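(* Let $p:\mathbb{N}\to[0,1]$ satisfy one of the following: (a) (Density) $p(n)\to \tilde p$ for some $\tilde p>0$; (b) (Root growth) $p(n)=Kn^{-\beta}$ for some $K>0$ and $0<\beta<1$; (c) (Logarithmic growth) $p(n)=K\frac{\log n}{n}$ for some $K>0$. Let $\mu_n$ be the distribution that samples a graph $G\sim \mathrm{ER}(n,p(n))$ and independently assigns to each node an i.i.d. feature vector drawn from a fixed bounded distribution on $\mathbb{R}^d$. Then every closed term of the language $\mathrm{Agg}[\mathrm{WMean},\mathrm{RW}]$ converges asymptotically almost surely with respect to $(\mu_n)_{n\in\mathbb{N}}$.
   Context: Graphs are finite simple undirected graphs; $N(v)$ denotes the set of neighbours of a node $v$ and $d(v)=|N(v)|$. $\mathrm{ER}(n,p)$ is the Erdős–Rényi graph on $n$ nodes, each edge present independently with probability $p$. Each node $v$ carries a feature vector $H_G(v)$. Fix $k_0\in\mathbb{N}$; for a node $v$, $\mathrm{rw}(v)\in\mathbb{R}^{k_0}$ is the vector whose $j$-th entry is the probability that a simple random walk of $j$ steps started at $v$ is at $v$ after $j$ steps ($\mathrm{rw}(v)=0$ if $v$ is isolated). Terms of $\mathrm{Agg}[\mathrm{WMean},\mathrm{RW}]$ with free node variables $x_1,\dots,x_k$ are built as follows; a term $\tau(x_1,\dots,x_k)$ is interpreted in a graph $G$ at a $k$-tuple of nodes $\bar u$ as a vector $[\![\tau(\bar u)]\!]_G\in\mathbb{R}^e$ (for some dimension $e$ depending on the term): (i) $H(x_i)$, interpreted as $H_G(u_i)$; (ii) any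 constant vector $c$; (iii) $\mathrm{rw}(x_i)$, interpreted as $\mathrm{rw}(u_i)$; (iv) $f(\rho_1,\dots,\rho_r)$ for terms $\rho_j$ and a Lipschitz function $f$, interpreted as $f([\![\rho_1(\bar u)]\!],\dots,[\![\rho_r(\bar u)]\!])$; (v) global weighted mean $\sum_y \rho(\bar x,y)\star h(\eta(\bar x,y))$, where $\rho,\eta$ are terms, $\rho$ takes values in $\mathbb{R}^e$, and $h$ is a function with values in $(0,\infty)^e$ which is Lipschitz on bounded sets; interpreted as $\big(\sum_{v\in V(G)}[\![\rho(\bar u,v)]\!]\odot h([\![\eta(\bar u,v)]\!])\big)\oslash\big(\sum_{v\in V(G)}h([\![\eta(\bar u,v)]\!])\big)$, with $\odot,\oslash$ componentwise product and division; (vi) local weighted mean $\sum_{y\in N(x_i)}\rho(\bar x,y)\star h(\eta(\bar x,y))$, interpreted as in (v) but with both sums over $v\in N(u_i)$, and as $0$ if $N(u_i)=\emptyset$. A closed term $\tau$ (no free variables) has a value $[\![\tau]\!]_G$ depending only on the featured graph $G$. It converges asymptotically almost surely (a.a.s.) with respect to $(\mu_n)$ if there is a constant vector $z$ such that for all $\epsilon,\theta>0$ there is $N$ with $\Pr_{G\sim\mu_n}(\|[\![\tau]\!]_G-z\|<\epsilon)\ge 1-\theta$ for all $n\ge N$. *)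

theory Defs
  imports "HOL-Analysis.Analysis" "HOL-Probability.Probability"
begin

section \<open>Vectors in R^e represented as real lists of length e\<close>

definition lnorm :: "real list \<Rightarrow> real" where
  "lnorm xs = sqrt (sum_list (map (\<lambda>x. x\<^sup>2) xs))"

definition ldist :: "real list \<Rightarrow> real list \<Rightarrow> real" where
  "ldist xs ys = lnorm (map2 (-) xs ys)"

definition lipschitz_vec :: "nat \<Rightarrow> nat \<Rightarrow> (real list \<Rightarrow> real list) \<Rightarrow> bool" where
  "lipschitz_vec m e f \<longleftrightarrow>
     (\<forall>x. length x = m \<longrightarrow> length (f x) = e) \<and>
     (\<exists>L. \<forall>x y. length x = m \<longrightarrow> length y = m \<longrightarrow> ldist (f x) (f y) \<le> L * ldist x y)"

definition pos_loc_lipschitz_vec :: "nat \<Rightarrow> nat \<Rightarrow> (real list \<Rightarrow> real list) \<Rightarrow> bool" where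
  "pos_loc_lipschitz_vec m e h \<longleftrightarrow>
     (\<forall>x. length x = m \<longrightarrow> length (h x) = e \<and> (\<forall>i<e. h x ! i > 0)) \<and>
     (\<forall>B. \<exists>L. \<forall>x y. length x = m \<longrightarrow> length y = m \<longrightarrow> lnorm x \<le> B \<longrightarrow> lnorm y \<le> B \<longrightarrow>
           ldist (h x) (h y) \<le> L * ldist x y)"

section \<open>Graphs on vertex set {0..<n}; edges are 2-element sets\<close>

definition nbrs :: "nat set set \<Rightarrow> nat \<Rightarrow> nat \<Rightarrow> nat set" where
  "nbrs Es n v = {u. u < n \<and> u \<noteq> v \<and> {u, v} \<in> Es}"

definition ER :: "nat \<Rightarrow> real \<Rightarrow> nat set set pmf" where
  "ER n p = map_pmf (\<lambda>b. {{i, j} | i j. i < j \<and> j < n \<and> b (i, j)})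
              (Pi_pmf {(i, j). i < j \<and> j < n} False (\<lambda>_. bernoulli_pmf p))"

fun walkp :: "nat set set \<Rightarrow> nat \<Rightarrow> nat \<Rightarrow> nat \<Rightarrow> nat \<Rightarrow> real" where
  "walkp Es n 0 u w = (if u = w then 1 else 0)"
| "walkp Es n (Suc j) u w =
     (\<Sum>x\<in>nbrs Es n u. walkp Es n j x w / real (card (nbrs Es n u)))"

definition rw :: "nat \<Rightarrow> nat set set \<Rightarrow> nat \<Rightarrow> nat \<Rightarrow> real list" where
  "rw k0 Es n v = (if nbrs Es n v = {} then replicate k0 0
                   else map (\<lambda>j. walkp Es n j v v) [1..<k0 + 1])"

definition idx_list :: "'d::finite list" where
  "idx_list = (SOME xs. distinct xs \<and> set xs = UNIV)"

definition vec_to_list :: "real ^ 'd::finite \<Rightarrow> real list" where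
  "vec_to_list x = map (vec_nth x) idx_list"

text \<open>Node variables are x_0, x_1, ...; in a mean the bound variable y is the next
  variable index (the number of free variables of the surrounding term).
  The nat field of GMean/LMean is the output dimension e.\<close>
datatype aterm =
    Feat nat
  | Cst "real list"
  | RW nat
  | App "real list \<Rightarrow> real list" "aterm list"
  | GMean nat aterm "real list \<Rightarrow> real list" aterm
  | LMean nat nat aterm "real list \<Rightarrow> real list" aterm

text \<open>wf d k0 k t e: t is a term with free variables among x_0..x_{k-1}, of dimension e\<close>
inductive wf :: "nat \<Rightarrow> nat \<Rightarrow> nat \<Rightarrow> aterm \<Rightarrow> nat \<Rightarrow> bool" for d k0 where
  wf_Feat: "i < k \<Longrightarrow> wf d k0 k (Feat i) d"
| wf_Cst: "wf d k0 k (Cst c) (length c)"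
| wf_RW: "i < k \<Longrightarrow> wf d k0 k (RW i) k0"
| wf_App: "list_all2 (wf d k0 k) ts es \<Longrightarrow> lipschitz_vec (sum_list es) e f
           \<Longrightarrow> wf d k0 k (App f ts) e"
| wf_GMean: "wf d k0 (Suc k) \<rho> e \<Longrightarrow> wf d k0 (Suc k) \<eta> m \<Longrightarrow> pos_loc_lipschitz_vec m e h
           \<Longrightarrow> wf d k0 k (GMean e \<rho> h \<eta>) e"
| wf_LMean: "i < k \<Longrightarrow> wf d k0 (Suc k) \<rho> e \<Longrightarrow> wf d k0 (Suc k) \<eta> m
           \<Longrightarrow> pos_loc_lipschitz_vec m e h
           \<Longrightarrow> wf d k0 k (LMean i e \<rho> h \<eta>) e"

definition wmean :: "nat \<Rightarrow> nat set \<Rightarrow> (nat \<Rightarrow> real list) \<Rightarrow> (nat \<Rightarrow> real list) \<Rightarrow> real list" where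
  "wmean e A r w = map (\<lambda>i. (\<Sum>v\<in>A. r v ! i * w v ! i) / (\<Sum>v\<in>A. w v ! i)) [0..<e]"

fun sem :: "nat \<Rightarrow> nat \<Rightarrow> nat set set \<Rightarrow> (nat \<Rightarrow> real ^ 'd::finite) \<Rightarrow> nat list \<Rightarrow> aterm \<Rightarrow> real list" where
  "sem k0 n Es H us (Feat i) = vec_to_list (H (us ! i))"
| "sem k0 n Es H us (Cst c) = c"
| "sem k0 n Es H us (RW i) = rw k0 Es n (us ! i)"
| "sem k0 n Es H us (App f ts) = f (concat (map (sem k0 n Es H us) ts))"
| "sem k0 n Es H us (GMean e \<rho> h \<eta>) =
     wmean e {..<n} (\<lambda>v. sem k0 n Es H (us @ [v]) \<rho>) (\<lambda>v. h (sem k0 n Es H (us @ [v]) \<eta>))"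
| "sem k0 n Es H us (LMean i e \<rho> h \<eta>) =
     (if nbrs Es n (us ! i) = {} then replicate e 0 else
      wmean e (nbrs Es n (us ! i)) (\<lambda>v. sem k0 n Es H (us @ [v]) \<rho>) (\<lambda>v. h (sem k0 n Es H (us @ [v]) \<eta>)))"

definition featured_ER :: "(nat \<Rightarrow> real) \<Rightarrow> (real ^ 'd::finite) measure \<Rightarrow> nat
     \<Rightarrow> (nat set set \<times> (nat \<Rightarrow> real ^ 'd)) measure" where
  "featured_ER p F n = measure_pmf (ER n (p n)) \<Otimes>\<^sub>M PiM {..<n} (\<lambda>_. F)"

definition closed_term_aas_converges :: "nat \<Rightarrow> (nat \<Rightarrow> real) \<Rightarrow> (real ^ 'd::finite) measure
     \<Rightarrow> nat \<Rightarrow> aterm \<Rightarrow> bool" where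
  "closed_term_aas_converges k0 p F e t \<longleftrightarrow>
     (\<exists>z. length z = e \<and>
       (\<forall>\<epsilon>>0. \<forall>\<theta>>0. \<exists>N. \<forall>n\<ge>N.
          measure (featured_ER p F n)
            {\<omega> \<in> space (featured_ER p F n).
               ldist (sem k0 n (fst \<omega>) (snd \<omega>) [] t) z < \<epsilon>} \<ge> 1 - \<theta>))"

end

(* Fix a tuple us of distinct nodes and condition on its adjacency type t, the graph induced on it.
   A term X is controlled if there are limit functions e t of the features of us such that
   the conditional mean of |X(us) - e t (H us)| tends to 0, uniformly in us.
   Averaging a controlled term over one more node v, taken from all nodes or from the
   neighbours of one node of us, again gives something controlled: by induction X(us, v) may
   be replaced by its limit function, and what remains is a sum of functions of the pair
   (adjacency of v to us, feature of v).  These pairs are i.i.d. over v outside us, so a second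
   moment estimate suffices.  The only facts about p this uses are that p(n) converges and
   n p(n) tends to infinity, which the three regimes share.  Since only one tuple is considered
   at a time, nodes of small degree need no separate treatment.  A return probability is an iterated
   local mean of the indicator that the walk has reached its target, so it is controlled as well, with limit 0. *)
theory Submission
  imports Defs "HOL-Real_Asymp.Real_Asymp"
begin

section \<open>Edge patterns in the random graph\<close>

text \<open>In the sparse regimes a type that contains an edge has probability tending to 0, so an
  error that is small in absolute terms says nothing about what is seen from a neighbour. Hence the
  error is measured relative to the type: E[1(type = t) |X - e t|] \<le> \<epsilon> P(type = t).
  This form survives a mean over neighbours: attaching one more node with pattern A multiplies
  P(type = t) by a factor q_A, there are at most n candidates, and n q_A \<le> n p^|I| is bounded by
  what the sum is divided by. No division by P(type = t) occurs, so types of probability 0 are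
  harmless. The mean absolute error is used because it passes through the sum over the new node
  without any independence; independence enters only in two fluctuation terms, one for the edges
  with the features frozen and one for the features. A weighted mean is a quotient of two averages
  with the same deterministic normalisation n p^|I|. Only the limiting denominator has to stay away
  from 0; the actual one may vanish, since the quotient is bounded anyway.\<close>

definition pairs :: "nat \<Rightarrow> (nat \<times> nat) set" where
  "pairs n = {(i, j). i < j \<and> j < n}"

definition doubleton :: "nat \<times> nat \<Rightarrow> nat set" where
  "doubleton x = {fst x, snd x}"

definition edges :: "nat \<Rightarrow> nat set set" where
  "edges n = doubleton ` pairs n"

text \<open>The probability that a p-biased random subset agrees with \<open>T\<close> on all of
  \<open>S\<close>. The element type is left open because the same product is needed for sets of
  edges and for sets of positions in a tuple.\<close>

definition cyl_prob :: "real \<Rightarrow> 'a set \<Rightarrow> 'a set \<Rightarrow> real" where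
  "cyl_prob p S T = (\<Prod>s\<in>S. if s \<in> T then p else 1 - p)"

lemma finite_pairs [simp]: "finite (pairs n)"
  by (rule finite_subset[of _ "{..<n} \<times> {..<n}"]) (auto simp: pairs_def)

lemma finite_edges [simp]: "finite (edges n)"
  by (simp add: edges_def)

lemma inj_on_doubleton: "inj_on doubleton (pairs n)"
  by (auto simp: inj_on_def doubleton_eq_iff doubleton_def pairs_def)

lemma doubleton_in_edges:
  assumes "u < n" "v < n" "u \<noteq> v"
  shows "{u, v} \<in> edges n"
proof (cases "u < v")
  case True
  then show ?thesis
    unfolding edges_def using assms by (intro image_eqI[of _ _ "(u, v)"]) (auto simp: doubleton_def pairs_def)
next
  case False
  then show ?thesis
    unfolding edges_def using assms by (intro image_eqI[of _ _ "(v, u)"]) (auto simp: doubleton_def pairs_def)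
qed

lemma ER_eq: "ER n p = map_pmf (\<lambda>b. doubleton ` {x \<in> pairs n. b x}) (Pi_pmf (pairs n) False (\<lambda>_. bernoulli_pmf p))"
proof -
  have "{{i, j} | i j. i < j \<and> j < n \<and> b (i, j)} = doubleton ` {x \<in> pairs n. b x}" for b
    unfolding image_def Bex_def mem_Collect_eq split_paired_Ex
    by (intro Collect_cong) (auto simp: doubleton_def pairs_def)
  then show ?thesis
    unfolding ER_def pairs_def by simp
qed

lemma set_pmf_ER: "set_pmf (ER n p) \<subseteq> Pow (edges n)"
  by (auto simp: ER_eq edges_def)

lemma cyl_prob_Un: "finite S \<Longrightarrow> finite S' \<Longrightarrow> S \<inter> S' = {} \<Longrightarrow> cyl_prob p (S \<union> S') T = cyl_prob p S T * cyl_prob p S' T"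
  by (simp add: cyl_prob_def prod.union_disjoint)

lemma cyl_prob_cong: "(\<And>s. s \<in> S \<Longrightarrow> s \<in> T \<longleftrightarrow> s \<in> T') \<Longrightarrow> cyl_prob p S T = cyl_prob p S T'"
  by (auto simp: cyl_prob_def intro!: prod.cong)

text \<open>Pulled back to the independent coin flips, the cylinder is a rectangle, and the measure
  of a rectangle is a product. Injectivity of \<open>doubleton\<close> lets the product run over
  edges instead of ordered pairs.\<close>

lemma ER_cylinder:
  assumes "0 \<le> p" "p \<le> 1" "S \<subseteq> edges n"
  shows "measure_pmf.prob (ER n p) {G. \<forall>s\<in>S. s \<in> G \<longleftrightarrow> s \<in> T} = cyl_prob p S T"
proof -
  \<comment> \<open>Coordinates outside \<open>S\<close> are unconstrained and contribute the factor
    1.\<close>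
  define B where "B = (\<lambda>x. if doubleton x \<in> S then {doubleton x \<in> T} else UNIV)"
  have "(\<lambda>b. doubleton ` {x \<in> pairs n. b x}) -` {G. \<forall>s\<in>S. s \<in> G \<longleftrightarrow> s \<in> T} = Pi (pairs n) B"
  proof (rule set_eqI)
    fix b
    have mem: "doubleton x \<in> doubleton ` {x \<in> pairs n. b x} \<longleftrightarrow> b x" if "x \<in> pairs n" for x
      using inj_on_image_mem_iff[OF inj_on_doubleton that, of "{x\<in>pairs n. b x}"] that by auto
    have "(\<forall>s\<in>S. s \<in> doubleton ` {x \<in> pairs n. b x} \<longleftrightarrow> s \<in> T)
       \<longleftrightarrow> (\<forall>x\<in>pairs n. doubleton x \<in> S \<longrightarrow> (b x \<longleftrightarrow> doubleton x \<in> T))" (is "?P \<longleftrightarrow> ?Q")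
    proof
      assume ?P
      then show ?Q using mem by blast
    next
      assume Q: ?Q
      show ?P
      proof
        fix s assume "s \<in> S"
        then obtain x where "x \<in> pairs n" "s = doubleton x" using assms(3) unfolding edges_def by blast
        then show "s \<in> doubleton ` {x \<in> pairs n. b x} \<longleftrightarrow> s \<in> T" using mem Q \<open>s \<in> S\<close> by blast
      qed
    qed
    also have "\<dots> \<longleftrightarrow> b \<in> Pi (pairs n) B" by (auto simp: Pi_def B_def)
    finally show "b \<in> (\<lambda>b. doubleton ` {x \<in> pairs n. b x}) -` {G. \<forall>s\<in>S. s \<in> G \<longleftrightarrow> s \<in> T} \<longleftrightarrow> b \<in> Pi (pairs n) B"
      by simp
  qed
  then have "measure_pmf.prob (ER n p) {G. \<forall>s\<in>S. s \<in> G \<longleftrightarrow> s \<in> T}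
      = (\<Prod>x\<in>pairs n. measure_pmf.prob (bernoulli_pmf p) (B x))"
    unfolding ER_eq measure_map_pmf by (simp only: measure_Pi_pmf_Pi finite_pairs)
  also have "\<dots> = (\<Prod>x\<in>pairs n. if doubleton x \<in> S then (if doubleton x \<in> T then p else 1 - p) else 1)"
    using assms by (intro prod.cong) (auto simp: measure_pmf_single B_def)
  also have "\<dots> = (\<Prod>s\<in>edges n. if s \<in> S then (if s \<in> T then p else 1 - p) else 1)"
    unfolding edges_def prod.reindex[OF inj_on_doubleton] o_def ..
  also have "\<dots> = (\<Prod>s\<in>{s\<in>edges n. s \<in> S}. (if s \<in> T then p else 1 - p))"
    by (rule prod.inter_filter[symmetric]) simp
  also have "{s\<in>edges n. s \<in> S} = S" using assms by auto
  finally show ?thesis by (simp add: cyl_prob_def)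
qed

text \<open>An event that depends only on the edges in \<open>S0\<close> is a finite disjoint union
  of cylinders over \<open>S0\<close>, one for each \<open>U \<subseteq> S0\<close> satisfying the
  predicate; each of them factorises against a cylinder over the disjoint set
  \<open>S\<close>.\<close>

lemma ER_indep:
  assumes p: "0 \<le> p" "p \<le> 1" and S: "S \<subseteq> edges n" "S0 \<subseteq> edges n" "S0 \<inter> S = {}"
    and dep: "\<And>G. \<phi> G \<longleftrightarrow> \<phi> (G \<inter> S0)"
  shows "measure_pmf.prob (ER n p) {G. \<phi> G \<and> (\<forall>s\<in>S. s \<in> G \<longleftrightarrow> s \<in> T)}
       = measure_pmf.prob (ER n p) {G. \<phi> G} * cyl_prob p S T"
proof -
  have fin: "finite S" "finite S0" using S finite_subset[OF _ finite_edges] by auto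
  \<comment> \<open>Stated for a variable \<open>S'\<close> so that \<open>S' = S\<close> gives the
    joint event and \<open>S' = {}\<close> the marginal. The intersection
    \<open>T \<inter> S'\<close> keeps \<open>T\<close> from prescribing edges inside
    \<open>S0\<close>.\<close>
  have split: "measure_pmf.prob (ER n p) {G. \<phi> G \<and> (\<forall>s\<in>S'. s \<in> G \<longleftrightarrow> s \<in> T)} =
      (\<Sum>U\<in>{U\<in>Pow S0. \<phi> U}. measure_pmf.prob (ER n p) {G. \<forall>s\<in>S0 \<union> S'. s \<in> G \<longleftrightarrow> s \<in> U \<union> (T \<inter> S')})"
    if "S0 \<inter> S' = {}" for S'
  proof -
    have "{G. \<phi> G \<and> (\<forall>s\<in>S'. s \<in> G \<longleftrightarrow> s \<in> T)}
        = (\<Union>U\<in>{U\<in>Pow S0. \<phi> U}. {G. \<forall>s\<in>S0 \<union> S'. s \<in> G \<longleftrightarrow> s \<in> U \<union> (T \<inter> S')})" (is "?l = ?r")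
    proof (intro equalityI subsetI)
      fix G assume "G \<in> ?l"
      then have "G \<inter> S0 \<in> {U\<in>Pow S0. \<phi> U}" "G \<in> {Ga. \<forall>s\<in>S0 \<union> S'. s \<in> Ga \<longleftrightarrow> s \<in> (G \<inter> S0) \<union> (T \<inter> S')}"
        using that dep[of G] by auto
      then show "G \<in> ?r" by blast
    next
      fix G assume "G \<in> ?r"
      then obtain U where U: "U \<subseteq> S0" "\<phi> U" "\<forall>s\<in>S0 \<union> S'. s \<in> G \<longleftrightarrow> s \<in> U \<union> (T \<inter> S')" by auto
      then have "G \<inter> S0 = U" using that by auto
      then have "\<phi> G" using dep[of G] U by simp
      then show "G \<in> ?l" using U that by auto
    qed
    moreover have "disjoint_family_on (\<lambda>U. {G. \<forall>s\<in>S0 \<union> S'. s \<in> G \<longleftrightarrow> s \<in> U \<union> (T \<inter> S')}) {U\<in>Pow S0. \<phi> U}"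
      unfolding disjoint_family_on_def
    proof (intro ballI impI)
      fix U U' assume U: "U \<in> {U\<in>Pow S0. \<phi> U}" "U' \<in> {U\<in>Pow S0. \<phi> U}" "U \<noteq> U'"
      have "U = U'" if G: "\<forall>s\<in>S0 \<union> S'. s \<in> G \<longleftrightarrow> s \<in> U \<union> (T \<inter> S')" "\<forall>s\<in>S0 \<union> S'. s \<in> G \<longleftrightarrow> s \<in> U' \<union> (T \<inter> S')" for G
        using U(1,2) G \<open>S0 \<inter> S' = {}\<close> by blast
      then show "{G. \<forall>s\<in>S0 \<union> S'. s \<in> G \<longleftrightarrow> s \<in> U \<union> (T \<inter> S')} \<inter> {G. \<forall>s\<in>S0 \<union> S'. s \<in> G \<longleftrightarrow> s \<in> U' \<union> (T \<inter> S')} = {}"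
        using U(3) by blast
    qed
    moreover have "finite {U\<in>Pow S0. \<phi> U}" using fin by simp
    ultimately show ?thesis
      by (simp only:) (rule measure_pmf.finite_measure_finite_Union, simp_all)
  qed
  have "measure_pmf.prob (ER n p) {G. \<phi> G \<and> (\<forall>s\<in>S. s \<in> G \<longleftrightarrow> s \<in> T)}
     = (\<Sum>U\<in>{U\<in>Pow S0. \<phi> U}. cyl_prob p (S0 \<union> S) (U \<union> (T \<inter> S)))"
    using S p by (subst split) (auto simp del: Un_iff intro!: sum.cong ER_cylinder)
  also have "\<dots> = (\<Sum>U\<in>{U\<in>Pow S0. \<phi> U}. cyl_prob p S0 U * cyl_prob p S T)"
  proof (rule sum.cong)
    fix U assume U: "U \<in> {U\<in>Pow S0. \<phi> U}"
    have "cyl_prob p S0 (U \<union> (T \<inter> S)) = cyl_prob p S0 U" "cyl_prob p S (U \<union> (T \<inter> S)) = cyl_prob p S T"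
      using U S by (auto intro!: cyl_prob_cong)
    then show "cyl_prob p (S0 \<union> S) (U \<union> (T \<inter> S)) = cyl_prob p S0 U * cyl_prob p S T"
      using S fin by (simp add: cyl_prob_Un)
  qed simp
  also have "\<dots> = (\<Sum>U\<in>{U\<in>Pow S0. \<phi> U}. cyl_prob p S0 U) * cyl_prob p S T"
    by (simp add: sum_distrib_right)
  also have "(\<Sum>U\<in>{U\<in>Pow S0. \<phi> U}. cyl_prob p S0 U) = measure_pmf.prob (ER n p) {G. \<phi> G}"
    using split[of "{}"] S p by (simp add: ER_cylinder)
  finally show ?thesis .
qed

section \<open>Locally Lipschitz functions of real lists\<close>

lemma lnorm_L2_set: "lnorm xs = L2_set (\<lambda>j. xs ! j) {..<length xs}"
  unfolding lnorm_def L2_set_def sum_list_sum_nth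
  by (auto intro!: arg_cong[where f = sqrt] sum.cong)

lemma ldist_L2_set:
  "length xs = m \<Longrightarrow> length ys = m \<Longrightarrow> ldist xs ys = L2_set (\<lambda>j. xs ! j - ys ! j) {..<m}"
  unfolding ldist_def lnorm_L2_set by (auto intro!: L2_set_cong)

lemma abs_le_L2_set: "finite A \<Longrightarrow> i \<in> A \<Longrightarrow> \<bar>f i\<bar> \<le> L2_set f A"
  using member_le_L2_set[of A i "\<lambda>i. \<bar>f i\<bar>"] by (simp add: L2_set_def)

text \<open>Boxes replace Euclidean balls because every coordinate of a term is treated as a
  separate scalar functional; likewise \<open>local_lipschitz\<close> uses the sum of the coordinate
  errors, whose expectation splits by linearity.\<close>

definition boxed :: "nat \<Rightarrow> real \<Rightarrow> real list \<Rightarrow> bool" where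
  "boxed m B x \<longleftrightarrow> length x = m \<and> (\<forall>j<m. \<bar>x ! j\<bar> \<le> B)"

definition local_lipschitz :: "nat \<Rightarrow> (real list \<Rightarrow> real) \<Rightarrow> bool" where
  "local_lipschitz m g \<longleftrightarrow> (\<forall>B. \<exists>L\<ge>0. \<forall>x y. boxed m B x \<longrightarrow> boxed m B y \<longrightarrow>
      \<bar>g x - g y\<bar> \<le> L * (\<Sum>j<m. \<bar>x ! j - y ! j\<bar>))"

lemma local_lipschitz_of_ldist:
  assumes len: "\<And>x. length x = m \<Longrightarrow> length (f x) = e" and i: "i < e"
    and lip: "\<And>B. \<exists>L. \<forall>x y. length x = m \<longrightarrow> length y = m \<longrightarrow> lnorm x \<le> B \<longrightarrow> lnorm y \<le> B \<longrightarrow>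
                ldist (f x) (f y) \<le> L * ldist x y"
  shows "local_lipschitz m (\<lambda>x. f x ! i)"
  unfolding local_lipschitz_def
proof
  fix B :: real
  \<comment> \<open>The Euclidean norm is at most the sum of the absolute coordinates, so the box of
    half-width B in dimension m lies in the ball of radius m B.\<close>
  obtain L where L: "\<And>x y. length x = m \<Longrightarrow> length y = m \<Longrightarrow> lnorm x \<le> m * B \<Longrightarrow> lnorm y \<le> m * B \<Longrightarrow>
                ldist (f x) (f y) \<le> L * ldist x y" using lip[of "m * B"] by auto
  have box: "length x = m \<and> lnorm x \<le> m * B" if "boxed m B x" for x
  proof -
    have "lnorm x \<le> (\<Sum>j<m. \<bar>x ! j\<bar>)"
      using L2_set_le_sum_abs[of "\<lambda>j. x ! j" "{..<m}"] that by (simp add: lnorm_L2_set boxed_def)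
    also have "\<dots> \<le> (\<Sum>j<m. B)" using that by (intro sum_mono) (auto simp: boxed_def)
    finally show ?thesis using that by (simp add: boxed_def)
  qed
  \<comment> \<open>The given constant may be negative; \<open>\<bar>L\<bar>\<close> keeps the
    estimates monotone.\<close>
  have "\<bar>f x ! i - f y ! i\<bar> \<le> \<bar>L\<bar> * (\<Sum>j<m. \<bar>x ! j - y ! j\<bar>)" if x: "boxed m B x" and y: "boxed m B y" for x y
  proof -
    note bx = box[OF x] and byy = box[OF y]
    have "\<bar>f x ! i - f y ! i\<bar> \<le> ldist (f x) (f y)"
      using bx byy len i abs_le_L2_set[of "{..<e}" i "\<lambda>j. f x ! j - f y ! j"] by (simp add: ldist_L2_set[of _ e])
    also have "\<dots> \<le> L * ldist x y" using L bx byy by simp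
    also have "\<dots> \<le> \<bar>L\<bar> * ldist x y"
      using bx byy by (intro mult_right_mono) (auto simp: ldist_L2_set[of _ m])
    also have "\<dots> \<le> \<bar>L\<bar> * (\<Sum>j<m. \<bar>x ! j - y ! j\<bar>)"
      using bx byy by (intro mult_left_mono) (auto simp: ldist_L2_set[of _ m] L2_set_le_sum_abs)
    finally show ?thesis .
  qed
  then show "\<exists>L\<ge>0. \<forall>x y. boxed m B x \<longrightarrow> boxed m B y \<longrightarrow>
      \<bar>f x ! i - f y ! i\<bar> \<le> L * (\<Sum>j<m. \<bar>x ! j - y ! j\<bar>)"
    by (intro exI[of _ "\<bar>L\<bar>"]) auto
qed

lemma lipschitz_vec_local_lipschitz: "lipschitz_vec m e f \<Longrightarrow> i < e \<Longrightarrow> local_lipschitz m (\<lambda>x. f x ! i)"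
  by (rule local_lipschitz_of_ldist[of m f e]) (auto simp: lipschitz_vec_def)

lemma pos_loc_lipschitz_vec_local_lipschitz: "pos_loc_lipschitz_vec m e h \<Longrightarrow> i < e \<Longrightarrow> local_lipschitz m (\<lambda>x. h x ! i)"
  by (rule local_lipschitz_of_ldist[of m h e]) (auto simp: pos_loc_lipschitz_vec_def)

lemma local_lipschitz_bounded:
  assumes "local_lipschitz m g"
  shows "\<exists>C\<ge>0. \<forall>x. boxed m B x \<longrightarrow> \<bar>g x\<bar> \<le> C"
proof -
  obtain L where L: "L \<ge> 0" "\<And>x y. boxed m \<bar>B\<bar> x \<Longrightarrow> boxed m \<bar>B\<bar> y \<Longrightarrow>
      \<bar>g x - g y\<bar> \<le> L * (\<Sum>j<m. \<bar>x ! j - y ! j\<bar>)" using assms unfolding local_lipschitz_def by metis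
  define z where "z = replicate m (0::real)"
  \<comment> \<open>The comparison point 0 lies in the box only for a nonnegative half-width, hence
    \<open>\<bar>B\<bar>\<close>.\<close>
  have z: "boxed m \<bar>B\<bar> z" by (auto simp: boxed_def z_def)
  have "\<bar>g x\<bar> \<le> \<bar>g z\<bar> + L * (m * \<bar>B\<bar>)" if x: "boxed m B x" for x
  proof -
    have bx: "boxed m \<bar>B\<bar> x" using x by (force simp: boxed_def)
    have "\<bar>g x\<bar> \<le> \<bar>g z\<bar> + \<bar>g x - g z\<bar>" by simp
    also have "\<bar>g x - g z\<bar> \<le> L * (\<Sum>j<m. \<bar>x ! j - z ! j\<bar>)" using L(2)[OF bx z] .
    also have "(\<Sum>j<m. \<bar>x ! j - z ! j\<bar>) \<le> (\<Sum>j<m. \<bar>B\<bar>)"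
      using bx by (intro sum_mono) (auto simp: boxed_def z_def)
    finally show ?thesis using L(1) by (simp add: mult_left_mono)
  qed
  then show ?thesis using L(1) by (intro exI[of _ "\<bar>g z\<bar> + L * (m * \<bar>B\<bar>)"]) auto
qed

section \<open>Compactness and measurability through clipped coordinates\<close>

definition clip :: "real \<Rightarrow> real \<Rightarrow> real" where
  "clip B x = max (- B) (min B x)"

lemma clip_bound: "B \<ge> 0 \<Longrightarrow> \<bar>clip B x\<bar> \<le> B"
  by (auto simp: clip_def)

lemma clip_id: "\<bar>x\<bar> \<le> B \<Longrightarrow> clip B x = x"
  by (auto simp: clip_def)

text \<open>Clipping extends a function that is Lipschitz only on boxes of lists to a continuous
  function on all of \<open>nat \<Rightarrow> real\<close>, where compactness and Borel
  measurability can be used. Coordinates from m on are ignored.\<close>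

lemma continuous_on_local_lipschitz:
  assumes "local_lipschitz m g" "B \<ge> 0"
  shows "continuous_on UNIV (\<lambda>y::nat \<Rightarrow> real. g (map (\<lambda>j. clip B (y j)) [0..<m]))"
proof -
  obtain L where L: "L \<ge> 0" "\<And>x y. boxed m B x \<Longrightarrow> boxed m B y \<Longrightarrow>
      \<bar>g x - g y\<bar> \<le> L * (\<Sum>j<m. \<bar>x ! j - y ! j\<bar>)" using assms unfolding local_lipschitz_def by metis
  define \<phi> where "\<phi> = (\<lambda>y::nat \<Rightarrow> real. g (map (\<lambda>j. clip B (y j)) [0..<m]))"
  have "(\<phi> \<longlongrightarrow> \<phi> y) (at y)" for y
  proof -
    define s where "s = (\<lambda>z. L * (\<Sum>j<m. \<bar>clip B (z j) - clip B (y j)\<bar>))"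
    have "continuous_on UNIV s"
      unfolding s_def clip_def by (intro continuous_intros continuous_on_product_coordinates)
    then have "(s \<longlongrightarrow> s y) (at y)" by (simp add: continuous_on_def)
    then have s: "(s \<longlongrightarrow> 0) (at y)" by (simp add: s_def)
    have "\<bar>\<phi> z - \<phi> y\<bar> \<le> s z" for z
      unfolding \<phi>_def s_def
      by (rule order.trans[OF L(2)]) (use assms(2) in \<open>auto simp: boxed_def clip_bound\<close>)
    then have "((\<lambda>z. \<bar>\<phi> z - \<phi> y\<bar>) \<longlongrightarrow> 0) (at y)"
      by (intro tendsto_sandwich[OF _ _ tendsto_const s]) auto
    then show ?thesis by (simp add: tendsto_rabs_zero_iff LIM_zero_iff)
  qed
  then show ?thesis by (simp add: continuous_on_def \<phi>_def)
qed

text \<open>Turns pointwise positivity of a weight into a uniform lower bound, which later keeps the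
  denominators of weighted means away from 0. The clipped function attains its minimum on a cube of
  sequences, compact by Tychonoff, and is positive there.\<close>

lemma local_lipschitz_lower_bound:
  assumes "local_lipschitz m g" "\<And>x. length x = m \<Longrightarrow> g x > 0"
  shows "\<exists>c>0. \<forall>x. boxed m B x \<longrightarrow> c \<le> g x"
proof -
  let ?B = "\<bar>B\<bar>"
  define \<phi> where "\<phi> = (\<lambda>y::nat \<Rightarrow> real. g (map (\<lambda>j. clip ?B (y j)) [0..<m]))"
  have cont: "continuous_on (UNIV :: (nat \<Rightarrow> real) set) \<phi>" unfolding \<phi>_def using continuous_on_local_lipschitz[OF assms(1)] by simp
  have "compactin euclidean (PiE UNIV (\<lambda>_::nat. {- ?B..?B}))"
    unfolding euclidean_product_topology[symmetric] by (subst compactin_PiE) auto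
  then have "compact (PiE UNIV (\<lambda>_::nat. {- ?B..?B}))" by simp
  moreover have "(\<lambda>_. 0) \<in> PiE UNIV (\<lambda>_::nat. {- ?B..?B})" by auto
  ultimately obtain y where y: "\<And>z. z \<in> PiE UNIV (\<lambda>_::nat. {- ?B..?B}) \<Longrightarrow> \<phi> y \<le> \<phi> z"
    using continuous_attains_inf[of "PiE UNIV (\<lambda>_::nat. {- ?B..?B})" \<phi>] continuous_on_subset[OF cont] by blast
  have "\<phi> y \<le> g x" if x: "boxed m B x" for x
  proof -
    define z where "z = (\<lambda>j. if j < m then x ! j else 0)"
    have "z \<in> PiE UNIV (\<lambda>_::nat. {- ?B..?B})" using x by (fastforce simp: boxed_def z_def)
    moreover have "map (\<lambda>j. clip ?B (z j)) [0..<m] = x"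
      using x by (intro nth_equalityI) (force simp: boxed_def z_def intro!: clip_id)+
    ultimately show ?thesis using y[of z] by (simp add: \<phi>_def)
  qed
  moreover have "\<phi> y > 0" using assms(2) by (simp add: \<phi>_def)
  ultimately show ?thesis by blast
qed

text \<open>The bound on the \<open>X j\<close> makes clipping invisible on the space, so the
  function agrees with a measurable map followed by a continuous one.\<close>

lemma local_lipschitz_measurable:
  assumes g: "local_lipschitz m g" and X: "\<And>j. j < m \<Longrightarrow> X j \<in> borel_measurable M"
    and B: "\<And>j \<omega>. j < m \<Longrightarrow> \<omega> \<in> space M \<Longrightarrow> \<bar>X j \<omega>\<bar> \<le> B"
  shows "(\<lambda>\<omega>. g (map (\<lambda>j. X j \<omega>) [0..<m])) \<in> borel_measurable M"
proof -
  let ?Y = "\<lambda>\<omega> j. if j < m then X j \<omega> else 0"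
  have "?Y \<in> measurable M borel"
  proof (rule measurable_coordinatewise_then_product)
    show "(\<lambda>\<omega>. ?Y \<omega> i) \<in> borel_measurable M" for i
      by (cases "i < m") (auto simp: X)
  qed
  moreover have "(\<lambda>y::nat \<Rightarrow> real. g (map (\<lambda>j. clip \<bar>B\<bar> (y j)) [0..<m])) \<in> borel_measurable borel"
    by (rule borel_measurable_continuous_onI, rule continuous_on_local_lipschitz[OF g]) simp
  ultimately have "(\<lambda>\<omega>. g (map (\<lambda>j. clip \<bar>B\<bar> (?Y \<omega> j)) [0..<m])) \<in> borel_measurable M"
    by (rule measurable_compose)
  moreover have "g (map (\<lambda>j. clip \<bar>B\<bar> (?Y \<omega> j)) [0..<m]) = g (map (\<lambda>j. X j \<omega>) [0..<m])" if "\<omega> \<in> space M" for \<omega>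
    using B[OF _ that] by (intro arg_cong[where f = g] map_cong) (force intro!: clip_id)+
  ultimately show ?thesis
    using measurable_cong[of M "\<lambda>\<omega>. g (map (\<lambda>j. clip \<bar>B\<bar> (?Y \<omega> j)) [0..<m])" "\<lambda>\<omega>. g (map (\<lambda>j. X j \<omega>) [0..<m])" borel]
    by blast
qed

lemma local_lipschitz_mult: "local_lipschitz 2 (\<lambda>x. x ! 0 * x ! 1)"
  unfolding local_lipschitz_def
proof
  fix B
  have "\<bar>x ! 0 * x ! 1 - y ! 0 * y ! 1\<bar> \<le> \<bar>B\<bar> * (\<Sum>j<2. \<bar>x ! j - y ! j\<bar>)"
    if x: "boxed 2 B x" and y: "boxed 2 B y" for x y
  proof -
    have B: "\<bar>x ! 1\<bar> \<le> \<bar>B\<bar>" "\<bar>y ! 0\<bar> \<le> \<bar>B\<bar>" using x y by (force simp: boxed_def)+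
    have "x ! 0 * x ! 1 - y ! 0 * y ! 1 = (x ! 0 - y ! 0) * x ! 1 + y ! 0 * (x ! 1 - y ! 1)"
      by (simp add: algebra_simps)
    also have "\<bar>\<dots>\<bar> \<le> \<bar>x ! 0 - y ! 0\<bar> * \<bar>x ! 1\<bar> + \<bar>y ! 0\<bar> * \<bar>x ! 1 - y ! 1\<bar>"
      by (metis abs_mult abs_triangle_ineq)
    also have "\<dots> \<le> \<bar>x ! 0 - y ! 0\<bar> * \<bar>B\<bar> + \<bar>B\<bar> * \<bar>x ! 1 - y ! 1\<bar>"
      using B by (intro add_mono mult_mono) auto
    finally show ?thesis by (simp add: algebra_simps numeral_2_eq_2)
  qed
  then show "\<exists>L\<ge>0. \<forall>x y. boxed 2 B x \<longrightarrow> boxed 2 B y \<longrightarrow>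
      \<bar>x ! 0 * x ! 1 - y ! 0 * y ! 1\<bar> \<le> L * (\<Sum>j<2. \<bar>x ! j - y ! j\<bar>)"
    by (intro exI[of _ "\<bar>B\<bar>"]) auto
qed

section \<open>Adjacency types\<close>

text \<open>Positions rather than nodes are recorded, so that types of different tuples are
  comparable. With i < j the attachments of a node appended at position k are exactly the pairs with
  second entry k, and the extended type is \<open>t \<union> A \<times> {k}\<close>.\<close>

definition adj_type :: "nat set set \<Rightarrow> nat list \<Rightarrow> (nat \<times> nat) set" where
  "adj_type G us = {(i, j). i < j \<and> j < length us \<and> {us ! i, us ! j} \<in> G}"

definition attached :: "nat set set \<Rightarrow> nat list \<Rightarrow> nat \<Rightarrow> nat set" where
  "attached G us v = {i. i < length us \<and> {us ! i, v} \<in> G}"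

definition valid :: "nat \<Rightarrow> nat \<Rightarrow> nat list \<Rightarrow> bool" where
  "valid n k us \<longleftrightarrow> length us = k \<and> distinct us \<and> set us \<subseteq> {..<n}"

lemma valid_snoc: "valid n k us \<Longrightarrow> v < n \<Longrightarrow> v \<notin> set us \<Longrightarrow> valid n (Suc k) (us @ [v])"
  by (auto simp: valid_def)

lemma adj_type_snoc: "adj_type G (us @ [v]) = adj_type G us \<union> attached G us v \<times> {length us}"
  by (auto simp: adj_type_def attached_def nth_append less_Suc_eq split: if_splits)

lemma adj_type_subset: "adj_type G us \<subseteq> pairs (length us)"
  by (auto simp: adj_type_def pairs_def)

lemma attached_subset: "attached G us v \<subseteq> {..<length us}"
  by (auto simp: attached_def)

lemma adj_type_snoc_eq_iff:
  assumes "t \<subseteq> pairs (length us)" "A \<subseteq> {..<length us}"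
  shows "adj_type G (us @ [v]) = t \<union> A \<times> {length us} \<longleftrightarrow> adj_type G us = t \<and> attached G us v = A"
proof
  let ?k = "length us"
  assume *: "adj_type G (us @ [v]) = t \<union> A \<times> {?k}"
  \<comment> \<open>Both parts can be read off the union, since pairs inside the old tuple never
    have second entry \<open>?k\<close>.\<close>
  have dec: "t' = (t' \<union> A' \<times> {?k}) \<inter> pairs ?k" "A' = {i. (i, ?k) \<in> t' \<union> A' \<times> {?k}}" if "t' \<subseteq> pairs ?k" for t' A'
    using that by (auto simp: pairs_def)
  have "adj_type G us = (adj_type G us \<union> attached G us v \<times> {?k}) \<inter> pairs ?k" "attached G us v = {i. (i, ?k) \<in> adj_type G us \<union> attached G us v \<times> {?k}}"
    by (rule dec[OF adj_type_subset])+
  then show "adj_type G us = t \<and> attached G us v = A"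
    using dec[OF assms(1), of A] * unfolding adj_type_snoc by metis
qed (auto simp: adj_type_snoc)

lemma ext_subset: "t \<subseteq> pairs k \<Longrightarrow> A \<subseteq> {..<k} \<Longrightarrow> t \<union> A \<times> {k} \<subseteq> pairs (Suc k)"
  by (auto simp: pairs_def)

lemma cyl_prob_nonneg: "0 \<le> p \<Longrightarrow> p \<le> 1 \<Longrightarrow> 0 \<le> cyl_prob p S T"
  by (auto simp: cyl_prob_def intro!: prod_nonneg)

lemma cyl_prob_le_1: "0 \<le> p \<Longrightarrow> p \<le> 1 \<Longrightarrow> cyl_prob p S T \<le> 1"
  by (auto simp: cyl_prob_def intro!: prod_le_1)

text \<open>Isolates the factor p^|I| that the normalisation of an average cancels; what remains
  converges even when p tends to 0.\<close>

lemma cyl_prob_split: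
  assumes "finite S" "I \<subseteq> A" "I \<subseteq> S"
  shows "cyl_prob p S A = p ^ card I * cyl_prob p (S - I) A"
proof -
  have "S = I \<union> (S - I)" "finite I" using assms finite_subset by auto
  then have "cyl_prob p S A = cyl_prob p I A * cyl_prob p (S - I) A"
    using cyl_prob_Un[of I "S - I" p A] assms(1) by (metis Diff_disjoint finite_Diff)
  also have "cyl_prob p I A = (\<Prod>s\<in>I. p)" unfolding cyl_prob_def using assms by (intro prod.cong) auto
  finally show ?thesis by simp
qed

section \<open>Expectation over the graph and independence of attachments\<close>

locale er_features = prob_space F for F :: "'a measure" +
  fixes p :: "nat \<Rightarrow> real" and pt :: real
  assumes p_nonneg [simp]: "0 \<le> p n" and p_le_1 [simp]: "p n \<le> 1"
    and p_tendsto: "p \<longlonglongrightarrow> pt"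
    and np_at_top: "filterlim (\<lambda>n. real n * p n) at_top sequentially"
begin

sublocale P: product_sigma_finite "\<lambda>_::nat. F" ..

abbreviation PF :: "nat \<Rightarrow> (nat \<Rightarrow> 'a) measure" where
  "PF n \<equiv> PiM {..<n} (\<lambda>_. F)"

text \<open>The random graph is supported on subsets of \<open>edges n\<close>, so its expectation
  is a finite sum and linearity needs no integrability.\<close>

definition EG :: "nat \<Rightarrow> (nat set set \<Rightarrow> real) \<Rightarrow> real" where
  "EG n \<psi> = (\<Sum>G\<in>Pow (edges n). pmf (ER n (p n)) G * \<psi> G)"

abbreviation PG :: "nat \<Rightarrow> (nat set set \<Rightarrow> bool) \<Rightarrow> real" where
  "PG n \<phi> \<equiv> EG n (\<lambda>G. of_bool (\<phi> G))"

lemma EG_mono: "(\<And>G. G \<subseteq> edges n \<Longrightarrow> \<psi> G \<le> \<psi>' G) \<Longrightarrow> EG n \<psi> \<le> EG n \<psi>'"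
  unfolding EG_def by (intro sum_mono mult_left_mono) auto

lemma EG_cong: "(\<And>G. G \<subseteq> edges n \<Longrightarrow> \<psi> G = \<psi>' G) \<Longrightarrow> EG n \<psi> = EG n \<psi>'"
  unfolding EG_def by (intro sum.cong) auto

lemma EG_nonneg: "(\<And>G. G \<subseteq> edges n \<Longrightarrow> 0 \<le> \<psi> G) \<Longrightarrow> 0 \<le> EG n \<psi>"
  unfolding EG_def by (intro sum_nonneg mult_nonneg_nonneg) auto

lemma EG_add: "EG n (\<lambda>G. \<psi> G + \<psi>' G) = EG n \<psi> + EG n \<psi>'"
  by (simp add: EG_def algebra_simps sum.distrib)

lemma EG_diff: "EG n (\<lambda>G. \<psi> G - \<psi>' G) = EG n \<psi> - EG n \<psi>'"
  by (simp add: EG_def algebra_simps sum_subtractf)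

lemma EG_cmult: "EG n (\<lambda>G. c * \<psi> G) = c * EG n \<psi>"
  by (simp add: EG_def mult.left_commute sum_distrib_left)

lemma EG_cmult_right: "EG n (\<lambda>G. \<psi> G * c) = EG n \<psi> * c"
  by (simp add: EG_def mult.assoc sum_distrib_right)

lemma EG_sum: "EG n (\<lambda>G. \<Sum>a\<in>A. \<psi> a G) = (\<Sum>a\<in>A. EG n (\<psi> a))"
  by (induction A rule: infinite_finite_induct) (auto simp: EG_add, auto simp: EG_def)

lemma PG_eq_prob: "PG n \<phi> = measure_pmf.prob (ER n (p n)) {G. \<phi> G}"
proof -
  have "measure_pmf.prob (ER n (p n)) {G. \<phi> G} = measure_pmf.prob (ER n (p n)) {G\<in>Pow (edges n). \<phi> G}"
    by (intro measure_pmf.finite_measure_eq_AE) (use set_pmf_ER[of n "p n"] in \<open>auto simp: AE_measure_pmf_iff\<close>)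
  also have "\<dots> = (\<Sum>G\<in>{G\<in>Pow (edges n). \<phi> G}. pmf (ER n (p n)) G)"
    by (rule measure_measure_pmf_finite) simp
  also have "\<dots> = PG n \<phi>" unfolding EG_def
    by (simp only: sum.inter_filter finite_Pow_iff finite_edges) (rule sum.cong, auto)
  finally show ?thesis by simp
qed

lemma PG_nonneg [simp]: "0 \<le> PG n \<phi>" by (simp add: PG_eq_prob)

lemma PG_True: "EG n (\<lambda>_. 1) = 1"
  using PG_eq_prob[of n "\<lambda>_. True"] by simp

text \<open>The k potential edges from \<open>v\<close> to the tuple are distinct and none lies in
  \<open>S0\<close>, whose edges avoid \<open>v\<close>; so \<open>ER_indep\<close> applies. Leaving
  \<open>S0\<close> free allows an event that already speaks about another outside node.\<close>

lemma PG_attached: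
  assumes us: "valid n k us" and v: "v < n" "v \<notin> set us" and A: "A \<subseteq> {..<k}"
    and S0: "S0 \<subseteq> edges n" "\<And>s. s \<in> S0 \<Longrightarrow> v \<notin> s" and dep: "\<And>G. \<phi> G \<longleftrightarrow> \<phi> (G \<inter> S0)"
  shows "PG n (\<lambda>G. \<phi> G \<and> attached G us v = A) = PG n \<phi> * cyl_prob (p n) {..<k} A"
proof -
  define e where "e = (\<lambda>i. {us ! i, v})"
  have len: "length us = k" using us by (simp add: valid_def)
  have inj: "inj_on e {..<k}"
    using us v by (auto simp: inj_on_def e_def doubleton_eq_iff valid_def nth_eq_iff_index_eq)
  have "PG n (\<lambda>G. \<phi> G \<and> attached G us v = A) =
     measure_pmf.prob (ER n (p n)) {G. \<phi> G \<and> (\<forall>s\<in>e ` {..<k}. s \<in> G \<longleftrightarrow> s \<in> e ` A)}"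
  proof -
    have "attached G us v = A \<longleftrightarrow> (\<forall>s\<in>e ` {..<k}. s \<in> G \<longleftrightarrow> s \<in> e ` A)" for G
    proof -
      have "(\<forall>s\<in>e ` {..<k}. s \<in> G \<longleftrightarrow> s \<in> e ` A) \<longleftrightarrow> (\<forall>i<k. e i \<in> G \<longleftrightarrow> i \<in> A)"
        using inj_on_image_mem_iff[OF inj _ A] by auto
      also have "\<dots> \<longleftrightarrow> attached G us v = A" using A by (auto simp: attached_def e_def len)
      finally show ?thesis by simp
    qed
    then show ?thesis by (simp add: PG_eq_prob)
  qed
  also have "\<dots> = measure_pmf.prob (ER n (p n)) {G. \<phi> G} * cyl_prob (p n) (e ` {..<k}) (e ` A)"
  proof (rule ER_indep)
    show "e ` {..<k} \<subseteq> edges n"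
    proof
      fix s assume "s \<in> e ` {..<k}"
      then obtain i where i: "i < k" "s = {us ! i, v}" by (auto simp: e_def)
      then have "us ! i < n" "us ! i \<noteq> v" using us v nth_mem[of i us] by (auto simp: valid_def simp del: nth_mem)
      then show "s \<in> edges n"
        using us v i by (auto simp: valid_def intro!: doubleton_in_edges)
    qed
    show "S0 \<inter> e ` {..<k} = {}" using S0(2) by (auto simp: e_def)
  qed (use S0 dep in auto)
  also have "cyl_prob (p n) (e ` {..<k}) (e ` A) = cyl_prob (p n) {..<k} A"
    unfolding cyl_prob_def using inj_on_image_mem_iff[OF inj _ A]
    by (subst prod.reindex[OF inj]) (auto intro!: prod.cong)
  finally show ?thesis by (simp add: PG_eq_prob)
qed

context
  fixes n k us and t :: "(nat \<times> nat) set"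
  assumes us: "valid n k us"
begin

lemma adj_type_dep:
  defines "S0 \<equiv> {{a, b} | a b. a \<in> set us \<and> b \<in> set us \<and> a \<noteq> b}"
  shows "S0 \<subseteq> edges n" "adj_type G us = t \<longleftrightarrow> adj_type (G \<inter> S0) us = t" 
proof -
  show "S0 \<subseteq> edges n"
    using us by (auto simp: S0_def valid_def intro!: doubleton_in_edges)
  have "{us ! i, us ! j} \<in> S0" if "i < j" "j < length us" for i j
    using that us unfolding S0_def valid_def
    by (intro CollectI exI[of _ "us ! i"] exI[of _ "us ! j"]) (auto simp: nth_eq_iff_index_eq)
  then have "adj_type G us = adj_type (G \<inter> S0) us" by (auto simp: adj_type_def)
  then show "adj_type G us = t \<longleftrightarrow> adj_type (G \<inter> S0) us = t" by simp
qed

lemma PG_adj_type_attached: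
  assumes "v < n" "v \<notin> set us" "A \<subseteq> {..<k}"
  shows "PG n (\<lambda>G. adj_type G us = t \<and> attached G us v = A) = PG n (\<lambda>G. adj_type G us = t) * cyl_prob (p n) {..<k} A"
  by (rule PG_attached[OF us assms adj_type_dep(1)], use assms in blast, rule adj_type_dep(2))

text \<open>Given the type, the attachments of two outside nodes are independent, which is all that
  a second moment needs. \<open>PG_attached\<close> is used for \<open>w\<close> with the attachment
  of \<open>v\<close> as part of the event: the edges from \<open>v\<close> to the tuple avoid
  \<open>w\<close>.\<close>

lemma PG_adj_type_attached_attached:
  assumes v: "v < n" "v \<notin> set us" and w: "w < n" "w \<notin> set us" and A: "A \<subseteq> {..<k}" and "v \<noteq> w"
  shows "PG n (\<lambda>G. adj_type G us = t \<and> attached G us v = A \<and> attached G us w = A) = PG n (\<lambda>G. adj_type G us = t) * (cyl_prob (p n) {..<k} A)\<^sup>2"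
proof -
  define S0 where "S0 = {{a, b} | a b. a \<in> set us \<and> b \<in> set us \<and> a \<noteq> b}"
  define S1 where "S1 = (\<lambda>i. {us ! i, v}) ` {..<k}"
  have us_n: "us ! i < n" "us ! i \<noteq> v" "us ! i \<noteq> w" if "i < k" for i
    using us that v w nth_mem[of i us] by (auto simp: valid_def simp del: nth_mem)
  have "PG n (\<lambda>G. (adj_type G us = t \<and> attached G us v = A) \<and> attached G us w = A)
      = PG n (\<lambda>G. adj_type G us = t \<and> attached G us v = A) * cyl_prob (p n) {..<k} A"
  proof (rule PG_attached[OF us w A, where ?S0.0 = "S0 \<union> S1"])
    show "S0 \<union> S1 \<subseteq> edges n"
      using us_n v adj_type_dep(1) by (auto simp: S0_def S1_def intro!: doubleton_in_edges)
    show "w \<notin> s" if "s \<in> S0 \<union> S1" for s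
      using that w us_n \<open>v \<noteq> w\<close> by (auto simp: S0_def S1_def)
    show "adj_type G us = t \<and> attached G us v = A \<longleftrightarrow> adj_type (G \<inter> (S0 \<union> S1)) us = t \<and> attached (G \<inter> (S0 \<union> S1)) us v = A" for G
    proof -
      have "G \<inter> S0 = (G \<inter> (S0 \<union> S1)) \<inter> S0" by auto
      then have "adj_type G us = t \<longleftrightarrow> adj_type (G \<inter> (S0 \<union> S1)) us = t"
        using adj_type_dep(2)[of G] adj_type_dep(2)[of "G \<inter> (S0 \<union> S1)"] by (simp add: S0_def)
      moreover have "attached G us v = attached (G \<inter> (S0 \<union> S1)) us v"
        using us by (auto simp: attached_def S1_def valid_def)
      ultimately show ?thesis by simp
    qed
  qed
  then show ?thesis using PG_adj_type_attached[OF v A] by (simp add: power2_eq_square conj_assoc)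
qed

text \<open>Converts an error relative to the probability of a longer type into one relative to the
  probability of the shorter type.\<close>

lemma PG_adj_type_snoc:
  assumes "v < n" "v \<notin> set us" "A \<subseteq> {..<k}" "t \<subseteq> pairs k"
  shows "PG n (\<lambda>G. adj_type G (us @ [v]) = t \<union> A \<times> {k}) = PG n (\<lambda>G. adj_type G us = t) * cyl_prob (p n) {..<k} A"
  using PG_adj_type_attached[OF assms(1-3)] adj_type_snoc_eq_iff[of t us A] us assms by (simp add: valid_def)

end

end

section \<open>Expectations and fluctuations\<close>

text \<open>Plays the role of Cauchy-Schwarz: a second moment bounds a first absolute moment,
  pointwise and without square roots of expectations. The free parameter s will be sqrt m, where m
  is the normalisation of the average.\<close>

lemma abs_le_amgm: "s > 0 \<Longrightarrow> \<bar>x :: real\<bar> \<le> (1 / (2 * s)) * x\<^sup>2 + s / 2"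
proof -
  assume s: "s > 0"
  have "0 \<le> (\<bar>x\<bar> - s)\<^sup>2" by simp
  then have "2 * \<bar>x\<bar> * s \<le> x\<^sup>2 + s * s" by (simp add: power2_diff power2_eq_square algebra_simps)
  then show ?thesis using s by (simp add: field_simps power2_eq_square)
qed

text \<open>Features are renumbered by position. The restriction makes the result extensional, hence
  a point of the product space over k copies of \<open>F\<close>.\<close>

definition proj :: "nat list \<Rightarrow> (nat \<Rightarrow> 'a) \<Rightarrow> nat \<Rightarrow> 'a" where
  "proj us H = (\<lambda>i\<in>{..<length us}. H (us ! i))"

lemma proj_snoc: "proj (us @ [v]) H = (proj us H)(length us := H v)"
  by (auto simp: proj_def fun_eq_iff nth_append restrict_def)

lemma proj_upd: "v \<notin> set us \<Longrightarrow> proj us (H(v := y)) = proj us H"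
  by (auto simp: proj_def fun_eq_iff restrict_def)

lemma sum_sum_diag:
  assumes "finite V" and that: "\<And>v w. v \<in> V \<Longrightarrow> w \<in> V \<Longrightarrow> v \<noteq> w \<Longrightarrow> f v w = 0"
  shows "(\<Sum>v\<in>V. \<Sum>w\<in>V. f v w) = (\<Sum>v\<in>V. f v v :: real)"
proof (rule sum.cong[OF refl])
  fix v assume v: "v \<in> V"
  have "(\<Sum>w\<in>V. f v w) = (\<Sum>w\<in>V. if w = v then f v v else 0)"
    using that v by (intro sum.cong) auto
  then show "(\<Sum>w\<in>V. f v w) = f v v" using assms v by simp
qed

context er_features
begin

section \<open>Expectation over graph and features\<close>

lemma prob_space_PF: "prob_space (PF n)"
  by (rule prob_space_PiM) (rule prob_space_axioms)

text \<open>Bounded measurable functions are integrable here and, unlike integrable ones in general,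
  closed under products.\<close>

definition bounded_meas :: "nat \<Rightarrow> ((nat \<Rightarrow> 'a) \<Rightarrow> real) \<Rightarrow> bool" where
  "bounded_meas n f \<longleftrightarrow> f \<in> borel_measurable (PF n) \<and> (\<exists>B. \<forall>H\<in>space (PF n). \<bar>f H\<bar> \<le> B)"

lemma bmeasI: "f \<in> borel_measurable (PF n) \<Longrightarrow> (\<And>H. H \<in> space (PF n) \<Longrightarrow> \<bar>f H\<bar> \<le> B) \<Longrightarrow> bounded_meas n f"
  unfolding bounded_meas_def by blast

lemma bounded_meas_integrable: "bounded_meas n f \<Longrightarrow> integrable (PF n) f"
  using prob_space_PF[of n] unfolding bounded_meas_def
  by (auto intro!: finite_measure.integrable_const_bound AE_I2 simp: prob_space.finite_measure)

lemma bounded_meas_const: "bounded_meas n (\<lambda>_. c)"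
  by (rule bmeasI) auto

lemma bounded_meas_add: "bounded_meas n f \<Longrightarrow> bounded_meas n g \<Longrightarrow> bounded_meas n (\<lambda>H. f H + g H)"
  unfolding bounded_meas_def
proof safe
  fix B C assume "\<forall>H\<in>space (PF n). \<bar>f H\<bar> \<le> B" "\<forall>H\<in>space (PF n). \<bar>g H\<bar> \<le> C"
  then show "\<exists>B. \<forall>H\<in>space (PF n). \<bar>f H + g H\<bar> \<le> B"
    by (intro exI[of _ "B + C"]) (auto intro!: order.trans[OF abs_triangle_ineq] add_mono)
qed auto

lemma bounded_meas_mult: "bounded_meas n f \<Longrightarrow> bounded_meas n g \<Longrightarrow> bounded_meas n (\<lambda>H. f H * g H)"
  unfolding bounded_meas_def
proof safe
  fix B C assume "\<forall>H\<in>space (PF n). \<bar>f H\<bar> \<le> B" "\<forall>H\<in>space (PF n). \<bar>g H\<bar> \<le> C"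
  then show "\<exists>B. \<forall>H\<in>space (PF n). \<bar>f H * g H\<bar> \<le> B"
    by (intro exI[of _ "B * C"]) (auto simp: abs_mult intro!: mult_mono elim: order.trans[OF abs_ge_zero])
qed auto

lemma bounded_meas_diff: "bounded_meas n f \<Longrightarrow> bounded_meas n g \<Longrightarrow> bounded_meas n (\<lambda>H. f H - g H)"
  using bounded_meas_add[of n f "\<lambda>H. - 1 * g H"] bounded_meas_mult[OF bounded_meas_const[of n "- 1"], of g] by simp

lemma bounded_meas_abs: "bounded_meas n f \<Longrightarrow> bounded_meas n (\<lambda>H. \<bar>f H\<bar>)"
  unfolding bounded_meas_def by auto

lemma bounded_meas_sum: "(\<And>a. a \<in> A \<Longrightarrow> bounded_meas n (f a)) \<Longrightarrow> bounded_meas n (\<lambda>H. \<Sum>a\<in>A. f a H)"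
  by (induction A rule: infinite_finite_induct) (auto intro: bounded_meas_add bounded_meas_const)

lemma bounded_meas_EG: "(\<And>G. G \<subseteq> edges n \<Longrightarrow> bounded_meas n (\<Phi> G)) \<Longrightarrow> bounded_meas n (\<lambda>H. EG n (\<lambda>G. \<Phi> G H))"
  unfolding EG_def by (intro bounded_meas_sum bounded_meas_mult bounded_meas_const) auto

text \<open>The finite graph sum stands inside the feature integral, so measurability is required
  for each fixed graph only; joint measurability is postponed to the end.\<close>

definition EE :: "nat \<Rightarrow> (nat set set \<Rightarrow> (nat \<Rightarrow> 'a) \<Rightarrow> real) \<Rightarrow> real" where
  "EE n \<Phi> = (\<integral>H. EG n (\<lambda>G. \<Phi> G H) \<partial>PF n)"

lemma EE_mono:
  assumes "\<And>G. G \<subseteq> edges n \<Longrightarrow> bounded_meas n (\<Phi> G)" "\<And>G. G \<subseteq> edges n \<Longrightarrow> bounded_meas n (\<Psi> G)"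
    and "\<And>G H. G \<subseteq> edges n \<Longrightarrow> H \<in> space (PF n) \<Longrightarrow> \<Phi> G H \<le> \<Psi> G H"
  shows "EE n \<Phi> \<le> EE n \<Psi>"
  unfolding EE_def using assms by (intro integral_mono bounded_meas_integrable bounded_meas_EG EG_mono)

lemma EE_add:
  assumes "\<And>G. G \<subseteq> edges n \<Longrightarrow> bounded_meas n (\<Phi> G)" "\<And>G. G \<subseteq> edges n \<Longrightarrow> bounded_meas n (\<Psi> G)"
  shows "EE n (\<lambda>G H. \<Phi> G H + \<Psi> G H) = EE n \<Phi> + EE n \<Psi>"
  unfolding EE_def EG_add using assms
  by (intro Bochner_Integration.integral_add bounded_meas_integrable bounded_meas_EG)

lemma EE_cmult: "EE n (\<lambda>G H. c * \<Phi> G H) = c * EE n \<Phi>"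
  unfolding EE_def EG_cmult by simp

lemma EE_sum:
  assumes "\<And>a G. a \<in> A \<Longrightarrow> G \<subseteq> edges n \<Longrightarrow> bounded_meas n (\<Phi> a G)"
  shows "EE n (\<lambda>G H. \<Sum>a\<in>A. \<Phi> a G H) = (\<Sum>a\<in>A. EE n (\<Phi> a))"
  unfolding EE_def EG_sum using assms
  by (intro Bochner_Integration.integral_sum bounded_meas_integrable bounded_meas_EG)

lemma EE_indep: "EE n (\<lambda>G H. \<psi> G * f H) = EG n \<psi> * (\<integral>H. f H \<partial>PF n)"
  unfolding EE_def EG_cmult_right by simp

lemma EE_graph: "EE n (\<lambda>G H. \<psi> G) = EG n \<psi>"
  using EE_indep[of n \<psi> "\<lambda>_. 1"] prob_space.prob_space[OF prob_space_PF[of n]] by simp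

lemma proj_measurable:
  assumes "set us \<subseteq> {..<n}"
  shows "proj us \<in> measurable (PF n) (PF (length us))"
  unfolding proj_def using assms by (intro measurable_restrict measurable_component_singleton) (auto dest: nth_mem)

lemma proj_space: "set us \<subseteq> {..<n} \<Longrightarrow> H \<in> space (PF n) \<Longrightarrow> proj us H \<in> space (PF (length us))"
  using measurable_space[OF proj_measurable] .

lemma bounded_meas_proj:
  assumes "set us \<subseteq> {..<n}" "bounded_meas (length us) x"
  shows "bounded_meas n (\<lambda>H. x (proj us H))"
  using assms proj_space[OF assms(1)] measurable_compose[OF proj_measurable[OF assms(1)]]
  unfolding bounded_meas_def by blast

text \<open>The conditional expectation of \<open>x\<close> given the first k features.\<close>

definition avg_last :: "nat \<Rightarrow> ((nat \<Rightarrow> 'a) \<Rightarrow> real) \<Rightarrow> (nat \<Rightarrow> 'a) \<Rightarrow> real" where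
  "avg_last k x h = (\<integral>y. x (h(k := y)) \<partial>F)"

lemma upd_measurable: "(\<lambda>(h, y). h(k := y)) \<in> measurable (PF k \<Otimes>\<^sub>M F) (PF (Suc k))"
  using measurable_add_dim[of k "{..<k}" "\<lambda>_. F"] by (simp add: lessThan_Suc)

lemma upd_space: "h \<in> space (PF k) \<Longrightarrow> y \<in> space F \<Longrightarrow> h(k := y) \<in> space (PF (Suc k))"
  using measurable_space[OF upd_measurable, of "(h, y)" k] by (auto simp: space_pair_measure)

lemma upd_compose:
  assumes "bounded_meas (Suc k) x"
  shows "(\<lambda>(h, y). x (h(k := y))) \<in> borel_measurable (PF k \<Otimes>\<^sub>M F)"
proof -
  have "x \<in> borel_measurable (PF (Suc k))" using assms by (simp add: bounded_meas_def)
  from measurable_compose[OF upd_measurable this] show ?thesis by (simp add: case_prod_beta')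
qed

lemma avg_last_integrable:
  assumes "bounded_meas (Suc k) x" "h \<in> space (PF k)"
  shows "integrable F (\<lambda>y. x (h(k := y)))"
proof -
  obtain B where B: "\<And>H. H \<in> space (PF (Suc k)) \<Longrightarrow> \<bar>x H\<bar> \<le> B" using assms by (auto simp: bounded_meas_def)
  from measurable_compose[OF measurable_Pair1'[OF assms(2)] upd_compose[OF assms(1)]]
  have "(\<lambda>y. x (h(k := y))) \<in> borel_measurable F" by simp
  then show ?thesis
    using B upd_space[OF assms(2)] by (intro integrable_const_bound[of _ B]) auto
qed

lemma avg_last_bound:
  assumes "bounded_meas (Suc k) x" "h \<in> space (PF k)" "\<And>H. H \<in> space (PF (Suc k)) \<Longrightarrow> \<bar>x H\<bar> \<le> B"
  shows "\<bar>avg_last k x h\<bar> \<le> B"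
proof -
  have "\<bar>avg_last k x h\<bar> \<le> (\<integral>y. \<bar>x (h(k := y))\<bar> \<partial>F)"
    unfolding avg_last_def by (rule integral_abs_bound)
  also have "\<dots> \<le> (\<integral>y. B \<partial>F)"
    using assms upd_space[OF assms(2)] by (intro integral_mono integrable_abs avg_last_integrable integrable_const) auto
  finally show ?thesis by (simp add: prob_space)
qed

lemma avg_last_mono:
  assumes "bounded_meas (Suc k) x" "bounded_meas (Suc k) y" "h \<in> space (PF k)" "\<And>H. H \<in> space (PF (Suc k)) \<Longrightarrow> x H \<le> y H"
  shows "avg_last k x h \<le> avg_last k y h"
  unfolding avg_last_def using assms upd_space[OF assms(3)] by (intro integral_mono avg_last_integrable) auto

lemma avg_last_const: "avg_last k (\<lambda>_. c) h = c"
  by (simp add: avg_last_def prob_space)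

lemma bounded_meas_avg_last:
  assumes "bounded_meas (Suc k) x"
  shows "bounded_meas k (avg_last k x)"
proof -
  obtain B where B: "\<And>H. H \<in> space (PF (Suc k)) \<Longrightarrow> \<bar>x H\<bar> \<le> B" using assms by (auto simp: bounded_meas_def)
  have "avg_last k x \<in> borel_measurable (PF k)"
    unfolding avg_last_def by (intro borel_measurable_lebesgue_integral upd_compose[OF assms])
  then show ?thesis using avg_last_bound[OF assms _ B] by (rule bmeasI)
qed

text \<open>The features are frozen in the coefficients \<open>c v\<close>. Given the type, the
  centred attachment indicators are pairwise uncorrelated, so only the diagonal of the second moment
  survives, with variance at most q per node; \<open>abs_le_amgm\<close> then passes to the first
  moment. Keeping the factor q in the variance matters when p tends to 0.\<close>

lemma edge_fluctuation:
  fixes B :: real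
  assumes us: "valid n k us" and V: "V \<subseteq> {..<n} - set us" and A: "A \<subseteq> {..<k}"
    and c: "\<And>v. v \<in> V \<Longrightarrow> \<bar>c v\<bar> \<le> B" and s: "s > 0"
  shows "EG n (\<lambda>G. of_bool (adj_type G us = t) * \<bar>\<Sum>v\<in>V. (of_bool (attached G us v = A) - cyl_prob (p n) {..<k} A) * c v\<bar>)
     \<le> PG n (\<lambda>G. adj_type G us = t) * ((card V * B\<^sup>2 * cyl_prob (p n) {..<k} A / s + s) / 2)"
proof -
  let ?q = "cyl_prob (p n) {..<k} A"
  let ?t = "\<lambda>G. of_bool (adj_type G us = t) :: real"
  let ?a = "\<lambda>G v. of_bool (attached G us v = A) - ?q"
  let ?P = "PG n (\<lambda>G. adj_type G us = t)"
  have q: "0 \<le> ?q" "?q \<le> 1" by (auto simp: cyl_prob_nonneg cyl_prob_le_1)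
  have V': "finite V" "\<And>v. v \<in> V \<Longrightarrow> v < n \<and> v \<notin> set us" using V finite_subset[OF V] by auto
  \<comment> \<open>Expanding the product of the centred indicators leaves only probabilities of
    joint attachment. On the diagonal an indicator times itself is the indicator again.\<close>
  have cov: "EG n (\<lambda>G. ?t G * (?a G v * ?a G w)) = (if v = w then ?P * (?q * (1 - ?q)) else 0)"
    if "v \<in> V" "w \<in> V" for v w
  proof -
    have "EG n (\<lambda>G. ?t G * (?a G v * ?a G w)) =
      PG n (\<lambda>G. adj_type G us = t \<and> attached G us v = A \<and> attached G us w = A)
      - ?q * PG n (\<lambda>G. adj_type G us = t \<and> attached G us v = A)
      - ?q * PG n (\<lambda>G. adj_type G us = t \<and> attached G us w = A) + ?q\<^sup>2 * ?P"
      unfolding EG_cmult[symmetric] EG_diff[symmetric] EG_add[symmetric]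
      by (intro EG_cong) (auto simp: power2_eq_square algebra_simps)
    also have "\<dots> = (if v = w then ?P * (?q * (1 - ?q)) else 0)"
      using PG_adj_type_attached_attached[OF us, of v w A t] PG_adj_type_attached[OF us, of v A t] PG_adj_type_attached[OF us, of w A t] V'(2)[OF that(1)] V'(2)[OF that(2)] A
      by (auto simp: power2_eq_square algebra_simps)
    finally show ?thesis .
  qed
  have "EG n (\<lambda>G. ?t G * (\<Sum>v\<in>V. ?a G v * c v)\<^sup>2)
      = EG n (\<lambda>G. \<Sum>v\<in>V. \<Sum>w\<in>V. (c v * c w) * (?t G * (?a G v * ?a G w)))"
    by (intro EG_cong) (simp add: power2_eq_square sum_product sum_distrib_left algebra_simps)
  also have "\<dots> = (\<Sum>v\<in>V. \<Sum>w\<in>V. (c v * c w) * EG n (\<lambda>G. ?t G * (?a G v * ?a G w)))"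
    by (simp only: EG_sum EG_cmult)
  also have "\<dots> = (\<Sum>v\<in>V. (c v * c v) * EG n (\<lambda>G. ?t G * (?a G v * ?a G v)))"
    using V'(1) by (intro sum_sum_diag) (auto simp: cov)
  also have "\<dots> \<le> (\<Sum>v\<in>V. B\<^sup>2 * (?P * ?q))"
  proof (rule sum_mono)
    fix v assume v: "v \<in> V"
    have "c v * c v \<le> B\<^sup>2" using power_mono[OF c[OF v] abs_ge_zero, of 2] by (simp add: power2_eq_square)
    moreover have "?q * (1 - ?q) \<le> ?q" using q by (simp add: mult_left_le)
    ultimately show "(c v * c v) * EG n (\<lambda>G. ?t G * (?a G v * ?a G v)) \<le> B\<^sup>2 * (?P * ?q)"
      unfolding cov[OF v v] using q by (simp only: simp_thms if_True) (intro mult_mono mult_left_mono mult_nonneg_nonneg, auto)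
  qed
  finally have S: "EG n (\<lambda>G. ?t G * (\<Sum>v\<in>V. ?a G v * c v)\<^sup>2) \<le> card V * B\<^sup>2 * (?P * ?q)" by simp
  have "EG n (\<lambda>G. ?t G * \<bar>\<Sum>v\<in>V. ?a G v * c v\<bar>)
     \<le> EG n (\<lambda>G. (1 / (2 * s)) * (?t G * (\<Sum>v\<in>V. ?a G v * c v)\<^sup>2) + (s / 2) * ?t G)"
  proof (rule EG_mono)
    show "?t G * \<bar>\<Sum>v\<in>V. ?a G v * c v\<bar> \<le> (1 / (2 * s)) * (?t G * (\<Sum>v\<in>V. ?a G v * c v)\<^sup>2) + (s / 2) * ?t G" for G
      using abs_le_amgm[OF s, of "\<Sum>v\<in>V. ?a G v * c v"] by (cases "adj_type G us = t") simp_all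
  qed
  also have "\<dots> = (1 / (2 * s)) * EG n (\<lambda>G. ?t G * (\<Sum>v\<in>V. ?a G v * c v)\<^sup>2) + (s / 2) * ?P"
    by (simp only: EG_add EG_cmult)
  also have "\<dots> \<le> (1 / (2 * s)) * (card V * B\<^sup>2 * (?P * ?q)) + (s / 2) * ?P"
    using S s by (intro add_mono mult_left_mono) auto
  also have "\<dots> = ?P * ((card V * B\<^sup>2 * ?q / s + s) / 2)"
    using s by (simp add: field_simps)
  finally show ?thesis .
qed

text \<open>The differences \<open>D v\<close> have mean zero given the features of the tuple and
  are pairwise orthogonal, so the second moment grows linearly in the number of nodes. No type
  appears, because features are independent of the graph.\<close>

lemma feature_fluctuation:
  fixes B :: real
  assumes us: "valid n k us" and V: "V \<subseteq> {..<n} - set us" and x: "bounded_meas (Suc k) x"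
    and B: "\<And>h. h \<in> space (PF (Suc k)) \<Longrightarrow> \<bar>x h\<bar> \<le> B" and s: "s > 0"
  shows "(\<integral>H. \<bar>\<Sum>v\<in>V. x (proj (us @ [v]) H) - avg_last k x (proj us H)\<bar> \<partial>PF n) \<le> (card V * (4 * B\<^sup>2) / s + s) / 2"
proof -
  define D where "D = (\<lambda>v H. x (proj (us @ [v]) H) - avg_last k x (proj us H))"
  interpret PFn: prob_space "PF n" by (rule prob_space_PF)
  have us': "length us = k" "set us \<subseteq> {..<n}" using us by (auto simp: valid_def)
  have V': "finite V" "\<And>v. v \<in> V \<Longrightarrow> v < n \<and> v \<notin> set us" using V finite_subset[OF V] by auto
  have bm: "bounded_meas n (D v)" if "v \<in> V" for v
    unfolding D_def using us' V'(2)[OF that] x by (intro bounded_meas_diff bounded_meas_proj) (auto intro: bounded_meas_avg_last)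
  \<comment> \<open>Centring at most doubles the bound; its square is the source of
    \<open>4 * B\<^sup>2\<close>.\<close>
  have Db: "\<bar>D v H\<bar> \<le> 2 * B" if "v \<in> V" "H \<in> space (PF n)" for v H
  proof -
    have "\<bar>x (proj (us @ [v]) H)\<bar> \<le> B"
      using proj_space[of "us @ [v]" n H] us' V'(2)[OF that(1)] that(2) by (intro B) auto
    moreover have "\<bar>avg_last k x (proj us H)\<bar> \<le> B"
      using avg_last_bound[OF x _ B] proj_space[of us n H] us' that(2) by auto
    ultimately show ?thesis unfolding D_def by linarith
  qed
  have orth: "(\<integral>H. D v H * D w H \<partial>PF n) = 0" if "v \<in> V" "w \<in> V" "v \<noteq> w" for v w
  proof -
    \<comment> \<open>The coordinate of \<open>v\<close> is integrated first: neither
      \<open>D w\<close> nor the features of the tuple depend on it, and the inner integral of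
      \<open>D v\<close> is 0.\<close>
    have ins: "{..<n} = insert v ({..<n} - {v})" using V'(2)[OF that(1)] by auto
    have "(\<integral>H. D v H * D w H \<partial>PF n) = (\<integral>H. (\<integral>y. D v (H(v := y)) * D w (H(v := y)) \<partial>F) \<partial>PiM ({..<n} - {v}) (\<lambda>_. F))"
      using P.product_integral_insert[of "{..<n} - {v}" v "\<lambda>H. D v H * D w H"]
        bounded_meas_integrable[OF bounded_meas_mult[OF bm[OF that(1)] bm[OF that(2)]]] unfolding ins[symmetric] by simp
    also have "\<dots> = (\<integral>H. 0 \<partial>PiM ({..<n} - {v}) (\<lambda>_. F))"
    proof (rule Bochner_Integration.integral_cong[OF refl])
      fix H assume H: "H \<in> space (PiM ({..<n} - {v}) (\<lambda>_. F))"
      have h: "proj us H \<in> space (PF k)"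
      proof -
        have "H (us ! i) \<in> space F" if "i < k" for i
        proof -
          have "us ! i \<in> {..<n} - {v}" using us' V'(2)[OF \<open>v \<in> V\<close>] that nth_mem[of i us] by (auto simp del: nth_mem)
          then show ?thesis using H by (auto simp: space_PiM PiE_def Pi_def)
        qed
        then show ?thesis using us' by (auto simp: proj_def space_PiM)
      qed
      have "(\<integral>y. D v (H(v := y)) * D w (H(v := y)) \<partial>F)
          = (\<integral>y. (x ((proj us H)(k := y)) - avg_last k x (proj us H)) * D w H \<partial>F)"
        using V'(2)[OF that(1)] that(3) us' unfolding D_def
        by (intro Bochner_Integration.integral_cong) (auto simp: proj_snoc proj_upd)
      also have "\<dots> = (\<integral>y. x ((proj us H)(k := y)) - avg_last k x (proj us H) \<partial>F) * D w H" by simp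
      also have "(\<integral>y. x ((proj us H)(k := y)) - avg_last k x (proj us H) \<partial>F) = 0"
        using avg_last_integrable[OF x h] by (simp add: avg_last_def prob_space)
      finally show "(\<integral>y. D v (H(v := y)) * D w (H(v := y)) \<partial>F) = 0" by (simp only: mult_zero_left)
    qed
    finally show ?thesis by simp
  qed
  have bS: "bounded_meas n (\<lambda>H. \<Sum>v\<in>V. D v H)" using bm by (intro bounded_meas_sum)
  have "(\<integral>H. (\<Sum>v\<in>V. D v H)\<^sup>2 \<partial>PF n) = (\<integral>H. (\<Sum>v\<in>V. \<Sum>w\<in>V. D v H * D w H) \<partial>PF n)"
    by (simp add: power2_eq_square sum_product)
  also have "\<dots> = (\<Sum>v\<in>V. \<Sum>w\<in>V. (\<integral>H. D v H * D w H \<partial>PF n))"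
    using bm by (subst Bochner_Integration.integral_sum, intro bounded_meas_integrable bounded_meas_sum bounded_meas_mult, simp, simp)
       (intro sum.cong Bochner_Integration.integral_sum bounded_meas_integrable bounded_meas_mult, auto)
  also have "\<dots> = (\<Sum>v\<in>V. \<integral>H. D v H * D v H \<partial>PF n)"
    using V'(1) orth by (intro sum_sum_diag) auto
  also have "\<dots> \<le> (\<Sum>v\<in>V. \<integral>H. 4 * B\<^sup>2 \<partial>PF n)"
  proof (intro sum_mono integral_mono bounded_meas_integrable bounded_meas_const bounded_meas_mult bm)
    fix v H assume "v \<in> V" "H \<in> space (PF n)"
    then show "D v H * D v H \<le> 4 * B\<^sup>2"
      using power_mono[OF Db abs_ge_zero, of v H 2] by (simp add: power2_eq_square)
  qed
  also have "\<dots> = card V * (4 * B\<^sup>2)" by (simp add: PFn.prob_space)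
  finally have S: "(\<integral>H. (\<Sum>v\<in>V. D v H)\<^sup>2 \<partial>PF n) \<le> card V * (4 * B\<^sup>2)" .
  have bS2: "bounded_meas n (\<lambda>H. (\<Sum>v\<in>V. D v H)\<^sup>2)" unfolding power2_eq_square using bS by (intro bounded_meas_mult)
  have "(\<integral>H. \<bar>\<Sum>v\<in>V. D v H\<bar> \<partial>PF n) \<le> (\<integral>H. (1 / (2 * s)) * (\<Sum>v\<in>V. D v H)\<^sup>2 + s / 2 \<partial>PF n)"
    using bS bS2 abs_le_amgm[OF s]
    by (intro integral_mono bounded_meas_integrable bounded_meas_abs bounded_meas_add bounded_meas_mult bounded_meas_const)
  also have "\<dots> = (1 / (2 * s)) * (\<integral>H. (\<Sum>v\<in>V. D v H)\<^sup>2 \<partial>PF n) + s / 2"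
    using bounded_meas_integrable[OF bS2] by (simp add: PFn.prob_space)
  also have "\<dots> \<le> (1 / (2 * s)) * (card V * (4 * B\<^sup>2)) + s / 2"
    using S s by (intro add_mono mult_left_mono) auto
  also have "\<dots> = (card V * (4 * B\<^sup>2) / s + s) / 2" using s by (simp add: field_simps)
  finally show ?thesis by (simp add: D_def)
qed

end

section \<open>Averages over neighbourhoods\<close>

lemma tendsto_cyl_prob: "p \<longlonglongrightarrow> (q::real) \<Longrightarrow> (\<lambda>n. cyl_prob (p n) S A) \<longlonglongrightarrow> cyl_prob q S A"
  unfolding cyl_prob_def by (intro tendsto_prod) (auto intro!: tendsto_intros)

(* I = {} selects all nodes and I = {i} the neighbours of us ! i, so both kinds of mean are one construction. *)
definition common_nbrs :: "nat \<Rightarrow> nat set \<Rightarrow> nat set set \<Rightarrow> nat list \<Rightarrow> nat set" where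
  "common_nbrs n I G us = {v\<in>{..<n}. \<forall>i\<in>I. v \<noteq> us ! i \<and> {v, us ! i} \<in> G}"

lemma common_nbrs_subset: "common_nbrs n I G us \<subseteq> {..<n}"
  by (auto simp: common_nbrs_def)

lemma finite_exts [simp]: "finite {A. I \<subseteq> A \<and> A \<subseteq> {..<k::nat}}"
  by (rule finite_subset[of _ "Pow {..<k}"]) auto

context er_features
begin

text \<open>The threshold N is chosen before the tuple and the type. This uniformity is what permits
  summation over a number of new nodes that grows with n.\<close>

definition type_conv :: "nat \<Rightarrow> (nat \<Rightarrow> nat set set \<Rightarrow> (nat \<Rightarrow> 'a) \<Rightarrow> nat list \<Rightarrow> real)
    \<Rightarrow> ((nat \<times> nat) set \<Rightarrow> (nat \<Rightarrow> 'a) \<Rightarrow> real) \<Rightarrow> bool" where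
  "type_conv k X e \<longleftrightarrow> (\<forall>\<epsilon>>0. \<exists>N. \<forall>n\<ge>N. \<forall>us. valid n k us \<longrightarrow> (\<forall>t\<subseteq>pairs k.
      EE n (\<lambda>G H. of_bool (adj_type G us = t) * \<bar>X n G H us - e t (proj us H)\<bar>) \<le> \<epsilon> * PG n (\<lambda>G. adj_type G us = t)))"

text \<open>The nodes need not be distinct: a mean also runs over nodes already in the tuple, and
  there only the bound is available.\<close>

definition bounded_functional :: "nat \<Rightarrow> (nat \<Rightarrow> nat set set \<Rightarrow> (nat \<Rightarrow> 'a) \<Rightarrow> nat list \<Rightarrow> real) \<Rightarrow> real \<Rightarrow> bool" where
  "bounded_functional k X B \<longleftrightarrow> (\<forall>n G us. length us = k \<longrightarrow> set us \<subseteq> {..<n} \<longrightarrow>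
      (\<lambda>H. X n G H us) \<in> borel_measurable (PF n) \<and> (\<forall>H\<in>space (PF n). \<bar>X n G H us\<bar> \<le> B))"

definition bounded_limit :: "nat \<Rightarrow> ((nat \<times> nat) set \<Rightarrow> (nat \<Rightarrow> 'a) \<Rightarrow> real) \<Rightarrow> real \<Rightarrow> bool" where
  "bounded_limit k e B \<longleftrightarrow> (\<forall>t. e t \<in> borel_measurable (PF k) \<and> (\<forall>h\<in>space (PF k). \<bar>e t h\<bar> \<le> B))"

text \<open>The divisor is the deterministic order of magnitude of the number of summands. A
  weighted mean is the quotient of two such averages, in which the divisor cancels.\<close>

definition avg :: "nat set \<Rightarrow> (nat \<Rightarrow> nat set set \<Rightarrow> (nat \<Rightarrow> 'a) \<Rightarrow> nat list \<Rightarrow> real)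
    \<Rightarrow> nat \<Rightarrow> nat set set \<Rightarrow> (nat \<Rightarrow> 'a) \<Rightarrow> nat list \<Rightarrow> real" where
  "avg I X n G H us = (\<Sum>v\<in>common_nbrs n I G us. X n G H (us @ [v])) / (real n * p n ^ card I)"

(* The weight of A is the limit of P(v is attached to us exactly at A) / p^|I|; only A containing I contribute. *)
definition limit_avg :: "nat \<Rightarrow> nat set \<Rightarrow> ((nat \<times> nat) set \<Rightarrow> (nat \<Rightarrow> 'a) \<Rightarrow> real)
    \<Rightarrow> (nat \<times> nat) set \<Rightarrow> (nat \<Rightarrow> 'a) \<Rightarrow> real" where
  "limit_avg k I e t h = (\<Sum>A | I \<subseteq> A \<and> A \<subseteq> {..<k}. cyl_prob pt ({..<k} - I) A * avg_last k (e (t \<union> A \<times> {k})) h)"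

lemma bounded_functional_bounded_meas: "bounded_functional k X B \<Longrightarrow> length us = k \<Longrightarrow> set us \<subseteq> {..<n} \<Longrightarrow> bounded_meas n (\<lambda>H. X n G H us)"
  unfolding bounded_functional_def bounded_meas_def by blast

lemma bounded_limit_bounded_meas: "bounded_limit k e B \<Longrightarrow> bounded_meas k (e t)"
  unfolding bounded_limit_def bounded_meas_def by blast

lemma bounded_meas_avg: "bounded_functional (Suc k) X B \<Longrightarrow> length us = k \<Longrightarrow> set us \<subseteq> {..<n} \<Longrightarrow> bounded_meas n (\<lambda>H. avg I X n G H us)"
  unfolding avg_def divide_inverse using common_nbrs_subset[of n I]
  by (intro bounded_meas_mult bounded_meas_const bounded_meas_sum bounded_functional_bounded_meas) fastforce+

lemma bounded_meas_limit_avg: "bounded_limit (Suc k) e B \<Longrightarrow> bounded_meas k (limit_avg k I e t)"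
  unfolding limit_avg_def by (intro bounded_meas_mult bounded_meas_const bounded_meas_sum bounded_meas_avg_last bounded_limit_bounded_meas)

section \<open>The error of a single averaging step\<close>

lemma EE_le_const:
  assumes "\<And>G. G \<subseteq> edges n \<Longrightarrow> bounded_meas n (\<Phi> G)" "\<And>H. H \<in> space (PF n) \<Longrightarrow> EG n (\<lambda>G. \<Phi> G H) \<le> c"
  shows "EE n \<Phi> \<le> c"
proof -
  interpret PFn: prob_space "PF n" by (rule prob_space_PF)
  have "EE n \<Phi> \<le> (\<integral>H. c \<partial>PF n)"
    unfolding EE_def using assms by (intro integral_mono bounded_meas_integrable bounded_meas_EG bounded_meas_const)
  then show ?thesis by (simp add: PFn.prob_space)
qed

text \<open>A pathwise estimate. Its terms are, in order: the at most k summands inside the tuple;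
  the deterministic error of the attachment weights; the replacement of \<open>X\<close> by its
  limit function; the fluctuation of the edges with the features frozen; the fluctuation of the
  features.\<close>

lemma avg_decomp:
  assumes us: "valid n k us" and t: "adj_type G us = t" and I: "I \<subseteq> {..<k}"
    and X: "bounded_functional (Suc k) X B" and e: "bounded_limit (Suc k) e B" and H: "H \<in> space (PF n)"
    and m: "real n * p n ^ card I = m" "m > 0"
  defines "V \<equiv> {..<n} - set us" and "x \<equiv> \<lambda>A v. e (t \<union> A \<times> {k}) (proj (us @ [v]) H)"
    and "c \<equiv> \<lambda>A. avg_last k (e (t \<union> A \<times> {k})) (proj us H)"
  shows "\<bar>avg I X n G H us - limit_avg k I e t (proj us H)\<bar> \<le> 
     k * B / m + (\<Sum>A | I \<subseteq> A \<and> A \<subseteq> {..<k}. \<bar>card V * cyl_prob (p n) {..<k} A / m - cyl_prob pt ({..<k} - I) A\<bar> * B)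
     + (1 / m) * (\<Sum>A | I \<subseteq> A \<and> A \<subseteq> {..<k}. \<Sum>v\<in>V. of_bool (attached G us v = A) * \<bar>X n G H (us @ [v]) - x A v\<bar>)
     + (1 / m) * (\<Sum>A | I \<subseteq> A \<and> A \<subseteq> {..<k}. \<bar>\<Sum>v\<in>V. (of_bool (attached G us v = A) - cyl_prob (p n) {..<k} A) * x A v\<bar>)
     + (1 / m) * (\<Sum>A | I \<subseteq> A \<and> A \<subseteq> {..<k}. cyl_prob (p n) {..<k} A * \<bar>\<Sum>v\<in>V. x A v - c A\<bar>)"
proof -
  let ?A = "{A. I \<subseteq> A \<and> A \<subseteq> {..<k}}"
  let ?X = "\<lambda>v. X n G H (us @ [v])"
  let ?q = "\<lambda>A. cyl_prob (p n) {..<k} A"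
  let ?w = "\<lambda>A. cyl_prob pt ({..<k} - I) A"
  let ?a = "\<lambda>A v. of_bool (attached G us v = A) :: real"
  have us': "length us = k" "distinct us" "set us \<subseteq> {..<n}" using us by (auto simp: valid_def)
  have finV: "finite V" by (simp add: V_def)
  have cB: "\<bar>c A\<bar> \<le> B" for A
    unfolding c_def using e us' H proj_space[of us n H]
    by (intro avg_last_bound[OF bounded_limit_bounded_meas[OF e]]) (auto simp: bounded_limit_def)
  have common_nbrs_iff: "v \<in> common_nbrs n I G us \<longleftrightarrow> I \<subseteq> attached G us v" if "v \<in> V" for v
    using that I us' by (auto simp: common_nbrs_def attached_def V_def insert_commute)
  have "(\<Sum>v\<in>common_nbrs n I G us. ?X v) = (\<Sum>v\<in>common_nbrs n I G us \<inter> set us. ?X v) + (\<Sum>v\<in>common_nbrs n I G us \<inter> V. ?X v)"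
    using common_nbrs_subset[of n I G us] by (subst sum.union_disjoint[symmetric]) (auto simp: V_def intro!: sum.cong)
  also have "(\<Sum>v\<in>common_nbrs n I G us \<inter> V. ?X v) = (\<Sum>v\<in>V. \<Sum>A\<in>?A. ?a A v * ?X v)"
  proof -
    \<comment> \<open>Exactly one pattern A matches \<open>v\<close>, namely its own attachment set,
      and this set contains I precisely when \<open>v\<close> is selected.\<close>
    have "(\<Sum>A\<in>?A. ?a A v * ?X v) = (if v \<in> common_nbrs n I G us then ?X v else 0)" if "v \<in> V" for v
    proof -
      have "(\<Sum>A\<in>?A. ?a A v * ?X v) = (\<Sum>A\<in>?A. if A = attached G us v then ?X v else 0)"
        by (intro sum.cong) auto
      also have "\<dots> = (if v \<in> common_nbrs n I G us then ?X v else 0)"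
        using common_nbrs_iff[OF that] attached_subset[of G us v] us' by (subst sum.delta) auto
      finally show ?thesis .
    qed
    then have "(\<Sum>v\<in>V. \<Sum>A\<in>?A. ?a A v * ?X v) = (\<Sum>v\<in>V. if v \<in> common_nbrs n I G us then ?X v else 0)" by simp
    also have "\<dots> = (\<Sum>v\<in>V \<inter> common_nbrs n I G us. ?X v)" using finV by (simp add: sum.inter_restrict)
    finally show ?thesis by (simp add: Int_commute)
  qed
  also have "\<dots> = (\<Sum>A\<in>?A. \<Sum>v\<in>V. ?a A v * ?X v)" by (rule sum.swap)
  finally have S: "(\<Sum>v\<in>common_nbrs n I G us. ?X v) = (\<Sum>v\<in>common_nbrs n I G us \<inter> set us. ?X v) + (\<Sum>A\<in>?A. \<Sum>v\<in>V. ?a A v * ?X v)" .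
  \<comment> \<open>Telescoping through the sums of a x, q x and q c, where a is the attachment
    indicator, x the limit function at v and c its mean over the new feature.\<close>
  have idA: "(\<Sum>v\<in>V. ?a A v * ?X v) / m - ?w A * c A =
      (card V * ?q A / m - ?w A) * c A
      + (1 / m) * (\<Sum>v\<in>V. ?a A v * (?X v - x A v))
      + (1 / m) * (\<Sum>v\<in>V. (?a A v - ?q A) * x A v)
      + (1 / m) * (?q A * (\<Sum>v\<in>V. x A v - c A))" for A
    using m by (simp add: field_simps sum_subtractf sum_distrib_left sum_distrib_right)
  have absA: "\<bar>(\<Sum>v\<in>V. ?a A v * ?X v) / m - ?w A * c A\<bar> \<le>
      \<bar>card V * ?q A / m - ?w A\<bar> * B
      + (1 / m) * (\<Sum>v\<in>V. ?a A v * \<bar>?X v - x A v\<bar>)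
      + (1 / m) * \<bar>\<Sum>v\<in>V. (?a A v - ?q A) * x A v\<bar>
      + (1 / m) * (?q A * \<bar>\<Sum>v\<in>V. x A v - c A\<bar>)" for A
    unfolding idA
  proof (intro order.trans[OF abs_triangle_ineq] add_mono)
    show "\<bar>(card V * ?q A / m - ?w A) * c A\<bar> \<le> \<bar>card V * ?q A / m - ?w A\<bar> * B"
      using cB[of A] by (simp add: abs_mult mult_left_mono)
    have "\<bar>\<Sum>v\<in>V. ?a A v * (?X v - x A v)\<bar> \<le> (\<Sum>v\<in>V. ?a A v * \<bar>?X v - x A v\<bar>)"
      by (rule order.trans[OF sum_abs]) (simp add: abs_mult)
    then show "\<bar>1 / m * (\<Sum>v\<in>V. ?a A v * (?X v - x A v))\<bar> \<le> 1 / m * (\<Sum>v\<in>V. ?a A v * \<bar>?X v - x A v\<bar>)"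
      using m(2) by (simp add: abs_mult divide_right_mono)
    show "\<bar>1 / m * (\<Sum>v\<in>V. (?a A v - ?q A) * x A v)\<bar> \<le> (1 / m) * \<bar>\<Sum>v\<in>V. (?a A v - ?q A) * x A v\<bar>"
      using m(2) by (simp add: abs_mult)
    show "\<bar>1 / m * (?q A * (\<Sum>v\<in>V. x A v - c A))\<bar> \<le> 1 / m * (?q A * \<bar>\<Sum>v\<in>V. x A v - c A\<bar>)"
      using m(2) by (simp add: abs_mult cyl_prob_nonneg)
  qed
  have "\<bar>\<Sum>v\<in>common_nbrs n I G us \<inter> set us. ?X v\<bar> \<le> (\<Sum>v\<in>common_nbrs n I G us \<inter> set us. B)"
    using X us' H common_nbrs_subset[of n I G us] unfolding bounded_functional_def by (intro order.trans[OF sum_abs] sum_mono) auto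
  also have "\<dots> \<le> k * B"
  proof -
    have "card (common_nbrs n I G us \<inter> set us) \<le> k" using card_mono[of "set us" "common_nbrs n I G us \<inter> set us"] us'
      by (metis List.finite_set card_length inf_le2 order.trans)
    moreover have "0 \<le> B" using cB[of "{}"] by simp
    ultimately show ?thesis by (simp add: mult_right_mono)
  qed
  finally have S0: "\<bar>(\<Sum>v\<in>common_nbrs n I G us \<inter> set us. ?X v) / m\<bar> \<le> k * B / m"
    using m(2) by (simp add: divide_right_mono)
  have E: "avg I X n G H us - limit_avg k I e t (proj us H)
     = (\<Sum>v\<in>common_nbrs n I G us \<inter> set us. ?X v) / m + (\<Sum>A\<in>?A. (\<Sum>v\<in>V. ?a A v * ?X v) / m - ?w A * c A)"
    unfolding avg_def limit_avg_def m(1) S c_def add_divide_distrib sum_subtractf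
      sum_divide_distrib[of "\<lambda>A. \<Sum>v\<in>V. ?a A v * ?X v" ?A m] by simp
  have "\<bar>avg I X n G H us - limit_avg k I e t (proj us H)\<bar> \<le> k * B / m + (\<Sum>A\<in>?A. \<bar>(\<Sum>v\<in>V. ?a A v * ?X v) / m - ?w A * c A\<bar>)"
    unfolding E by (rule order.trans[OF abs_triangle_ineq add_mono[OF S0 sum_abs]])
  also have "\<dots> \<le> k * B / m + (\<Sum>A\<in>?A. \<bar>card V * ?q A / m - ?w A\<bar> * B
      + (1 / m) * (\<Sum>v\<in>V. ?a A v * \<bar>?X v - x A v\<bar>)
      + (1 / m) * \<bar>\<Sum>v\<in>V. (?a A v - ?q A) * x A v\<bar>
      + (1 / m) * (?q A * \<bar>\<Sum>v\<in>V. x A v - c A\<bar>))"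
    by (rule add_left_mono, rule sum_mono, rule absA)
  finally show ?thesis by (simp only: sum.distrib sum_distrib_left add.assoc)
qed

text \<open>Expectation of the pathwise estimate, with the induction hypothesis \<open>err\<close>
  applied to each extended type. Both fluctuation sums have second moment of order m, hence first
  moment of order sqrt m, and dividing by m leaves the rate 1 / sqrt m.\<close>

lemma avg_error:
  assumes us: "valid n k us" and t: "t \<subseteq> pairs k" and I: "I \<subseteq> {..<k}"
    and X: "bounded_functional (Suc k) X B" and e: "bounded_limit (Suc k) e B"
    and m: "real n * p n ^ card I = m" "m > 0"
    and err: "\<And>v A. v < n \<Longrightarrow> v \<notin> set us \<Longrightarrow> A \<subseteq> {..<k} \<Longrightarrow>
       EE n (\<lambda>G H. of_bool (adj_type G (us @ [v]) = t \<union> A \<times> {k}) * \<bar>X n G H (us @ [v]) - e (t \<union> A \<times> {k}) (proj (us @ [v]) H)\<bar>)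
         \<le> \<epsilon> * PG n (\<lambda>G. adj_type G (us @ [v]) = t \<union> A \<times> {k})"
    and "\<epsilon> \<ge> 0"
  defines "M \<equiv> real (card {A. I \<subseteq> A \<and> A \<subseteq> {..<k}})"
  shows "EE n (\<lambda>G H. of_bool (adj_type G us = t) * \<bar>avg I X n G H us - limit_avg k I e t (proj us H)\<bar>)
     \<le> (k * B / m + (\<Sum>A | I \<subseteq> A \<and> A \<subseteq> {..<k}. \<bar>(real n - k) * cyl_prob (p n) {..<k} A / m - cyl_prob pt ({..<k} - I) A\<bar> * B)
        + M * \<epsilon> + M * ((B\<^sup>2 + 1) / (2 * sqrt m)) + M * ((4 * B\<^sup>2 + 1) / (2 * sqrt m)))
       * PG n (\<lambda>G. adj_type G us = t)"
proof -
  let ?A = "{A. I \<subseteq> A \<and> A \<subseteq> {..<k}}"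
  let ?t = "\<lambda>G. of_bool (adj_type G us = t) :: real"
  let ?P = "PG n (\<lambda>G. adj_type G us = t)"
  let ?q = "\<lambda>A. cyl_prob (p n) {..<k} A"
  define V where "V = {..<n} - set us"
  define x where "x = (\<lambda>A v H. e (t \<union> A \<times> {k}) (proj (us @ [v]) H))"
  define c where "c = (\<lambda>A H. avg_last k (e (t \<union> A \<times> {k})) (proj us H))"
  have us': "length us = k" "distinct us" "set us \<subseteq> {..<n}" using us by (auto simp: valid_def)
  have finV: "finite V" and VD: "\<And>v. v \<in> V \<Longrightarrow> v < n \<and> v \<notin> set us" by (auto simp: V_def)
  have cardV: "real (card V) = real n - k"
  proof -
    have "card (set us) = k" "card (set us) \<le> n" using us' distinct_card[of us] card_mono[of "{..<n}" "set us"] by auto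
    then show ?thesis using us' unfolding V_def by (subst card_Diff_subset) auto
  qed
  have q0: "0 \<le> ?q A" "?q A \<le> 1" for A by (auto simp: cyl_prob_nonneg cyl_prob_le_1)
  \<comment> \<open>A pattern containing I has probability at most p^|I|, so the expected number of
    nodes with this pattern is at most m = n p^|I|.\<close>
  have qm: "card V * ?q A \<le> m" if "A \<in> ?A" for A
  proof -
    have "?q A = p n ^ card I * cyl_prob (p n) ({..<k} - I) A"
      using that I by (intro cyl_prob_split) auto
    also have "\<dots> \<le> p n ^ card I * 1" by (intro mult_left_mono cyl_prob_le_1) auto
    finally show ?thesis unfolding m(1)[symmetric] using q0[of A] by (intro mult_mono) (auto simp: cardV)
  qed
  have bX: "bounded_meas n (\<lambda>H. X n G H (us @ [v]))" if "v \<in> V" for v G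
    using bounded_functional_bounded_meas[OF X, of "us @ [v]" n] us' VD[OF that] by auto
  have bx: "bounded_meas n (x A v)" if "v \<in> V" for v A
    unfolding x_def using us' VD[OF that] bounded_limit_bounded_meas[OF e] by (intro bounded_meas_proj) auto
  have bc: "bounded_meas n (c A)" for A
    unfolding c_def
    by (intro bounded_meas_proj[OF us'(3)], unfold us'(1), intro bounded_meas_avg_last bounded_limit_bounded_meas[OF e])
  define c0 where "c0 = k * B / m + (\<Sum>A\<in>?A. \<bar>card V * ?q A / m - cyl_prob pt ({..<k} - I) A\<bar> * B)"
  define T1 where "T1 = (\<lambda>A v G H. of_bool (adj_type G (us @ [v]) = t \<union> A \<times> {k}) * \<bar>X n G H (us @ [v]) - x A v H\<bar>)"
  define T2 where "T2 = (\<lambda>A G H. ?t G * \<bar>\<Sum>v\<in>V. (of_bool (attached G us v = A) - ?q A) * x A v H\<bar>)"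
  define T3 where "T3 = (\<lambda>A G H. ?t G * \<bar>\<Sum>v\<in>V. x A v H - c A H\<bar>)"
  have b1: "bounded_meas n (T1 A v G)" if "v \<in> V" for A v G
    unfolding T1_def using that by (intro bounded_meas_mult bounded_meas_const bounded_meas_abs bounded_meas_diff bX bx)
  have b2: "bounded_meas n (T2 A G)" for A G
    unfolding T2_def by (intro bounded_meas_mult bounded_meas_const bounded_meas_abs bounded_meas_sum bx)
  have b3: "bounded_meas n (T3 A G)" for A G
    unfolding T3_def by (intro bounded_meas_mult bounded_meas_const bounded_meas_abs bounded_meas_sum bounded_meas_diff bx bc)
  have e1: "EE n (T1 A v) \<le> \<epsilon> * (?P * ?q A)" if "A \<in> ?A" "v \<in> V" for A v
    using err[of v A] PG_adj_type_snoc[OF us, of v A t] that VD[OF that(2)] t unfolding T1_def x_def by auto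
  have e2: "EE n (T2 A) \<le> ?P * (sqrt m * (B\<^sup>2 + 1) / 2)" if "A \<in> ?A" for A
  proof (rule EE_le_const)
    fix H assume H: "H \<in> space (PF n)"
    have xB: "\<bar>x A v H\<bar> \<le> B" if "v \<in> V" for v
      using proj_space[of "us @ [v]" n H] us' VD[OF that] H e unfolding x_def bounded_limit_def by auto
    \<comment> \<open>The choice s = sqrt m balances the two summands of the fluctuation
      bound.\<close>
    have "EG n (\<lambda>G. T2 A G H) \<le> ?P * ((card V * B\<^sup>2 * ?q A / sqrt m + sqrt m) / 2)"
      unfolding T2_def using that m(2) by (intro edge_fluctuation[OF us] xB) (auto simp: V_def)
    also have "\<dots> \<le> ?P * ((m * B\<^sup>2 / sqrt m + sqrt m) / 2)"
      using mult_right_mono[OF qm[OF that], of "B\<^sup>2"] m(2)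
      by (intro mult_left_mono divide_right_mono add_right_mono) (auto simp: algebra_simps)
    also have "m * B\<^sup>2 / sqrt m = sqrt m * B\<^sup>2" using m(2) by (simp add: field_simps)
    finally show "EG n (\<lambda>G. T2 A G H) \<le> ?P * (sqrt m * (B\<^sup>2 + 1) / 2)" by (simp add: algebra_simps)
  qed (rule b2)
  \<comment> \<open>The factor q must stay with this term: the number of nodes alone need not be
    bounded by m, but q times that number is.\<close>
  have e3: "?q A * EE n (T3 A) \<le> ?P * (sqrt m * (4 * B\<^sup>2 + 1) / 2)" if "A \<in> ?A" for A
  proof -
    have "EE n (T3 A) = ?P * (\<integral>H. \<bar>\<Sum>v\<in>V. x A v H - c A H\<bar> \<partial>PF n)"
      unfolding T3_def by (rule EE_indep)
    also have "\<dots> \<le> ?P * ((card V * (4 * B\<^sup>2) / sqrt m + sqrt m) / 2)"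
      unfolding x_def c_def using m(2) e
      by (intro mult_left_mono feature_fluctuation[OF us]) (auto simp: V_def bounded_limit_def intro!: bounded_limit_bounded_meas[OF e])
    finally have "?q A * EE n (T3 A) \<le> ?q A * (?P * ((card V * (4 * B\<^sup>2) / sqrt m + sqrt m) / 2))"
      using q0[of A] by (intro mult_left_mono)
    also have "\<dots> = ?P * (((card V * ?q A) * (4 * B\<^sup>2) / sqrt m + ?q A * sqrt m) / 2)"
      by (simp add: algebra_simps add_divide_distrib)
    also have "\<dots> \<le> ?P * ((m * (4 * B\<^sup>2) / sqrt m + 1 * sqrt m) / 2)"
      using m(2) q0[of A] qm[OF that]
      by (intro mult_left_mono divide_right_mono add_mono mult_right_mono) auto
    also have "m * (4 * B\<^sup>2) / sqrt m = sqrt m * (4 * B\<^sup>2)" using m(2) by (simp add: field_simps)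
    finally show ?thesis by (simp add: algebra_simps)
  qed
  have "EE n (\<lambda>G H. ?t G * \<bar>avg I X n G H us - limit_avg k I e t (proj us H)\<bar>)
     \<le> EE n (\<lambda>G H. c0 * ?t G + ((1 / m) * (\<Sum>A\<in>?A. \<Sum>v\<in>V. T1 A v G H) + ((1 / m) * (\<Sum>A\<in>?A. T2 A G H)
           + (1 / m) * (\<Sum>A\<in>?A. ?q A * T3 A G H))))"
  proof (rule EE_mono)
    show "bounded_meas n (\<lambda>H. ?t G * \<bar>avg I X n G H us - limit_avg k I e t (proj us H)\<bar>)" for G
      using us' by (intro bounded_meas_mult bounded_meas_const bounded_meas_abs bounded_meas_diff bounded_meas_avg[OF X] bounded_meas_proj)
        (auto simp only: us' intro!: bounded_meas_limit_avg[OF e])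
    show "bounded_meas n (\<lambda>H. c0 * ?t G + ((1 / m) * (\<Sum>A\<in>?A. \<Sum>v\<in>V. T1 A v G H) + ((1 / m) * (\<Sum>A\<in>?A. T2 A G H)
           + (1 / m) * (\<Sum>A\<in>?A. ?q A * T3 A G H))))" for G
      by (intro bounded_meas_add bounded_meas_mult bounded_meas_const bounded_meas_sum b1 b2 b3)
    fix G H assume H: "H \<in> space (PF n)"
    show "?t G * \<bar>avg I X n G H us - limit_avg k I e t (proj us H)\<bar> \<le>
      c0 * ?t G + ((1 / m) * (\<Sum>A\<in>?A. \<Sum>v\<in>V. T1 A v G H) + ((1 / m) * (\<Sum>A\<in>?A. T2 A G H)
           + (1 / m) * (\<Sum>A\<in>?A. ?q A * T3 A G H)))"
    proof (cases "adj_type G us = t")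
      case True
      \<comment> \<open>Once the tuple has type t, having the extended type is the same as being
        attached exactly at A.\<close>
      have T1: "(\<Sum>A\<in>?A. \<Sum>v\<in>V. T1 A v G H) = (\<Sum>A\<in>?A. \<Sum>v\<in>V. of_bool (attached G us v = A) * \<bar>X n G H (us @ [v]) - x A v H\<bar>)"
        using adj_type_snoc_eq_iff[of t us _ G] t us' True unfolding T1_def by (intro sum.cong refl) auto
      show ?thesis
        unfolding T1 using avg_decomp[OF us True I X e H m] True
        by (simp add: T2_def T3_def c0_def V_def x_def c_def)
    next
      case False
      have "0 \<le> (\<Sum>A\<in>?A. \<Sum>v\<in>V. T1 A v G H)" unfolding T1_def by (intro sum_nonneg mult_nonneg_nonneg) auto
      then show ?thesis using False m(2) by (simp add: T2_def T3_def)
    qed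
  qed
  also have "\<dots> = c0 * ?P + ((1 / m) * (\<Sum>A\<in>?A. \<Sum>v\<in>V. EE n (T1 A v)) + ((1 / m) * (\<Sum>A\<in>?A. EE n (T2 A))
           + (1 / m) * (\<Sum>A\<in>?A. ?q A * EE n (T3 A))))"
  proof -
    let ?S0 = "\<lambda>G H. c0 * ?t G" and ?S1 = "\<lambda>G H. (1 / m) * (\<Sum>A\<in>?A. \<Sum>v\<in>V. T1 A v G H)"
    let ?S2 = "\<lambda>G H. (1 / m) * (\<Sum>A\<in>?A. T2 A G H)" and ?S3 = "\<lambda>G H. (1 / m) * (\<Sum>A\<in>?A. ?q A * T3 A G H)"
    have S: "bounded_meas n (?S0 G)" "bounded_meas n (?S1 G)" "bounded_meas n (?S2 G)" "bounded_meas n (?S3 G)" for G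
      by (intro bounded_meas_add bounded_meas_mult bounded_meas_const bounded_meas_sum b1 b2 b3; assumption)+
    have "EE n (\<lambda>G H. ?S0 G H + (?S1 G H + (?S2 G H + ?S3 G H))) = EE n ?S0 + EE n (\<lambda>G H. ?S1 G H + (?S2 G H + ?S3 G H))"
      by (intro EE_add bounded_meas_add S)
    also have "EE n (\<lambda>G H. ?S1 G H + (?S2 G H + ?S3 G H)) = EE n ?S1 + EE n (\<lambda>G H. ?S2 G H + ?S3 G H)"
      by (intro EE_add bounded_meas_add S)
    also have "EE n (\<lambda>G H. ?S2 G H + ?S3 G H) = EE n ?S2 + EE n ?S3"
      by (intro EE_add bounded_meas_add S)
    also have "EE n ?S0 = c0 * ?P" by (simp only: EE_graph EG_cmult)
    also have "EE n ?S1 = (1 / m) * (\<Sum>A\<in>?A. \<Sum>v\<in>V. EE n (T1 A v))"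
      unfolding EE_cmult by (subst EE_sum, intro bounded_meas_sum b1, assumption, subst EE_sum, rule b1) auto
    also have "EE n ?S2 = (1 / m) * (\<Sum>A\<in>?A. EE n (T2 A))"
      unfolding EE_cmult by (subst EE_sum, rule b2) auto
    also have "EE n ?S3 = (1 / m) * (\<Sum>A\<in>?A. ?q A * EE n (T3 A))"
      unfolding EE_cmult by (subst EE_sum, intro bounded_meas_mult bounded_meas_const b3) (simp only: EE_cmult)
    finally show ?thesis .
  qed
  also have "\<dots> \<le> c0 * ?P + ((1 / m) * (\<Sum>A\<in>?A. \<Sum>v\<in>V. \<epsilon> * (?P * ?q A)) + ((1 / m) * (\<Sum>A\<in>?A. ?P * (sqrt m * (B\<^sup>2 + 1) / 2))
           + (1 / m) * (\<Sum>A\<in>?A. ?P * (sqrt m * (4 * B\<^sup>2 + 1) / 2))))"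
    using m(2) by (intro add_mono mult_left_mono sum_mono order.refl e1 e2 e3) auto
  also have "\<dots> \<le> c0 * ?P + ((1 / m) * (\<Sum>A\<in>?A. \<epsilon> * (?P * m)) + ((1 / m) * (\<Sum>A\<in>?A. ?P * (sqrt m * (B\<^sup>2 + 1) / 2))
           + (1 / m) * (\<Sum>A\<in>?A. ?P * (sqrt m * (4 * B\<^sup>2 + 1) / 2))))"
  proof -
    have "(\<Sum>v\<in>V. \<epsilon> * (?P * ?q A)) \<le> \<epsilon> * (?P * m)" if "A \<in> ?A" for A
    proof -
      have "(\<Sum>v\<in>V. \<epsilon> * (?P * ?q A)) = \<epsilon> * (?P * (card V * ?q A))" by simp
      also have "\<dots> \<le> \<epsilon> * (?P * m)" using \<open>\<epsilon> \<ge> 0\<close> qm[OF that] by (intro mult_left_mono) auto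
      finally show ?thesis .
    qed
    then show ?thesis using m(2) by (intro add_mono mult_left_mono sum_mono order.refl) auto
  qed
  also have "\<dots> = (c0 + M * \<epsilon> + M * (sqrt m / m * ((B\<^sup>2 + 1) / 2)) + M * (sqrt m / m * ((4 * B\<^sup>2 + 1) / 2))) * ?P"
    using m(2) by (simp add: M_def algebra_simps)
  also have "sqrt m / m = 1 / sqrt m" using m(2) by (simp add: field_simps)
  finally show ?thesis by (simp add: c0_def cardV mult.commute[of "sqrt m" 2])
qed

text \<open>In the bound of \<open>avg_error\<close> everything except the propagated error
  \<open>M * \<epsilon>'\<close> tends to 0, because m tends to infinity and p converges. M depends
  only on k and I.\<close>

lemma type_conv_avg:
  assumes I: "I \<subseteq> {..<k}" and X: "bounded_functional (Suc k) X B" and e: "bounded_limit (Suc k) e B" and type_conv: "type_conv (Suc k) X e"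
    and top: "filterlim (\<lambda>n. real n * p n ^ card I) at_top sequentially"
  shows "type_conv k (avg I X) (limit_avg k I e)"
  unfolding type_conv_def
proof (intro allI impI)
  fix \<epsilon> :: real assume \<epsilon>: "\<epsilon> > 0"
  let ?A = "{A. I \<subseteq> A \<and> A \<subseteq> {..<k}}"
  define m where "m = (\<lambda>n. real n * p n ^ card I)"
  define M where "M = real (card ?A)"
  \<comment> \<open>The summand 1 covers M = 0, and the factor 2 makes M \<epsilon>' strictly
    smaller than \<epsilon>, leaving room for the vanishing terms.\<close>
  define \<epsilon>' where "\<epsilon>' = \<epsilon> / (2 * (M + 1))"
  have M: "M \<ge> 0" by (simp add: M_def)
  have \<epsilon>': "\<epsilon>' > 0" "M * \<epsilon>' < \<epsilon>"
    using \<epsilon> M by (auto simp: \<epsilon>'_def field_simps intro!: add_nonneg_pos)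
  define bnd where "bnd = (\<lambda>n. k * B / m n + (\<Sum>A\<in>?A. \<bar>(real n - k) * cyl_prob (p n) {..<k} A / m n - cyl_prob pt ({..<k} - I) A\<bar> * B)
        + M * \<epsilon>' + M * ((B\<^sup>2 + 1) / (2 * sqrt (m n))) + M * ((4 * B\<^sup>2 + 1) / (2 * sqrt (m n))))"
  have m_top: "filterlim m at_top sequentially" using top by (simp add: m_def)
  have sm_top: "filterlim (\<lambda>n. 2 * sqrt (m n)) at_top sequentially"
    by (intro filterlim_tendsto_pos_mult_at_top[OF tendsto_const] filterlim_compose[OF sqrt_at_top m_top]) auto
  have m_pos: "\<forall>\<^sub>F n in sequentially. m n > 0"
    using m_top by (simp add: filterlim_at_top_dense)
  have lim_inv: "(\<lambda>n. c / f n) \<longlonglongrightarrow> 0" if "filterlim f at_top sequentially" for c :: real and f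
    using that by (intro tendsto_divide_0[OF tendsto_const] filterlim_at_top_imp_at_infinity)
  have limA: "(\<lambda>n. (real n - k) * cyl_prob (p n) {..<k} A / m n) \<longlonglongrightarrow> cyl_prob pt ({..<k} - I) A" if A: "A \<in> ?A" for A
  proof -
    \<comment> \<open>After cancelling n p^|I| only the share of nodes outside the tuple and the
      attachment probabilities at positions outside I remain.\<close>
    have "(\<lambda>n. (1 - real k / real n) * cyl_prob (p n) ({..<k} - I) A) \<longlonglongrightarrow> (1 - 0) * cyl_prob pt ({..<k} - I) A"
      by (intro tendsto_intros tendsto_cyl_prob p_tendsto lim_inv filterlim_real_sequentially)
    moreover have "\<forall>\<^sub>F n in sequentially. (1 - real k / real n) * cyl_prob (p n) ({..<k} - I) A = (real n - k) * cyl_prob (p n) {..<k} A / m n"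
      using m_pos
    proof eventually_elim
      case (elim n)
      then have "real n > 0" "p n ^ card I \<noteq> 0"
        unfolding m_def zero_less_mult_iff by (auto simp del: power_eq_0_iff)
      then show ?case
        using A I by (simp add: m_def cyl_prob_split[of "{..<k}" I A] field_simps)
    qed
    ultimately show ?thesis by (simp add: tendsto_cong)
  qed
  have "bnd \<longlonglongrightarrow> 0 + (\<Sum>A\<in>?A. 0 * B) + M * \<epsilon>' + M * 0 + M * 0"
    unfolding bnd_def using limA
    by (intro tendsto_add tendsto_mult tendsto_const tendsto_sum lim_inv m_top sm_top tendsto_rabs_zero LIM_zero) auto
  then have "\<forall>\<^sub>F n in sequentially. bnd n < \<epsilon>"
    using \<epsilon>'(2) by (intro order_tendstoD(2)) auto
  from eventually_conj[OF m_pos this] obtain N1 where N1: "\<And>n. n \<ge> N1 \<Longrightarrow> m n > 0 \<and> bnd n < \<epsilon>"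
    unfolding eventually_sequentially by blast
  obtain N2 where N2: "\<And>n us t. n \<ge> N2 \<Longrightarrow> valid n (Suc k) us \<Longrightarrow> t \<subseteq> pairs (Suc k) \<Longrightarrow>
      EE n (\<lambda>G H. of_bool (adj_type G us = t) * \<bar>X n G H us - e t (proj us H)\<bar>) \<le> \<epsilon>' * PG n (\<lambda>G. adj_type G us = t)"
    using type_conv[unfolded type_conv_def, THEN spec, THEN mp, OF \<epsilon>'(1)] by blast
  show "\<exists>N. \<forall>n\<ge>N. \<forall>us. valid n k us \<longrightarrow> (\<forall>t\<subseteq>pairs k.
      EE n (\<lambda>G H. of_bool (adj_type G us = t) * \<bar>avg I X n G H us - limit_avg k I e t (proj us H)\<bar>) \<le> \<epsilon> * PG n (\<lambda>G. adj_type G us = t))"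
  proof (intro exI[of _ "max N1 N2"] allI impI)
    fix n us t assume n: "n \<ge> max N1 N2" and us: "valid n k us" and t: "t \<subseteq> pairs k"
    have "EE n (\<lambda>G H. of_bool (adj_type G us = t) * \<bar>avg I X n G H us - limit_avg k I e t (proj us H)\<bar>) \<le> bnd n * PG n (\<lambda>G. adj_type G us = t)"
      unfolding bnd_def M_def
      using n N1[of n] us t \<epsilon>'(1)
      by (intro avg_error[OF us t I X e] N2 valid_snoc ext_subset) (auto simp: m_def)
    also have "\<dots> \<le> \<epsilon> * PG n (\<lambda>G. adj_type G us = t)"
      using N1[of n] n by (intro mult_right_mono) auto
    finally show "EE n (\<lambda>G H. of_bool (adj_type G us = t) * \<bar>avg I X n G H us - limit_avg k I e t (proj us H)\<bar>) \<le> \<epsilon> * PG n (\<lambda>G. adj_type G us = t)" .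
  qed
qed

end

section \<open>Controlled functionals\<close>

text \<open>D may be 0, as for an empty neighbourhood: then N = 0 as well and r = N / D = 0 still
  satisfies r D = N. Writing the difference over D' as (N - N') + r (D' - D) shows that only D'
  needs a positive lower bound.\<close>

lemma ratio_diff_le:
  fixes N D N' D' C d :: real
  assumes N: "\<bar>N\<bar> \<le> C * D" and D: "0 \<le> D" and d: "0 < d" "d \<le> D'" and C: "0 \<le> C"
  shows "\<bar>N / D - N' / D'\<bar> \<le> (1 + C) / d * (\<bar>N - N'\<bar> + \<bar>D - D'\<bar>)"
proof -
  define r where "r = N / D"
  have r: "\<bar>r\<bar> \<le> C" "r * D = N"
    using N D C by (cases "D = 0"; auto simp: r_def abs_divide divide_le_eq)+
  have "r - N' / D' = ((N - N') + r * (D' - D)) / D'"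
    using d r(2) by (simp add: field_simps)
  then have "\<bar>r - N' / D'\<bar> = \<bar>(N - N') + r * (D' - D)\<bar> / D'"
    using d by simp
  also have "\<dots> \<le> ((1 + C) * (\<bar>N - N'\<bar> + \<bar>D - D'\<bar>)) / d"
  proof (rule frac_le)
    have "\<bar>(N - N') + r * (D' - D)\<bar> \<le> \<bar>N - N'\<bar> + \<bar>r\<bar> * \<bar>D - D'\<bar>"
      by (metis abs_minus_commute abs_mult abs_triangle_ineq)
    also have "\<dots> \<le> \<bar>N - N'\<bar> + C * \<bar>D - D'\<bar>" using r(1) by (simp add: mult_right_mono)
    also have "\<dots> \<le> (1 + C) * (\<bar>N - N'\<bar> + \<bar>D - D'\<bar>)" using C by (simp add: algebra_simps)
    finally show "\<bar>(N - N') + r * (D' - D)\<bar> \<le> (1 + C) * (\<bar>N - N'\<bar> + \<bar>D - D'\<bar>)" .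
  qed (use d C in auto)
  finally show ?thesis by (simp add: r_def)
qed

lemma abs_weighted_sum_le:
  fixes r w :: "'a \<Rightarrow> real"
  assumes "\<And>v. v \<in> S \<Longrightarrow> \<bar>r v\<bar> \<le> B" "\<And>v. v \<in> S \<Longrightarrow> 0 \<le> w v"
  shows "\<bar>\<Sum>v\<in>S. r v * w v\<bar> \<le> B * (\<Sum>v\<in>S. w v)"
proof -
  have "\<bar>\<Sum>v\<in>S. r v * w v\<bar> \<le> (\<Sum>v\<in>S. B * w v)"
    using assms by (intro order.trans[OF sum_abs] sum_mono) (auto simp: abs_mult intro!: mult_right_mono)
  then show ?thesis by (simp add: sum_distrib_left)
qed

lemma abs_weighted_mean_le:
  fixes r w :: "'a \<Rightarrow> real"
  assumes "\<And>v. v \<in> S \<Longrightarrow> \<bar>r v\<bar> \<le> B" "\<And>v. v \<in> S \<Longrightarrow> 0 \<le> w v" "0 \<le> B"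
  shows "\<bar>(\<Sum>v\<in>S. r v * w v) / (\<Sum>v\<in>S. w v)\<bar> \<le> B"
proof (cases "(\<Sum>v\<in>S. w v) = 0")
  case False
  then have "(\<Sum>v\<in>S. w v) > 0" using sum_nonneg[of S w] assms(2) by fastforce
  then show ?thesis using abs_weighted_sum_le[of S r B w] assms by (simp add: abs_divide divide_le_eq)
qed (use assms in auto)

lemma common_nbrs_empty: "common_nbrs n {} G us = {..<n}"
  by (auto simp: common_nbrs_def)

lemma common_nbrs_singleton: "common_nbrs n {i} G us = nbrs G n (us ! i)"
  by (auto simp: common_nbrs_def nbrs_def)

context er_features
begin

section \<open>Closure of controlled functionals under Lipschitz maps and weighted means\<close>

definition controlled :: "nat \<Rightarrow> (nat \<Rightarrow> nat set set \<Rightarrow> (nat \<Rightarrow> 'a) \<Rightarrow> nat list \<Rightarrow> real)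
    \<Rightarrow> ((nat \<times> nat) set \<Rightarrow> (nat \<Rightarrow> 'a) \<Rightarrow> real) \<Rightarrow> real \<Rightarrow> bool" where
  "controlled k X e B \<longleftrightarrow> bounded_functional k X B \<and> bounded_limit k e B \<and> type_conv k X e \<and> 0 \<le> B"

lemma bounded_functional_mono: "bounded_functional k X B \<Longrightarrow> B \<le> C \<Longrightarrow> bounded_functional k X C"
  unfolding bounded_functional_def using order.trans by blast

lemma bounded_limit_mono: "bounded_limit k e B \<Longrightarrow> B \<le> C \<Longrightarrow> bounded_limit k e C"
  unfolding bounded_limit_def using order.trans by blast

lemma controlled_mono: "controlled k X e B \<Longrightarrow> B \<le> C \<Longrightarrow> controlled k X e C"
  unfolding controlled_def using bounded_functional_mono[of k X B C] bounded_limit_mono[of k e B C] by auto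

lemma type_conv_cong:
  assumes "\<And>n G H us. length us = k \<Longrightarrow> X n G H us = Y n G H us"
  shows "type_conv k X e \<longleftrightarrow> type_conv k Y e"
proof -
  have "EE n (\<lambda>G H. of_bool (adj_type G us = t) * \<bar>X n G H us - e t (proj us H)\<bar>) =
      EE n (\<lambda>G H. of_bool (adj_type G us = t) * \<bar>Y n G H us - e t (proj us H)\<bar>)" if "valid n k us" for n us t
    using assms[of us] that by (simp add: valid_def)
  then show ?thesis unfolding type_conv_def by (simp cong: imp_cong)
qed

lemma controlled_cong:
  assumes "\<And>n G H us. length us = k \<Longrightarrow> X n G H us = Y n G H us"
  shows "controlled k X e B \<longleftrightarrow> controlled k Y e B"
  using type_conv_cong[OF assms] assms unfolding controlled_def bounded_functional_def by simp

text \<open>The common frame for Lipschitz maps and quotients: a pointwise bound by finitely many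
  controlled errors suffices. It is asked for only from \<open>N0\<close> on, because a quotient of
  averages needs a nonzero normalisation.\<close>

lemma type_conv_dominated:
  fixes c :: real and m N0 :: nat
  assumes type_conv: "\<And>j. j < m \<Longrightarrow> type_conv k (X j) (e j)" and c: "0 \<le> c"
    and bX: "\<And>j n G us. j < m \<Longrightarrow> length us = k \<Longrightarrow> set us \<subseteq> {..<n} \<Longrightarrow> bounded_meas n (\<lambda>H. X j n G H us)"
    and be: "\<And>j t. j < m \<Longrightarrow> bounded_meas k (e j t)"
    and bY: "bounded_functional k Y C" and bf: "bounded_limit k f C"
    and dom: "\<And>n G H us t. n \<ge> N0 \<Longrightarrow> valid n k us \<Longrightarrow> H \<in> space (PF n) \<Longrightarrow>
      \<bar>Y n G H us - f t (proj us H)\<bar> \<le> c * (\<Sum>j<m. \<bar>X j n G H us - e j t (proj us H)\<bar>)"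
  shows "type_conv k Y f"
  unfolding type_conv_def
proof (intro allI impI)
  fix \<epsilon> :: real assume \<epsilon>: "\<epsilon> > 0"
  define \<epsilon>' where "\<epsilon>' = \<epsilon> / (c * m + 1)"
  have cm: "0 \<le> c * m" using c by simp
  then have \<epsilon>': "\<epsilon>' > 0" "c * (m * \<epsilon>') \<le> \<epsilon>"
    using \<epsilon> by (auto simp: \<epsilon>'_def field_simps)
  have "\<exists>N. j < m \<longrightarrow> (\<forall>n\<ge>N. \<forall>us. valid n k us \<longrightarrow> (\<forall>t\<subseteq>pairs k.
      EE n (\<lambda>G H. of_bool (adj_type G us = t) * \<bar>X j n G H us - e j t (proj us H)\<bar>) \<le> \<epsilon>' * PG n (\<lambda>G. adj_type G us = t)))" for j
    using type_conv[of j, unfolded type_conv_def, THEN spec, THEN mp, OF _ \<epsilon>'(1)] by (cases "j < m") simp_all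
  then have "\<exists>N. \<forall>j. j < m \<longrightarrow> (\<forall>n\<ge>N j. \<forall>us. valid n k us \<longrightarrow> (\<forall>t\<subseteq>pairs k.
      EE n (\<lambda>G H. of_bool (adj_type G us = t) * \<bar>X j n G H us - e j t (proj us H)\<bar>) \<le> \<epsilon>' * PG n (\<lambda>G. adj_type G us = t)))"
    by (intro choice allI)
  then obtain N where N: "\<And>j n us t. j < m \<Longrightarrow> n \<ge> N j \<Longrightarrow> valid n k us \<Longrightarrow> t \<subseteq> pairs k \<Longrightarrow>
      EE n (\<lambda>G H. of_bool (adj_type G us = t) * \<bar>X j n G H us - e j t (proj us H)\<bar>) \<le> \<epsilon>' * PG n (\<lambda>G. adj_type G us = t)"
    by blast
  show "\<exists>N. \<forall>n\<ge>N. \<forall>us. valid n k us \<longrightarrow> (\<forall>t\<subseteq>pairs k.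
      EE n (\<lambda>G H. of_bool (adj_type G us = t) * \<bar>Y n G H us - f t (proj us H)\<bar>) \<le> \<epsilon> * PG n (\<lambda>G. adj_type G us = t))"
  \<comment> \<open>The inserted 0 makes the maximum meaningful for m = 0.\<close>
  proof (intro exI[of _ "max N0 (Max (insert 0 (N ` {..<m})))"] allI impI)
    fix n us t assume n: "n \<ge> max N0 (Max (insert 0 (N ` {..<m})))" and us: "valid n k us" and t: "t \<subseteq> pairs k"
    have nN: "n \<ge> N j" if "j < m" for j using n that by auto
    have us': "length us = k" "set us \<subseteq> {..<n}" using us by (auto simp: valid_def)
    have bd: "bounded_meas n (\<lambda>H. of_bool (adj_type G us = t) * \<bar>Z n G H us - g t (proj us H)\<bar>)"
      if "bounded_meas n (\<lambda>H. Z n G H us)" "bounded_meas k (g t)" for Z g G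
      by (intro bounded_meas_mult bounded_meas_const bounded_meas_abs bounded_meas_diff bounded_meas_proj us'(2) that(1))
         (simp only: us' that(2))
    have bdX: "bounded_meas n (\<lambda>H. of_bool (adj_type G us = t) * \<bar>X j n G H us - e j t (proj us H)\<bar>)" if "j < m" for j G
      by (rule bd[of "X j" G "e j", OF bX[OF that us'] be[OF that]])
    have "EE n (\<lambda>G H. of_bool (adj_type G us = t) * \<bar>Y n G H us - f t (proj us H)\<bar>)
       \<le> EE n (\<lambda>G H. c * (\<Sum>j<m. of_bool (adj_type G us = t) * \<bar>X j n G H us - e j t (proj us H)\<bar>))"
    proof (rule EE_mono)
      show "bounded_meas n (\<lambda>H. of_bool (adj_type G us = t) * \<bar>Y n G H us - f t (proj us H)\<bar>)" for G
        by (rule bd[of Y _ f, OF bounded_functional_bounded_meas[OF bY us'] bounded_limit_bounded_meas[OF bf]])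
      show "bounded_meas n (\<lambda>H. c * (\<Sum>j<m. of_bool (adj_type G us = t) * \<bar>X j n G H us - e j t (proj us H)\<bar>))" for G
        by (rule bounded_meas_mult[OF bounded_meas_const bounded_meas_sum], rule bdX) simp
      fix G H assume "H \<in> space (PF n)"
      then show "of_bool (adj_type G us = t) * \<bar>Y n G H us - f t (proj us H)\<bar>
          \<le> c * (\<Sum>j<m. of_bool (adj_type G us = t) * \<bar>X j n G H us - e j t (proj us H)\<bar>)"
        using dom[OF _ us, of H G t] n by (cases "adj_type G us = t") auto
    qed
    also have "\<dots> = c * (\<Sum>j<m. EE n (\<lambda>G H. of_bool (adj_type G us = t) * \<bar>X j n G H us - e j t (proj us H)\<bar>))"
      unfolding EE_cmult by (subst EE_sum, rule bdX) simp_all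
    also have "\<dots> \<le> c * (\<Sum>j<m. \<epsilon>' * PG n (\<lambda>G. adj_type G us = t))"
      using c nN us t by (intro mult_left_mono sum_mono N) auto
    also have "\<dots> = (c * (m * \<epsilon>')) * PG n (\<lambda>G. adj_type G us = t)" by simp
    also have "\<dots> \<le> \<epsilon> * PG n (\<lambda>G. adj_type G us = t)" using \<epsilon>'(2) by (intro mult_right_mono) auto
    finally show "EE n (\<lambda>G H. of_bool (adj_type G us = t) * \<bar>Y n G H us - f t (proj us H)\<bar>) \<le> \<epsilon> * PG n (\<lambda>G. adj_type G us = t)" .
  qed
qed

lemma controlled_const: "controlled k (\<lambda>_ _ _ _. c) (\<lambda>_ _. c) \<bar>c\<bar>"
  by (simp add: controlled_def bounded_functional_def bounded_limit_def type_conv_def EE_graph) (simp add: EG_def sum_nonneg)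

lemma controlled_local_lipschitz:
  assumes X: "\<And>j. j < m \<Longrightarrow> controlled k (X j) (e j) B" and g: "local_lipschitz m g"
    and C: "0 \<le> C" "\<And>x. boxed m B x \<Longrightarrow> \<bar>g x\<bar> \<le> C"
  shows "controlled k (\<lambda>n G H us. g (map (\<lambda>j. X j n G H us) [0..<m])) (\<lambda>t h. g (map (\<lambda>j. e j t h) [0..<m])) C"
proof -
  have bX: "bounded_functional k (X j) B" and be: "bounded_limit k (e j) B" and cX: "type_conv k (X j) (e j)" if "j < m" for j
    using X[OF that] by (auto simp: controlled_def)
  have boxX: "boxed m B (map (\<lambda>j. X j n G H us) [0..<m])"
    if "length us = k" "set us \<subseteq> {..<n}" "H \<in> space (PF n)" for n G H us
    using bX that by (auto simp: boxed_def bounded_functional_def)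
  have boxe: "boxed m B (map (\<lambda>j. e j t h) [0..<m])" if "h \<in> space (PF k)" for t h
    using be that by (auto simp: boxed_def bounded_limit_def)
  have bY: "bounded_functional k (\<lambda>n G H us. g (map (\<lambda>j. X j n G H us) [0..<m])) C"
    unfolding bounded_functional_def
  proof (intro allI impI conjI ballI)
    fix n :: nat and G us assume us: "length us = k" "set us \<subseteq> {..<n}"
    show "(\<lambda>H. g (map (\<lambda>j. X j n G H us) [0..<m])) \<in> borel_measurable (PF n)"
      using bX us by (intro local_lipschitz_measurable[OF g, where B = B]) (auto simp: bounded_functional_def)
    show "\<bar>g (map (\<lambda>j. X j n G H us) [0..<m])\<bar> \<le> C" if "H \<in> space (PF n)" for H
      using C(2) boxX[OF us that] .
  qed
  have bf: "bounded_limit k (\<lambda>t h. g (map (\<lambda>j. e j t h) [0..<m])) C"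
    unfolding bounded_limit_def
  proof (intro allI conjI ballI)
    fix t
    show "(\<lambda>h. g (map (\<lambda>j. e j t h) [0..<m])) \<in> borel_measurable (PF k)"
      using be by (intro local_lipschitz_measurable[OF g, where B = B]) (auto simp: bounded_limit_def)
    show "\<bar>g (map (\<lambda>j. e j t h) [0..<m])\<bar> \<le> C" if "h \<in> space (PF k)" for h
      using C(2) boxe[OF that] .
  qed
  obtain L where L: "L \<ge> 0" "\<And>x y. boxed m B x \<Longrightarrow> boxed m B y \<Longrightarrow>
      \<bar>g x - g y\<bar> \<le> L * (\<Sum>j<m. \<bar>x ! j - y ! j\<bar>)" using g unfolding local_lipschitz_def by metis
  have "type_conv k (\<lambda>n G H us. g (map (\<lambda>j. X j n G H us) [0..<m])) (\<lambda>t h. g (map (\<lambda>j. e j t h) [0..<m]))"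
  proof (rule type_conv_dominated[OF cX L(1) bounded_functional_bounded_meas[OF bX] bounded_limit_bounded_meas[OF be] bY bf])
    fix n G H us t assume us: "valid n k us" and H: "H \<in> space (PF n)"
    then have us': "length us = k" "set us \<subseteq> {..<n}" by (auto simp: valid_def)
    have "proj us H \<in> space (PF k)" using proj_space[OF us'(2) H] us' by simp
    from L(2)[OF boxX[OF us' H] boxe[OF this]]
    show "\<bar>g (map (\<lambda>j. X j n G H us) [0..<m]) - g (map (\<lambda>j. e j t (proj us H)) [0..<m])\<bar>
       \<le> L * (\<Sum>j<m. \<bar>X j n G H us - e j t (proj us H)\<bar>)" by simp
  qed
  then show ?thesis using bY bf C by (simp add: controlled_def)
qed

lemma controlled_mult:
  assumes "controlled k X e B" "controlled k Y f B"
  shows "controlled k (\<lambda>n G H us. X n G H us * Y n G H us) (\<lambda>t h. e t h * f t h) (B * B)"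
proof -
  let ?X = "\<lambda>j::nat. if j = 0 then X else Y" and ?e = "\<lambda>j::nat. if j = 0 then e else f"
  have B: "0 \<le> B" using assms by (simp add: controlled_def)
  have "local_lipschitz 2 (\<lambda>x. x ! 0 * x ! 1)" by (rule local_lipschitz_mult)
  moreover have "\<bar>x ! 0 * x ! 1\<bar> \<le> B * B" if "boxed 2 B x" for x
    using that B unfolding abs_mult boxed_def by (intro mult_mono) auto
  ultimately have "controlled k (\<lambda>n G H us. map (\<lambda>j. ?X j n G H us) [0..<2] ! 0 * map (\<lambda>j. ?X j n G H us) [0..<2] ! 1)
      (\<lambda>t h. map (\<lambda>j. ?e j t h) [0..<2] ! 0 * map (\<lambda>j. ?e j t h) [0..<2] ! 1) (B * B)"
    using assms B by (intro controlled_local_lipschitz[of 2 k ?X ?e B]) auto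
  then show ?thesis by simp
qed

lemma pt_bounds: "0 \<le> pt" "pt \<le> 1"
  using p_tendsto by (auto intro: LIMSEQ_le_const LIMSEQ_le_const2)

text \<open>The limiting share of selected nodes does not vanish. If the limit of p is 0, the
  pattern A = I has weight 1; otherwise the full pattern has as weight a power of the positive
  limit. The result enters the lower bound for limiting denominators.\<close>

lemma sum_cyl_prob_pos:
  fixes k :: nat
  assumes "I \<subseteq> {..<k}"
  shows "(\<Sum>A | I \<subseteq> A \<and> A \<subseteq> {..<k}. cyl_prob pt ({..<k} - I) A) > 0"
proof -
  define A where "A = (if pt = 0 then I else {..<k})"
  show ?thesis
  proof (rule sum_pos2[of _ A])
    show "A \<in> {A. I \<subseteq> A \<and> A \<subseteq> {..<k}}" using assms by (auto simp: A_def)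
    show "0 < cyl_prob pt ({..<k} - I) A"
      using pt_bounds unfolding cyl_prob_def A_def by (intro prod_pos) auto
    show "0 \<le> cyl_prob pt ({..<k} - I) A" for A using pt_bounds by (rule cyl_prob_nonneg)
  qed (rule finite_exts)
qed

lemma avg_last_cmult: "avg_last k (\<lambda>h. c * x h) h = c * avg_last k x h"
  by (simp add: avg_last_def)

(* An empty neighbourhood needs no case distinction: the quotient is then 0 / 0 = 0, which is the prescribed value. *)
lemma controlled_wmean:
  assumes R: "controlled (Suc k) R eR B" and W: "controlled (Suc k) W eW B" and I: "I \<subseteq> {..<k}"
    and c: "0 < c" "\<And>n G H us. length us = Suc k \<Longrightarrow> set us \<subseteq> {..<n} \<Longrightarrow> H \<in> space (PF n) \<Longrightarrow> c \<le> W n G H us"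
    "\<And>t h. h \<in> space (PF (Suc k)) \<Longrightarrow> c \<le> eW t h"
    and top: "filterlim (\<lambda>n. real n * p n ^ card I) at_top sequentially"
  shows "controlled k (\<lambda>n G H us. (\<Sum>v\<in>common_nbrs n I G us. R n G H (us @ [v]) * W n G H (us @ [v])) / (\<Sum>v\<in>common_nbrs n I G us. W n G H (us @ [v])))
     (\<lambda>t h. limit_avg k I (\<lambda>t h. eR t h * eW t h) t h / limit_avg k I eW t h) B"
proof -
  let ?A = "{A. I \<subseteq> A \<and> A \<subseteq> {..<k}}"
  let ?RW = "\<lambda>n G H us. R n G H us * W n G H us" and ?eRW = "\<lambda>t h. eR t h * eW t h"
  define Y where "Y = (\<lambda>n G H us. (\<Sum>v\<in>common_nbrs n I G us. R n G H (us @ [v]) * W n G H (us @ [v])) / (\<Sum>v\<in>common_nbrs n I G us. W n G H (us @ [v])))"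
  define f where "f = (\<lambda>t h. limit_avg k I ?eRW t h / limit_avg k I eW t h)"
  have B: "0 \<le> B" using R by (simp add: controlled_def)
  note RW = controlled_mult[OF R W]
  have bR: "bounded_functional (Suc k) R B" and bW: "bounded_functional (Suc k) W B" and bRW: "bounded_functional (Suc k) ?RW (B * B)"
    and eR: "bounded_limit (Suc k) eR B" and eW: "bounded_limit (Suc k) eW B" and eRW: "bounded_limit (Suc k) ?eRW (B * B)"
    and cW: "type_conv (Suc k) W eW" and cRW: "type_conv (Suc k) ?RW ?eRW"
    using R W RW by (auto simp: controlled_def)
  have snoc: "length (us @ [v]) = Suc k" "set (us @ [v]) \<subseteq> {..<n}"
    if "length us = k" "set us \<subseteq> {..<n}" "v \<in> common_nbrs n I G us" for us v n G
    using that common_nbrs_subset[of n I G us] by auto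
  have pw: "\<bar>R n G H (us @ [v])\<bar> \<le> B" "c \<le> W n G H (us @ [v])"
    if "length us = k" "set us \<subseteq> {..<n}" "v \<in> common_nbrs n I G us" "H \<in> space (PF n)" for us v n G H
    using snoc[OF that(1-3)] that(4) bR c(2) by (auto simp: bounded_functional_def)
  have bY: "bounded_functional k Y B"
    unfolding bounded_functional_def
  proof (intro allI impI conjI ballI)
    fix n :: nat and G us assume us: "length us = k" "set us \<subseteq> {..<n}"
    show "(\<lambda>H. Y n G H us) \<in> borel_measurable (PF n)"
      unfolding Y_def using snoc[OF us] bR bW
      by (intro borel_measurable_divide borel_measurable_sum borel_measurable_times) (auto simp: bounded_functional_def)
    show "\<bar>Y n G H us\<bar> \<le> B" if "H \<in> space (PF n)" for H
      unfolding Y_def using pw[OF us _ that] c(1) B by (intro abs_weighted_mean_le) force+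
  qed
  define w0 where "w0 = (\<Sum>A\<in>?A. cyl_prob pt ({..<k} - I) A)"
  have w0: "w0 > 0" unfolding w0_def using sum_cyl_prob_pos[OF I] .
  have w_nonneg: "0 \<le> cyl_prob pt ({..<k} - I) A" for A using pt_bounds by (rule cyl_prob_nonneg)
  have D': "c * w0 \<le> limit_avg k I eW t h" if h: "h \<in> space (PF k)" for t h
  proof -
    have "c \<le> avg_last k (eW (t \<union> A \<times> {k})) h" for A
      using avg_last_mono[OF bounded_meas_const bounded_limit_bounded_meas[OF eW] h, of c] c(3) by (simp add: avg_last_const)
    then show ?thesis unfolding limit_avg_def w0_def sum_distrib_left
      using w_nonneg by (intro sum_mono) (metis mult.commute mult_left_mono)
  qed
  \<comment> \<open>This inequality survives the averaging because it is linear in the weight; it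
    bounds the limiting quotient by B.\<close>
  have N': "\<bar>limit_avg k I ?eRW t h\<bar> \<le> B * limit_avg k I eW t h" if h: "h \<in> space (PF k)" for t h
  proof -
    have "\<bar>avg_last k (?eRW t') h\<bar> \<le> B * avg_last k (eW t') h" for t'
    proof -
      have b: "\<bar>eR t' y * eW t' y\<bar> \<le> B * eW t' y" if "y \<in> space (PF (Suc k))" for y
        using eR c(1) c(3)[OF that, of t'] that by (auto simp: bounded_limit_def abs_mult intro!: mult_right_mono)
      have "avg_last k (?eRW t') h \<le> avg_last k (\<lambda>y. B * eW t' y) h"
        using b by (intro avg_last_mono[OF bounded_limit_bounded_meas[OF eRW] _ h] bounded_meas_mult bounded_meas_const bounded_limit_bounded_meas[OF eW]) force
      moreover have "avg_last k (\<lambda>y. - B * eW t' y) h \<le> avg_last k (?eRW t') h"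
        using b by (intro avg_last_mono[OF _ bounded_limit_bounded_meas[OF eRW] h] bounded_meas_mult bounded_meas_const bounded_limit_bounded_meas[OF eW]) force
      ultimately show ?thesis unfolding avg_last_cmult by linarith
    qed
    then have "\<bar>limit_avg k I ?eRW t h\<bar> \<le> (\<Sum>A\<in>?A. cyl_prob pt ({..<k} - I) A * (B * avg_last k (eW (t \<union> A \<times> {k})) h))"
      unfolding limit_avg_def using w_nonneg
      by (intro order.trans[OF sum_abs] sum_mono) (auto simp: abs_mult intro!: mult_left_mono)
    then show ?thesis by (simp add: limit_avg_def sum_distrib_left mult.left_commute)
  qed
  have bf: "bounded_limit k f B"
    unfolding bounded_limit_def
  proof (intro allI conjI ballI)
    fix t
    show "f t \<in> borel_measurable (PF k)"
      unfolding f_def using bounded_meas_limit_avg[OF eRW, of I t] bounded_meas_limit_avg[OF eW, of I t]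
      by (intro borel_measurable_divide) (auto simp: bounded_meas_def)
    show "\<bar>f t h\<bar> \<le> B" if "h \<in> space (PF k)" for h
    proof -
      have "0 < limit_avg k I eW t h" using D'[OF that, of t] c(1) w0 by (meson less_le_trans mult_pos_pos)
      then show ?thesis using N'[OF that, of t] by (simp add: f_def abs_divide divide_le_eq)
    qed
  qed
  have "\<forall>\<^sub>F n in sequentially. real n * p n ^ card I > 0"
    using top by (simp add: filterlim_at_top_dense)
  then obtain N0 where N0: "\<And>n. n \<ge> N0 \<Longrightarrow> real n * p n ^ card I > 0"
    unfolding eventually_sequentially by blast
  \<comment> \<open>Index 0 is the numerator, every other index the denominator; the quotient
    depends on both through \<open>ratio_diff_le\<close>.\<close>
  let ?X = "\<lambda>j::nat. if j = 0 then avg I ?RW else avg I W"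
  let ?e = "\<lambda>j::nat. if j = 0 then limit_avg k I ?eRW else limit_avg k I eW"
  have "type_conv k Y f"
  proof (rule type_conv_dominated[where m = 2 and X = ?X and e = ?e and c = "(1 + B) / (c * w0)" and C = B and ?N0.0 = N0])
    show "type_conv k (?X j) (?e j)" for j
      using type_conv_avg[OF I bRW eRW cRW top] type_conv_avg[OF I bW _ cW top] bounded_limit_mono[OF eW] by auto
    show "0 \<le> (1 + B) / (c * w0)" using B c(1) w0 by simp
    show "bounded_meas n (\<lambda>H. ?X j n G H us)" if "length us = k" "set us \<subseteq> {..<n}" for j n G us
      using bounded_meas_avg[OF bRW that] bounded_meas_avg[OF bW that] by simp
    show "bounded_meas k (?e j t)" for j t
      using bounded_meas_limit_avg[OF eRW] bounded_meas_limit_avg[OF eW] by simp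
    fix n G H us t assume n: "N0 \<le> n" and us: "valid n k us" and H: "H \<in> space (PF n)"
    have us': "length us = k" "set us \<subseteq> {..<n}" using us by (auto simp: valid_def)
    have h: "proj us H \<in> space (PF k)" using proj_space[OF us'(2) H] us' by simp
    define m where "m = real n * p n ^ card I"
    have m: "m > 0" using N0[OF n] by (simp add: m_def)
    \<comment> \<open>The normalisation cancels only if it is nonzero, which n \<ge> N0
      guarantees.\<close>
    have "Y n G H us = avg I ?RW n G H us / avg I W n G H us"
      using m by (simp add: Y_def avg_def m_def[symmetric])
    moreover have "\<bar>avg I ?RW n G H us\<bar> \<le> B * avg I W n G H us"
    proof -
      have "\<bar>\<Sum>v\<in>common_nbrs n I G us. ?RW n G H (us @ [v])\<bar> \<le> B * (\<Sum>v\<in>common_nbrs n I G us. W n G H (us @ [v]))"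
        using pw[OF us' _ H] c(1) by (intro abs_weighted_sum_le) force+
      from divide_right_mono[OF this, of m] show ?thesis
        using m by (simp add: avg_def m_def[symmetric] abs_divide)
    qed
    moreover have "0 \<le> avg I W n G H us"
      unfolding avg_def m_def[symmetric] using pw[OF us' _ H] c(1) m by (intro divide_nonneg_pos sum_nonneg) force+
    ultimately show "\<bar>Y n G H us - f t (proj us H)\<bar> \<le> (1 + B) / (c * w0) * (\<Sum>j<2. \<bar>?X j n G H us - ?e j t (proj us H)\<bar>)"
      using ratio_diff_le[of "avg I ?RW n G H us" B "avg I W n G H us" "c * w0" "limit_avg k I eW t (proj us H)" "limit_avg k I ?eRW t (proj us H)"]
        D'[OF h, of t] B c(1) w0 by (simp add: f_def numeral_2_eq_2)
  qed (use bY bf in auto)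
  then show ?thesis using bY bf B by (simp add: controlled_def Y_def f_def)
qed

section \<open>Random walk probabilities\<close>

lemma controlled_walkp_step:
  assumes i: "i < k" and j: "j < k" and X: "controlled (Suc k) (\<lambda>n G H us. walkp G n m (us ! k) (us ! j)) (\<lambda>_ _. 0) 1"
  shows "controlled k (\<lambda>n G H us. walkp G n (Suc m) (us ! i) (us ! j)) (\<lambda>_ _. 0) 1"
proof -
  have eq: "(\<Sum>v\<in>common_nbrs n {i} G us. walkp G n m ((us @ [v]) ! k) ((us @ [v]) ! j) * 1) / (\<Sum>v\<in>common_nbrs n {i} G us. 1)
     = walkp G n (Suc m) (us ! i) (us ! j)" if "length us = k" for n G us
    using that j by (simp add: common_nbrs_singleton nth_append sum_divide_distrib)
  have "controlled (Suc k) (\<lambda>_ _ _ _. 1) (\<lambda>_ _. 1) 1" using controlled_const[of "Suc k" 1] by simp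
  from controlled_wmean[OF X this, of "{i}" 1] i np_at_top
  have "controlled k (\<lambda>n G H us. (\<Sum>v\<in>common_nbrs n {i} G us. walkp G n m ((us @ [v]) ! k) ((us @ [v]) ! j) * 1) / (\<Sum>v\<in>common_nbrs n {i} G us. 1))
     (\<lambda>t h. limit_avg k {i} (\<lambda>t h. 0 * 1) t h / limit_avg k {i} (\<lambda>_ _. 1) t h) 1" by simp
  also have "(\<lambda>t h. limit_avg k {i} (\<lambda>t h. 0 * 1) t h / limit_avg k {i} (\<lambda>_ _. 1) t h) = (\<lambda>_ _. 0)"
    by (simp add: limit_avg_def avg_last_const fun_eq_iff)
  finally show ?thesis by (subst controlled_cong[OF eq[symmetric]])
qed

text \<open>Each step appends the next position of the walk to the tuple, so the induction passes to
  longer tuples. At the end, distinct positions of a valid tuple are distinct nodes and the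
  indicator is exactly 0. Walks that step onto a node of the tuple, the target included, are
  absorbed in the k B / m term of the averaging error.\<close>

lemma controlled_walkp:
  assumes "i < k" "j < k" "i \<noteq> j"
  shows "controlled k (\<lambda>n G H us. walkp G n m (us ! i) (us ! j)) (\<lambda>_ _. 0) 1"
  using assms
proof (induction m arbitrary: i k)
  case 0
  have "type_conv k (\<lambda>n G H us. walkp G n 0 (us ! i) (us ! j)) (\<lambda>_ _. 0)"
    unfolding type_conv_def
  proof (intro allI impI exI[of _ 0])
    fix \<epsilon> :: real and n us t assume "\<epsilon> > 0" and us: "valid n k us"
    then have "us ! i \<noteq> us ! j" using 0 by (auto simp: valid_def nth_eq_iff_index_eq)
    then show "EE n (\<lambda>G H. of_bool (adj_type G us = t) * \<bar>walkp G n 0 (us ! i) (us ! j) - 0\<bar>) \<le> \<epsilon> * PG n (\<lambda>G. adj_type G us = t)"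
      using \<open>\<epsilon> > 0\<close> PG_nonneg[of n "\<lambda>G. adj_type G us = t"] by (simp add: EE_def EG_def)
  qed
  then show ?case by (auto simp: controlled_def bounded_functional_def bounded_limit_def)
next
  case (Suc m)
  then show ?case by (intro controlled_walkp_step Suc.IH) auto
qed

text \<open>The first step moves the walk to the fresh position k, which differs from its target i,
  so \<open>controlled_walkp\<close> applies although start and target coincide.\<close>

lemma controlled_walkp_return:
  "i < k \<Longrightarrow> controlled k (\<lambda>n G H us. walkp G n (Suc m) (us ! i) (us ! i)) (\<lambda>_ _. 0) 1"
  by (intro controlled_walkp_step controlled_walkp) auto

end

section \<open>Terms are controlled\<close>

lemma length_concat_map:
  "list_all2 (\<lambda>t e. length (g t) = e) ts es \<Longrightarrow> length (concat (map g ts)) = sum_list es"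
  by (induction ts es rule: list_all2_induct) auto

lemma idx_list: "distinct (idx_list :: 'd::finite list) \<and> set (idx_list :: 'd list) = UNIV"
  unfolding idx_list_def by (rule someI_ex) (use finite_distinct_list[of "UNIV :: 'd set"] in auto)

lemma length_idx_list: "length (idx_list :: 'd::finite list) = CARD('d)"
  using idx_list distinct_card by metis

lemma vec_to_list_nth: "j < CARD('d) \<Longrightarrow> vec_to_list (x :: real ^ 'd::finite) ! j = x $ (idx_list ! j)"
  by (simp add: vec_to_list_def length_idx_list)

lemma length_sem:
  fixes H :: "nat \<Rightarrow> real ^ 'd::finite"
  assumes "wf CARD('d) k0 k t e"
  shows "length (sem k0 n G H us t) = e"
  using assms
proof (induction arbitrary: us rule: wf.induct)
  case (wf_App k ts es e f)
  have "list_all2 (\<lambda>t e. length (sem k0 n G H us t) = e) ts es"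
    using wf_App.IH by (rule list_all2_mono) auto
  then show ?case using wf_App.hyps by (auto simp: length_concat_map lipschitz_vec_def)
qed (auto simp: vec_to_list_def length_idx_list rw_def wmean_def)

text \<open>Entry j belongs to j + 1 steps. Isolated nodes need no exception: the empty sum makes
  every positive step of \<open>walkp\<close> give 0, the prescribed value.\<close>

lemma rw_nth: "j < k0 \<Longrightarrow> rw k0 G n v ! j = walkp G n (Suc j) v v"
  by (auto simp: rw_def simp del: upt_Suc)

lemma nbrs_restrict: "v < n \<Longrightarrow> nbrs (G \<inter> edges n) n v = nbrs G n v"
  by (auto simp: nbrs_def intro: doubleton_in_edges)

lemma nbrs_subset: "nbrs G n v \<subseteq> {..<n}"
  by (auto simp: nbrs_def)

lemma walkp_restrict: "u < n \<Longrightarrow> walkp (G \<inter> edges n) n m u w = walkp G n m u w"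
proof (induction m arbitrary: u)
  case (Suc m)
  then show ?case using nbrs_subset[of G n u] by (auto simp: nbrs_restrict intro!: sum.cong)
qed simp

lemma wmean_cong:
  assumes "A = B" "\<And>v. v \<in> B \<Longrightarrow> r v = r' v" "\<And>v. v \<in> B \<Longrightarrow> w v = w' v"
  shows "wmean e A r w = wmean e B r' w'"
  unfolding wmean_def using assms by (simp cong: sum.cong)

text \<open>The nodes must lie below n, since the neighbours of a larger node would be read off
  edges outside \<open>edges n\<close>.\<close>

lemma sem_restrict:
  fixes H :: "nat \<Rightarrow> real ^ 'd::finite"
  assumes "wf d k0 k t e" "length us = k" "set us \<subseteq> {..<n}"
  shows "sem k0 n (G \<inter> edges n) H us t = sem k0 n G H us t"
  using assms
proof (induction arbitrary: us rule: wf.induct)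
  case (wf_RW i k)
  then have "us ! i < n" using nth_mem by blast
  then show ?case by (simp add: rw_def nbrs_restrict walkp_restrict)
next
  case (wf_App k ts es e f)
  have "map (sem k0 n (G \<inter> edges n) H us) ts = map (sem k0 n G H us) ts"
    using wf_App.IH wf_App.prems by (induction ts es rule: list_all2_induct) auto
  then show ?case by (simp only: sem.simps)
next
  case (wf_GMean k \<rho> e \<eta> m h)
  then show ?case by (auto intro!: wmean_cong)
next
  case (wf_LMean i k \<rho> e \<eta> m h)
  then have "us ! i < n" using nth_mem by blast
  then show ?case using wf_LMean nbrs_subset[of G n "us ! i"]
    by (auto simp: nbrs_restrict intro!: wmean_cong)
qed auto

(* Features are bounded only almost surely; truncation makes all functionals bounded everywhere. *)
definition trunc :: "real \<Rightarrow> 'b::real_normed_vector \<Rightarrow> 'b" where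
  "trunc B x = (if norm x \<le> B then x else 0)"

lemma norm_trunc: "0 \<le> B \<Longrightarrow> norm (trunc B x) \<le> B"
  by (simp add: trunc_def)

context er_features
begin

lemma controlled_uniform:
  assumes "\<And>i. i < e \<Longrightarrow> \<exists>c B. controlled k (X i) c B"
  shows "\<exists>c B. \<forall>i<(e::nat). controlled k (X i) (c i) B"
proof -
  have "\<forall>i. \<exists>cB. i < e \<longrightarrow> controlled k (X i) (fst cB) (snd cB)" using assms by auto
  then have "\<exists>cB. \<forall>i. i < e \<longrightarrow> controlled k (X i) (fst (cB i)) (snd (cB i))" by (rule choice)
  then obtain cB where cB: "\<And>i. i < e \<Longrightarrow> controlled k (X i) (fst (cB i)) (snd (cB i))" by blast
  have "controlled k (X i) (fst (cB i)) (Max ((snd \<circ> cB) ` {..<e}))" if "i < e" for i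
    using that by (intro controlled_mono[OF cB]) auto
  then show ?thesis by (intro exI[of _ "\<lambda>i. fst (cB i)"] exI) auto
qed

lemma controlled_Lipschitz:
  assumes X: "\<And>j. j < m \<Longrightarrow> \<exists>c B. controlled k (\<lambda>n G H us. T n G H us ! j) c B" and g: "local_lipschitz m g"
    and len: "\<And>n G H us. length (T n G H us) = m"
  shows "\<exists>c B. controlled k (\<lambda>n G H us. g (T n G H us)) c B"
proof -
  obtain c B where cB: "\<And>j. j < m \<Longrightarrow> controlled k (\<lambda>n G H us. T n G H us ! j) (c j) B"
    using controlled_uniform[where X = "\<lambda>j n G H us. T n G H us ! j", OF X] by blast
  obtain C where "0 \<le> C" "\<And>x. boxed m B x \<Longrightarrow> \<bar>g x\<bar> \<le> C" using local_lipschitz_bounded[OF g] by blast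
  from controlled_local_lipschitz[where X = "\<lambda>j n G H us. T n G H us ! j", OF cB g this]
  have "controlled k (\<lambda>n G H us. g (map (\<lambda>j. T n G H us ! j) [0..<m])) (\<lambda>t h. g (map (\<lambda>j. c j t h) [0..<m])) C" .
  moreover have "map (\<lambda>j. T n G H us ! j) [0..<m] = T n G H us" for n G H us
    using map_nth[of "T n G H us"] len by simp
  ultimately show ?thesis by auto
qed

lemma controlled_weighted_mean:
  assumes R: "\<exists>c B. controlled (Suc k) R c B"
    and T: "\<And>j. j < m \<Longrightarrow> \<exists>c B. controlled (Suc k) (\<lambda>n G H us. T n G H us ! j) c B"
    and len: "\<And>n G H us. length (T n G H us) = m"
    and g: "local_lipschitz m g" "\<And>x. length x = m \<Longrightarrow> g x > 0"
    and I: "I \<subseteq> {..<k}" and top: "filterlim (\<lambda>n. real n * p n ^ card I) at_top sequentially"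
  shows "\<exists>c B. controlled k (\<lambda>n G H us. (\<Sum>v\<in>common_nbrs n I G us. R n G H (us @ [v]) * g (T n G H (us @ [v])))
      / (\<Sum>v\<in>common_nbrs n I G us. g (T n G H (us @ [v])))) c B"
proof -
  obtain c B where cB: "\<And>j. j < m \<Longrightarrow> controlled (Suc k) (\<lambda>n G H us. T n G H us ! j) (c j) B"
    using controlled_uniform[where X = "\<lambda>j n G H us. T n G H us ! j", OF T] by blast
  obtain eR BR where R: "controlled (Suc k) R eR BR" using R by blast
  obtain C where C: "0 \<le> C" "\<And>x. boxed m B x \<Longrightarrow> \<bar>g x\<bar> \<le> C" using local_lipschitz_bounded[OF g(1)] by blast
  \<comment> \<open>The actual arguments of the weight and their limit functions lie in the same
    box, so a single l bounds both the weight and its limit from below.\<close>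
  obtain l where l: "0 < l" "\<And>x. boxed m B x \<Longrightarrow> l \<le> g x" using local_lipschitz_lower_bound[OF g] by blast
  define eW where "eW = (\<lambda>t h. g (map (\<lambda>j. c j t h) [0..<m]))"
  have "map (\<lambda>j. T n G H us ! j) [0..<m] = T n G H us" for n G H us
    using map_nth[of "T n G H us"] len by simp
  then have W: "controlled (Suc k) (\<lambda>n G H us. g (T n G H us)) eW C"
    using controlled_local_lipschitz[where X = "\<lambda>j n G H us. T n G H us ! j", OF cB g(1) C] by (simp add: eW_def)
  have "controlled k (\<lambda>n G H us. (\<Sum>v\<in>common_nbrs n I G us. R n G H (us @ [v]) * g (T n G H (us @ [v])))
      / (\<Sum>v\<in>common_nbrs n I G us. g (T n G H (us @ [v])))) (\<lambda>t h. limit_avg k I (\<lambda>t h. eR t h * eW t h) t h / limit_avg k I eW t h) (max BR C)"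
  proof (rule controlled_wmean[OF controlled_mono[OF R] controlled_mono[OF W] I l(1) _ _ top])
    show "l \<le> g (T n G H us)" if "length us = Suc k" "set us \<subseteq> {..<n}" "H \<in> space (PF n)" for n G H us
      using cB that len by (intro l(2)) (auto simp: boxed_def controlled_def bounded_functional_def)
    show "l \<le> eW t h" if "h \<in> space (PF (Suc k))" for t h
      unfolding eW_def using cB that by (intro l(2)) (auto simp: boxed_def controlled_def bounded_limit_def)
  qed auto
  then show ?thesis by blast
qed

lemma controlled_feature:
  assumes g: "g \<in> borel_measurable F" "\<And>x. \<bar>g x\<bar> \<le> B" and i: "i < k"
  shows "controlled k (\<lambda>n G H us. g (H (us ! i))) (\<lambda>t h. g (h i)) B"
  unfolding controlled_def
proof (intro conjI)
  have comp: "(\<lambda>H. g (H j)) \<in> borel_measurable (PF n)" if "j < n" for j n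
    by (rule measurable_compose[of "\<lambda>H. H j" _ F, OF _ g(1)], rule measurable_component_singleton) (use that in simp)
  show "bounded_functional k (\<lambda>n G H us. g (H (us ! i))) B"
    using g(2) i nth_mem by (fastforce simp: bounded_functional_def intro!: comp)
  show "bounded_limit k (\<lambda>t h. g (h i)) B"
    using g(2) i by (auto simp: bounded_limit_def intro!: comp)
  show "type_conv k (\<lambda>n G H us. g (H (us ! i))) (\<lambda>t h. g (h i))"
    unfolding type_conv_def
  proof (intro allI impI exI[of _ 0])
    fix \<epsilon> :: real and n us t assume "\<epsilon> > 0" "valid n k us"
    then show "EE n (\<lambda>G H. of_bool (adj_type G us = t) * \<bar>g (H (us ! i)) - g (proj us H i)\<bar>) \<le> \<epsilon> * PG n (\<lambda>G. adj_type G us = t)"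
      using i PG_nonneg[of n "\<lambda>G. adj_type G us = t"] by (simp add: proj_def valid_def EE_def EG_def)
  qed
  show "0 \<le> B" using g(2)[of undefined] by linarith
qed

end

text \<open>Induction over the formation rules, one coordinate at a time; the number of free
  variables varies because a mean binds a new one. Truncated features give bounds for every outcome,
  as the everywhere bounds in \<open>controlled\<close> demand.\<close>

lemma controlled_sem:
  fixes F :: "(real ^ 'd::finite) measure"
  assumes F: "er_features F p pt" and borel: "sets F = sets borel" and B: "0 \<le> B"
    and wf: "wf CARD('d) k0 k t e" and i: "i < e"
  shows "\<exists>c C. er_features.controlled F p k (\<lambda>n G H us. sem k0 n G (\<lambda>j. trunc B (H j)) us t ! i) c C"
proof -
  interpret er_features F p pt by fact
  let ?S = "\<lambda>t n G H us. sem k0 n G (\<lambda>j. trunc B (H j :: real ^ 'd)) us t"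
  show ?thesis
    using wf i
  proof (induction arbitrary: i rule: wf.induct)
    case (wf_Feat l k)
    have [measurable]: "(\<lambda>x :: real ^ 'd. x $ (idx_list ! i)) \<in> borel_measurable borel"
      by (intro borel_measurable_continuous_onI continuous_intros)
    have "(\<lambda>x :: real ^ 'd. if norm x \<le> B then x $ (idx_list ! i) else 0) \<in> borel_measurable borel"
      by measurable
    then have "(\<lambda>x :: real ^ 'd. if norm x \<le> B then x $ (idx_list ! i) else 0) \<in> borel_measurable F"
      by (simp add: measurable_cong_sets[OF borel refl])
    moreover have "(\<lambda>x :: real ^ 'd. if norm x \<le> B then x $ (idx_list ! i) else 0) = (\<lambda>x. trunc B x $ (idx_list ! i))"
      by (auto simp: trunc_def)
    ultimately have "(\<lambda>x :: real ^ 'd. trunc B x $ (idx_list ! i)) \<in> borel_measurable F" by simp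
    moreover have "\<bar>trunc B x $ (idx_list ! i)\<bar> \<le> B" for x :: "real ^ 'd"
      using component_le_norm_cart[of "trunc B x" "idx_list ! i"] norm_trunc[OF B, of x] by linarith
    ultimately have "controlled k (\<lambda>n G H us. trunc B (H (us ! l)) $ (idx_list ! i)) (\<lambda>t h. trunc B (h l) $ (idx_list ! i)) B"
      using wf_Feat by (intro controlled_feature) auto
    then show ?case using wf_Feat by (auto simp: vec_to_list_nth)
  next
    case (wf_Cst k c)
    show ?case using controlled_const[of k "c ! i"] by auto
  next
    case (wf_RW l k)
    then show ?case using controlled_walkp_return[of l k i] by (auto simp: rw_nth simp del: walkp.simps)
  next
    case (wf_App k ts es e f)
    have len: "list_all2 (\<lambda>t e. length (?S t n G H us) = e) ts es" for n G H us
      using wf_App.IH by (rule list_all2_mono) (auto simp: length_sem)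
    \<comment> \<open>Each coordinate of the concatenation is a coordinate of one argument; the
      argument lengths are independent of graph and features, so this position is too.\<close>
    have "\<exists>c C. controlled k (\<lambda>n G H us. concat (map (\<lambda>t. ?S t n G H us) ts) ! j) c C" if "j < sum_list es" for j
      using wf_App.IH that
    proof (induction ts es arbitrary: j rule: list_all2_induct)
      case (Cons t ts e es)
      have len: "length (?S t n G H us) = e" for n G H us using Cons.hyps by (auto simp: length_sem)
      show ?case
      proof (cases "j < e")
        case True
        then show ?thesis using Cons.hyps len by (auto simp: nth_append)
      next
        case False
        then show ?thesis using Cons.IH[of "j - e"] Cons.prems len by (auto simp: nth_append)
      qed
    qed simp
    then show ?case
      unfolding sem.simps using wf_App.hyps wf_App.prems length_concat_map[OF len]
      by (intro controlled_Lipschitz[where g = "\<lambda>x. f x ! i"] lipschitz_vec_local_lipschitz) auto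
  next
    case (wf_GMean k \<rho> e \<eta> m h)
    \<comment> \<open>With I = {} the required divergence is that of n itself; with I = {l} in the
      local case it is that of n p(n).\<close>
    have "\<exists>c C. controlled k (\<lambda>n G H us. (\<Sum>v\<in>common_nbrs n {} G us. ?S \<rho> n G H (us @ [v]) ! i * h (?S \<eta> n G H (us @ [v])) ! i)
      / (\<Sum>v\<in>common_nbrs n {} G us. h (?S \<eta> n G H (us @ [v])) ! i)) c C"
      using wf_GMean
      by (intro controlled_weighted_mean[where g = "\<lambda>x. h x ! i" and m = m and R = "\<lambda>n G H us. ?S \<rho> n G H us ! i"] pos_loc_lipschitz_vec_local_lipschitz)
        (auto simp: length_sem pos_loc_lipschitz_vec_def filterlim_real_sequentially)
    then show ?case using wf_GMean.prems by (simp add: wmean_def common_nbrs_empty)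
  next
    case (wf_LMean l k \<rho> e \<eta> m h)
    have "\<exists>c C. controlled k (\<lambda>n G H us. (\<Sum>v\<in>common_nbrs n {l} G us. ?S \<rho> n G H (us @ [v]) ! i * h (?S \<eta> n G H (us @ [v])) ! i)
      / (\<Sum>v\<in>common_nbrs n {l} G us. h (?S \<eta> n G H (us @ [v])) ! i)) c C"
      using wf_LMean np_at_top
      by (intro controlled_weighted_mean[where g = "\<lambda>x. h x ! i" and m = m and R = "\<lambda>n G H us. ?S \<rho> n G H us ! i"] pos_loc_lipschitz_vec_local_lipschitz)
        (auto simp: length_sem pos_loc_lipschitz_vec_def)
    moreover have "?S (LMean l e \<rho> h \<eta>) n G H us ! i = (\<Sum>v\<in>common_nbrs n {l} G us. ?S \<rho> n G H (us @ [v]) ! i * h (?S \<eta> n G H (us @ [v])) ! i)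
      / (\<Sum>v\<in>common_nbrs n {l} G us. h (?S \<eta> n G H (us @ [v])) ! i)" for n G H us
      using wf_LMean.prems by (simp add: wmean_def common_nbrs_singleton)
    ultimately show ?case by simp
  qed
qed

section \<open>Convergence of closed terms\<close>

lemma ldist_le_sum: "length x = e \<Longrightarrow> length y = e \<Longrightarrow> ldist x y \<le> (\<Sum>i<e. \<bar>x ! i - y ! i\<bar>)"
  by (simp add: ldist_L2_set L2_set_le_sum_abs)

context er_features
begin

section \<open>Passage to the product measure\<close>

lemma EE_eq_EG:
  assumes "\<And>G. G \<subseteq> edges n \<Longrightarrow> bounded_meas n (\<Phi> G)"
  shows "EE n \<Phi> = EG n (\<lambda>G. \<integral>H. \<Phi> G H \<partial>PF n)"
  unfolding EE_def EG_def using assms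
  by (subst Bochner_Integration.integral_sum) (auto intro!: bounded_meas_integrable bounded_meas_mult bounded_meas_const)

lemma measure_pair_ER:
  assumes S: "S \<in> sets (measure_pmf (ER n (p n)) \<Otimes>\<^sub>M PF n)"
  shows "measure (measure_pmf (ER n (p n)) \<Otimes>\<^sub>M PF n) S = EG n (\<lambda>G. measure (PF n) (Pair G -` S))"
proof -
  interpret PFn: prob_space "PF n" by (rule prob_space_PF)
  let ?f = "\<lambda>G. measure (PF n) (Pair G -` S)"
  have "emeasure (measure_pmf (ER n (p n)) \<Otimes>\<^sub>M PF n) S = (\<integral>\<^sup>+G. emeasure (PF n) (Pair G -` S) \<partial>measure_pmf (ER n (p n)))"
    by (rule PFn.emeasure_pair_measure_alt[OF S])
  also have "\<dots> = (\<integral>\<^sup>+G. ennreal (?f G) \<partial>measure_pmf (ER n (p n)))"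
    by (simp add: PFn.emeasure_eq_measure)
  also have "\<dots> = ennreal (\<integral>G. ?f G \<partial>measure_pmf (ER n (p n)))"
    by (intro nn_integral_eq_integral measure_pmf.integrable_const_bound[of _ 1]) auto
  also have "(\<integral>G. ?f G \<partial>measure_pmf (ER n (p n))) = EG n ?f"
    unfolding EG_def using set_pmf_ER[of n "p n"]
    by (subst integral_measure_pmf_real[of "Pow (edges n)"]) (auto simp: mult.commute)
  finally show ?thesis
    by (simp add: measure_def EG_nonneg)
qed

end

(* The value is the limit of the values for truncated features, which are measurable because they are controlled. *)
lemma measurable_sem:
  fixes F :: "(real ^ 'd::finite) measure"
  assumes F: "er_features F p pt" and borel: "sets F = sets borel"
    and wf: "wf CARD('d) k0 0 t e" and i: "i < e"
  shows "(\<lambda>H. sem k0 n G H [] t ! i) \<in> borel_measurable (PiM {..<n} (\<lambda>_. F))"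
proof (rule borel_measurable_LIMSEQ_real)
  interpret er_features F p pt by fact
  fix j :: nat
  obtain c C where "controlled 0 (\<lambda>n G H us. sem k0 n G (\<lambda>i. trunc (real j) (H i)) us t ! i) c C"
    using controlled_sem[OF F borel _ wf i, of "real j"] by auto
  then show "(\<lambda>H. sem k0 n G (\<lambda>i. trunc (real j) (H i)) [] t ! i) \<in> borel_measurable (PF n)"
    by (simp add: controlled_def bounded_functional_def)
next
  fix H assume H: "H \<in> space (PiM {..<n} (\<lambda>_. F))"
  \<comment> \<open>A point of the product space is \<open>undefined\<close> outside {..<n}, and
    truncation must fix those values too for the two feature assignments to be equal as
    functions.\<close>
  define b where "b = max (norm (undefined :: real ^ 'd)) (\<Sum>i<n. norm (H i))"
  have b: "norm (H l) \<le> b" for l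
  proof (cases "l < n")
    case True
    then have "norm (H l) \<le> (\<Sum>i<n. norm (H i))" by (intro member_le_sum) auto
    then show ?thesis unfolding b_def by (rule max.coboundedI2)
  next
    case False
    then have "H l = undefined" using H by (intro PiE_arb[of H "{..<n}"]) (auto simp: space_PiM)
    then show ?thesis unfolding b_def by simp
  qed
  have "(\<lambda>l. trunc (real j) (H l)) = H" if "real j \<ge> b" for j
    using order.trans[OF b that] by (simp add: trunc_def)
  moreover have "\<forall>\<^sub>F j in sequentially. real j \<ge> b"
    using filterlim_real_sequentially by (simp add: filterlim_at_top)
  ultimately have "\<forall>\<^sub>F j in sequentially. sem k0 n G (\<lambda>l. trunc (real j) (H l)) [] t ! i = sem k0 n G H [] t ! i"
    by (auto elim!: eventually_mono)
  then show "(\<lambda>j. sem k0 n G (\<lambda>l. trunc (real j) (H l)) [] t ! i) \<longlonglongrightarrow> sem k0 n G H [] t ! i"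
    by (rule tendsto_eventually)
qed

lemma measurable_ldist_sem:
  fixes F :: "(real ^ 'd::finite) measure"
  assumes F: "er_features F p pt" and borel: "sets F = sets borel"
    and wf: "wf CARD('d) k0 0 t e" and z: "length z = e"
  shows "(\<lambda>H. ldist (sem k0 n G H [] t) z) \<in> borel_measurable (PiM {..<n} (\<lambda>_. F))"
  using measurable_sem[OF F borel wf]
  by (simp add: ldist_L2_set[OF length_sem[OF wf] z] L2_set_def)

(* The type of graphs is uncountable, so joint measurability needs that only the finitely many possible edges matter. *)
lemma sets_deviation:
  fixes F :: "(real ^ 'd::finite) measure" and n :: nat
  assumes F: "er_features F p pt" and borel: "sets F = sets borel"
    and wf: "wf CARD('d) k0 0 t e" and z: "length z = e"
  defines "\<mu> \<equiv> measure_pmf (ER n (p n)) \<Otimes>\<^sub>M PiM {..<n} (\<lambda>_. F)"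
  shows "{\<omega> \<in> space \<mu>. ldist (sem k0 n (fst \<omega>) (snd \<omega>) [] t) z < \<epsilon>} \<in> sets \<mu>"
proof -
  let ?S = "\<lambda>G. {H \<in> space (PiM {..<n} (\<lambda>_. F)). ldist (sem k0 n G H [] t) z < \<epsilon>}"
  have "{\<omega> \<in> space \<mu>. ldist (sem k0 n (fst \<omega>) (snd \<omega>) [] t) z < \<epsilon>}
      = (\<Union>G\<in>Pow (edges n). {G'. G' \<inter> edges n = G} \<times> ?S G)"
  proof (rule set_eqI)
    fix \<omega> :: "nat set set \<times> (nat \<Rightarrow> real ^ 'd)"
    obtain G' H where \<omega>: "\<omega> = (G', H)" by (cases \<omega>)
    have "sem k0 n (G' \<inter> edges n) H [] t = sem k0 n G' H [] t" by (rule sem_restrict[OF wf]) auto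
    then show "\<omega> \<in> {\<omega> \<in> space \<mu>. ldist (sem k0 n (fst \<omega>) (snd \<omega>) [] t) z < \<epsilon>}
        \<longleftrightarrow> \<omega> \<in> (\<Union>G\<in>Pow (edges n). {G'. G' \<inter> edges n = G} \<times> ?S G)"
      by (simp add: \<omega> \<mu>_def space_pair_measure)
  qed
  also have "\<dots> \<in> sets \<mu>"
  proof (intro sets.finite_UN)
    fix G
    have "?S G \<in> sets (PiM {..<n} (\<lambda>_. F))"
      using measurable_ldist_sem[OF F borel wf z, of n G] by (rule borel_measurable_less) simp
    then show "{G'. G' \<inter> edges n = G} \<times> ?S G \<in> sets \<mu>"
      unfolding \<mu>_def by (intro pair_measureI) auto
  qed simp
  finally show ?thesis .
qed

text \<open>The empty tuple has only one type, of probability 1, and no features, so the limit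
  function is a constant. Markov's inequality for the sum of the coordinate errors then gives
  convergence in probability; it is applied graph by graph and averaged.\<close>

lemma closed_term_converges:
  fixes F :: "(real ^ 'd::finite) measure"
  assumes F: "er_features F p pt" and borel: "sets F = sets borel"
    and bd: "AE x in F. norm x \<le> B0" and wf: "wf CARD('d) k0 0 t e"
  shows "closed_term_aas_converges k0 p F e t"
proof -
  interpret er_features F p pt by fact
  \<comment> \<open>B exceeds the almost sure bound and the norm of \<open>undefined\<close>, so
    almost surely truncation leaves the whole feature assignment unchanged.\<close>
  define B where "B = max (max B0 0) (norm (undefined :: real ^ 'd))"
  define X where "X = (\<lambda>i n G H us. sem k0 n G (\<lambda>j. trunc B (H j :: real ^ 'd)) us t ! i)"
  have "\<exists>c C. controlled 0 (X i) c C" if "i < e" for i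
    using controlled_sem[OF F borel _ wf that, of B] by (simp add: X_def B_def)
  then obtain c C where c: "\<And>i. i < e \<Longrightarrow> controlled 0 (X i) (c i) C"
    using controlled_uniform[where X = X] by blast
  \<comment> \<open>The limit functions at the only type and the only point of the product over the
    empty index set.\<close>
  define z where "z = map (\<lambda>i. c i {} (\<lambda>_. undefined)) [0..<e]"
  have z: "length z = e" by (simp add: z_def)
  have p0: "proj [] H = (\<lambda>_. undefined)" for H :: "nat \<Rightarrow> real ^ 'd" by (auto simp: proj_def)
  have t0: "adj_type G [] = {}" for G by (auto simp: adj_type_def)
  have bX: "bounded_meas n (\<lambda>H. \<bar>X i n G H [] - z ! i\<bar>)" if "i < e" for i n G
    using c[OF that] by (intro bounded_meas_abs bounded_meas_diff bounded_meas_const bounded_functional_bounded_meas) (auto simp: controlled_def)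
  have lim: "\<exists>N. \<forall>n\<ge>N. EE n (\<lambda>G H. \<Sum>i<e. \<bar>X i n G H [] - z ! i\<bar>) \<le> \<delta>" if "\<delta> > 0" for \<delta>
  proof -
    define \<delta>' where "\<delta>' = \<delta> / (e + 1)"
    have \<delta>': "\<delta>' > 0" "e * \<delta>' \<le> \<delta>" using that by (auto simp: \<delta>'_def field_simps)
    have "\<exists>N. i < e \<longrightarrow> (\<forall>n\<ge>N. EE n (\<lambda>G H. \<bar>X i n G H [] - z ! i\<bar>) \<le> \<delta>')" for i
    proof (cases "i < e")
      case True
      then have "type_conv 0 (X i) (c i)" using c by (simp add: controlled_def)
      from this[unfolded type_conv_def, THEN spec, THEN mp, OF \<delta>'(1)]
      obtain N where "\<And>n us t. n \<ge> N \<Longrightarrow> valid n 0 us \<Longrightarrow> t \<subseteq> pairs 0 \<Longrightarrow>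
        EE n (\<lambda>G H. of_bool (adj_type G us = t) * \<bar>X i n G H us - c i t (proj us H)\<bar>) \<le> \<delta>' * PG n (\<lambda>G. adj_type G us = t)"
        by blast
      from this[of _ "[]" "{}"] show ?thesis
        using True by (intro exI[of _ N]) (simp add: t0 p0 PG_True z_def valid_def)
    qed simp
    then have "\<exists>N. \<forall>i. i < e \<longrightarrow> (\<forall>n\<ge>N i. EE n (\<lambda>G H. \<bar>X i n G H [] - z ! i\<bar>) \<le> \<delta>')"
      by (intro choice allI)
    then obtain N where N: "\<And>i n. i < e \<Longrightarrow> n \<ge> N i \<Longrightarrow> EE n (\<lambda>G H. \<bar>X i n G H [] - z ! i\<bar>) \<le> \<delta>'" by blast
    have "EE n (\<lambda>G H. \<Sum>i<e. \<bar>X i n G H [] - z ! i\<bar>) \<le> \<delta>" if "n \<ge> Max (insert 0 (N ` {..<e}))" for n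
    proof -
      have "EE n (\<lambda>G H. \<Sum>i<e. \<bar>X i n G H [] - z ! i\<bar>) = (\<Sum>i<e. EE n (\<lambda>G H. \<bar>X i n G H [] - z ! i\<bar>))"
        by (rule EE_sum) (simp add: bX)
      also have "\<dots> \<le> (\<Sum>i<e. \<delta>')" using that by (intro sum_mono N) auto
      finally show ?thesis using \<delta>'(2) by simp
    qed
    then show ?thesis by blast
  qed
  have key: "measure (featured_ER p F n) {\<omega> \<in> space (featured_ER p F n). ldist (sem k0 n (fst \<omega>) (snd \<omega>) [] t) z < \<epsilon>}
      \<ge> 1 - (1 / \<epsilon>) * EE n (\<lambda>G H. \<Sum>i<e. \<bar>X i n G H [] - z ! i\<bar>)" (is "measure _ ?S \<ge> _") if \<epsilon>: "\<epsilon> > 0" for n \<epsilon>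
  proof -
    interpret PFn: prob_space "PF n" by (rule prob_space_PF)
    let ?D = "\<lambda>G H. \<Sum>i<e. \<bar>X i n G H [] - z ! i\<bar>"
    have bD: "bounded_meas n (?D G)" for G by (intro bounded_meas_sum bX) simp
    have S: "?S \<in> sets (featured_ER p F n)"
      using sets_deviation[OF F borel wf z] by (simp add: featured_ER_def)
    have slice: "measure (PF n) (Pair G -` ?S) \<ge> 1 - (1 / \<epsilon>) * (\<integral>H. ?D G H \<partial>PF n)" for G
    proof -
      have "AE H in PF n. norm (H i) \<le> B0" if "i < n" for i
        using that by (intro AE_PiM_component[where I = "{..<n}"] prob_space_axioms bd) auto
      then have ae: "AE H in PF n. \<forall>i\<in>{..<n}. norm (H i) \<le> B0" by (intro AE_finite_allI) auto
      have meas: "Pair G -` ?S \<in> sets (PF n)"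
        using sets_Pair1[OF S[unfolded featured_ER_def]] by (simp add: featured_ER_def)
      have "1 - (1 / \<epsilon>) * (\<integral>H. ?D G H \<partial>PF n) = (\<integral>H. 1 - (1 / \<epsilon>) * ?D G H \<partial>PF n)"
        using bounded_meas_integrable[OF bD, of G] by (simp add: PFn.prob_space)
      \<comment> \<open>Markov's inequality in integrated form: off the event the error is at least
        \<epsilon>, so the integrand on the left is at most 0.\<close>
      also have "\<dots> \<le> (\<integral>H. indicator (Pair G -` ?S) H \<partial>PF n)"
      proof (rule integral_mono_AE)
        show "integrable (PF n) (\<lambda>H. 1 - (1 / \<epsilon>) * ?D G H)"
          by (intro bounded_meas_integrable bounded_meas_diff bounded_meas_mult bounded_meas_const bD)
        show "integrable (PF n) (\<lambda>H. indicator (Pair G -` ?S) H :: real)"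
          using meas by (intro integrable_real_indicator) (auto simp: PFn.emeasure_eq_measure)
        show "AE H in PF n. 1 - (1 / \<epsilon>) * ?D G H \<le> indicator (Pair G -` ?S) H"
          using ae AE_space
        proof eventually_elim
          case (elim H)
          have "norm (H i) \<le> B" for i
          proof (cases "i < n")
            case True
            then have "norm (H i) \<le> B0" using elim(1) by blast
            then show ?thesis unfolding B_def by linarith
          next
            case False
            then have "H i = undefined" using elim(2) by (intro PiE_arb[of H "{..<n}"]) (auto simp: space_PiM)
            then show ?thesis unfolding B_def by simp
          qed
          then have "(\<lambda>i. trunc B (H i)) = H" by (simp add: trunc_def)
          then have dist: "ldist (sem k0 n G H [] t) z \<le> ?D G H"
            using ldist_le_sum[OF length_sem[OF wf] z, of n G H "[]"] by (simp add: X_def)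
          show ?case
          proof (cases "ldist (sem k0 n G H [] t) z < \<epsilon>")
            case True
            then have "indicator (Pair G -` ?S) H = (1 :: real)"
              using elim by (simp add: featured_ER_def space_pair_measure)
            moreover have "0 \<le> (1 / \<epsilon>) * ?D G H" using \<epsilon> by (intro mult_nonneg_nonneg sum_nonneg) auto
            ultimately show ?thesis by simp
          next
            case False
            then have "1 \<le> (1 / \<epsilon>) * ?D G H" using dist \<epsilon> by (simp add: field_simps)
            then show ?thesis by (simp add: order.trans[OF _ indicator_pos_le])
          qed
        qed
      qed
      also have "\<dots> = measure (PF n) (Pair G -` ?S)" using meas by simp
      finally show ?thesis .
    qed
    have "1 - (1 / \<epsilon>) * EE n ?D = EG n (\<lambda>G. 1 - (1 / \<epsilon>) * (\<integral>H. ?D G H \<partial>PF n))"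
      unfolding EE_eq_EG[OF bD] EG_diff EG_cmult PG_True ..
    also have "\<dots> \<le> EG n (\<lambda>G. measure (PF n) (Pair G -` ?S))"
      by (rule EG_mono) (rule slice)
    also have "\<dots> = measure (featured_ER p F n) ?S"
      using measure_pair_ER S unfolding featured_ER_def by simp
    finally show ?thesis .
  qed
  show ?thesis
    unfolding closed_term_aas_converges_def
  proof (intro exI[of _ z] conjI allI impI)
    fix \<epsilon> \<theta> :: real assume "\<epsilon> > 0" "\<theta> > 0"
    \<comment> \<open>A mean error of \<epsilon> \<theta> is what Markov's inequality turns into a
      failure probability of at most \<theta>.\<close>
    then obtain N where N: "\<And>n. n \<ge> N \<Longrightarrow> EE n (\<lambda>G H. \<Sum>i<e. \<bar>X i n G H [] - z ! i\<bar>) \<le> \<epsilon> * \<theta>"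
      using lim[of "\<epsilon> * \<theta>"] by auto
    have "1 - \<theta> \<le> measure (featured_ER p F n) {\<omega> \<in> space (featured_ER p F n). ldist (sem k0 n (fst \<omega>) (snd \<omega>) [] t) z < \<epsilon>}"
      if "n \<ge> N" for n
    proof -
      have "(1 / \<epsilon>) * EE n (\<lambda>G H. \<Sum>i<e. \<bar>X i n G H [] - z ! i\<bar>) \<le> \<theta>"
        using N[OF that] \<open>\<epsilon> > 0\<close> by (simp add: field_simps)
      then show ?thesis using key[OF \<open>\<epsilon> > 0\<close>, of n] by linarith
    qed
    then show "\<exists>N. \<forall>n\<ge>N. 1 - \<theta> \<le> measure (featured_ER p F n)
        {\<omega> \<in> space (featured_ER p F n). ldist (sem k0 n (fst \<omega>) (snd \<omega>) [] t) z < \<epsilon>}" by blast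
  qed (rule z)
qed

text \<open>Under root growth n p(n) = K n^(1 - \<beta>), under logarithmic growth n p(n) = K log n,
  and in both cases p tends to 0; a positive limit of p makes n p(n) grow linearly.\<close>

lemma regime_limits:
  fixes p :: "nat \<Rightarrow> real"
  assumes "(\<exists>pt>0. p \<longlonglongrightarrow> pt)
       \<or> (\<exists>K>0. \<exists>\<beta>. 0 < \<beta> \<and> \<beta> < 1 \<and> (\<forall>n. p n = K * real n powr (- \<beta>)))
       \<or> (\<exists>K>0. \<forall>n. p n = K * ln (real n) / real n)"
  shows "\<exists>pt. p \<longlonglongrightarrow> pt \<and> filterlim (\<lambda>n. real n * p n) at_top sequentially"
  using assms
proof (elim disjE exE conjE)
  fix pt :: real assume "0 < pt" "p \<longlonglongrightarrow> pt"
  then show ?thesis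
    using filterlim_tendsto_pos_mult_at_top[of p pt sequentially real] filterlim_real_sequentially
    by (auto simp: mult.commute)
next
  fix K \<beta> :: real assume "0 < K" "0 < \<beta>" "\<beta> < 1" and p: "\<forall>n. p n = K * real n powr (- \<beta>)"
  then have "p = (\<lambda>n. K * real n powr (- \<beta>))" by auto
  moreover have "(\<lambda>n. K * real n powr (- \<beta>)) \<longlonglongrightarrow> 0" using \<open>0 < \<beta>\<close> by real_asymp
  moreover have "filterlim (\<lambda>n. real n * (K * real n powr (- \<beta>))) at_top sequentially"
    using \<open>0 < K\<close> \<open>\<beta> < 1\<close> by real_asymp
  ultimately show ?thesis by auto
next
  fix K :: real assume "0 < K" and p: "\<forall>n. p n = K * ln (real n) / real n"
  then have "p = (\<lambda>n. K * ln (real n) / real n)" by auto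
  moreover have "(\<lambda>n. K * ln (real n) / real n) \<longlonglongrightarrow> 0" by real_asymp
  moreover have "filterlim (\<lambda>n. real n * (K * ln (real n) / real n)) at_top sequentially"
    using \<open>0 < K\<close> by real_asymp
  ultimately show ?thesis by auto
qed

theorem mainTheorem1:
  fixes p :: "nat \<Rightarrow> real" and F :: "(real ^ 'd::finite) measure" and k0 :: nat
  assumes p_range: "\<forall>n. 0 \<le> p n \<and> p n \<le> 1"
    and p_regime:
      "(\<exists>pt>0. p \<longlonglongrightarrow> pt)
       \<or> (\<exists>K>0. \<exists>\<beta>. 0 < \<beta> \<and> \<beta> < 1 \<and> (\<forall>n. p n = K * real n powr (- \<beta>)))
       \<or> (\<exists>K>0. \<forall>n. p n = K * ln (real n) / real n)"
    and F_prob: "prob_space F"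
    and F_borel: "sets F = sets borel"
    and F_bounded: "\<exists>B. AE x in F. norm x \<le> B"
  shows "\<forall>t e. wf CARD('d) k0 0 t e \<longrightarrow> closed_term_aas_converges k0 p F e t"
proof -
  obtain pt where "p \<longlonglongrightarrow> pt" "filterlim (\<lambda>n. real n * p n) at_top sequentially"
    using regime_limits[OF p_regime] by blast
  then have "er_features F p pt"
    using p_range F_prob by (simp add: er_features_def er_features_axioms_def)
  then show ?thesis
    using F_bounded F_borel closed_term_converges by blast
qed

end
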